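(* Let $d\ge 3$ be an integer, $\mathbb F_d=\mathbb Q(\cos^2(\pi/d))\subset\mathbb R$, and let $\alpha$ be a totally real algebraic integer (a real number), $\mathbb K=\mathbb F_d(\alpha)$, such that $4<\alpha<16^2$ and $0<\sigma(\alpha)<\sigma(4\sin^2(\pi/d))$ for every field embedding $\sigma:\mathbb K\to\mathbb R$ other than the identity inclusion. Then $\mathbb K=\mathbb Q(\alpha)$, and such $\alpha$ can exist only for the values of $d$ listed below, with $m=[\mathbb K:\mathbb F_d]$ bounded as follows: $d=3$: $m\le47$; $d=4$: $m\le16$; $d=5$: $m\le10$; $d=6$: $m\le8$; $d=7$: $m\le10$; $d=8$: $m\le9$; $d=9$: $m\le5$; $d=10$: $m\le5$; $d=11$: $m\le4$; $d=12$: $m\le5$; $d=13$: $m\le3$; $d=14$: $m\le3$; $d=15$: $m\le2$; $d=16$: $m\le3$; $d=17$: $m\le2$; $d=18$: $m\le4$; $d=19$: $m\le2$; $d=20$: $m\le3$; $d=21$: $m\le2$; $d=22$: $m\le2$; $d=24$: $m\le3$; $d=26$: $m\le2$; $d=28$: $m\le2$; $d=30$: $m\le3$; $d=36$: $m\le2$; $d=42$: $m\le2$; and for $d\in\{23,25,27,29,31,32,33,34,35,38,39,40,44,45,46,48,50,52,54,56,58,60,62,64,66,70,72,78,80,84,90,96,102,120\}$ one has $m=1$, i.e. $\mathbb K=\mathbb F_d$. In particular $[\mathbb K:\mathbb Q]\le47$ for $d=3$, $[\mathbb K:\mathbb Q]\le30$ for $d=7$, $[\mathbb K:\mathbb Q]\le20$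 for $d=5,11$, $[\mathbb K:\mathbb Q]\le18$ for $d=8,13,19$, and $[\mathbb K:\mathbb Q]\le16$ for all remaining $d$.
   Context: All fields are regarded as subfields of $\mathbb R$; "the identity inclusion" is the given embedding $\mathbb K\subset\mathbb R$. *)

theory Defs
  imports "HOL-Analysis.Analysis" "HOL-Computational_Algebra.Polynomial"
begin

definition is_subfield :: "real set \<Rightarrow> bool" where
  "is_subfield K \<longleftrightarrow> 0 \<in> K \<and> 1 \<in> K \<and>
     (\<forall>x\<in>K. \<forall>y\<in>K. x + y \<in> K \<and> x * y \<in> K) \<and>
     (\<forall>x\<in>K. - x \<in> K) \<and> (\<forall>x\<in>K. x \<noteq> 0 \<longrightarrow> inverse x \<in> K)"

definition gen_field :: "real set \<Rightarrow> real set" where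
  "gen_field S = \<Inter>{K. is_subfield K \<and> S \<subseteq> K}"

text \<open>Field embeddings of a subfield K of R into R, resp. into C
  (only the values on K matter).\<close>
definition real_emb :: "real set \<Rightarrow> (real \<Rightarrow> real) \<Rightarrow> bool" where
  "real_emb K \<sigma> \<longleftrightarrow> \<sigma> 1 = 1 \<and>
     (\<forall>x\<in>K. \<forall>y\<in>K. \<sigma> (x + y) = \<sigma> x + \<sigma> y \<and> \<sigma> (x * y) = \<sigma> x * \<sigma> y)"

definition complex_emb :: "real set \<Rightarrow> (real \<Rightarrow> complex) \<Rightarrow> bool" where
  "complex_emb K \<sigma> \<longleftrightarrow> \<sigma> 1 = 1 \<and>
     (\<forall>x\<in>K. \<forall>y\<in>K. \<sigma> (x + y) = \<sigma> x + \<sigma> y \<and> \<sigma> (x * y) = \<sigma> x * \<sigma> y)"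

definition totally_real :: "real \<Rightarrow> bool" where
  "totally_real \<alpha> \<longleftrightarrow> algebraic \<alpha> \<and>
     (\<forall>\<sigma>. complex_emb (gen_field {\<alpha>}) \<sigma> \<longrightarrow> \<sigma> \<alpha> \<in> \<real>)"

text \<open>Degree [K:F] = dimension of K as an F-vector space
  (size of a smallest finite F-spanning set of K, i.e. of a basis).\<close>
definition fdeg :: "real set \<Rightarrow> real set \<Rightarrow> nat" where
  "fdeg K F = (LEAST n. \<exists>B. finite B \<and> B \<subseteq> K \<and> card B = n \<and>
      (\<forall>x\<in>K. \<exists>c. (\<forall>b\<in>B. c b \<in> F) \<and> x = (\<Sum>b\<in>B. c b * b)))"

definition Fd :: "nat \<Rightarrow> real set" where
  "Fd d = gen_field {cos (pi / real d) ^ 2}"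

definition mbound :: "nat \<Rightarrow> nat" where
  "mbound d = (if d = 3 then 47 else if d = 4 then 16 else if d = 5 then 10
     else if d = 6 then 8 else if d = 7 then 10 else if d = 8 then 9
     else if d = 9 then 5 else if d = 10 then 5 else if d = 11 then 4
     else if d = 12 then 5 else if d = 13 then 3 else if d = 14 then 3
     else if d = 15 then 2 else if d = 16 then 3 else if d = 17 then 2
     else if d = 18 then 4 else if d = 19 then 2 else if d = 20 then 3
     else if d = 21 then 2 else if d = 22 then 2 else if d = 24 then 3
     else if d = 26 then 2 else if d = 28 then 2 else if d = 30 then 3
     else if d = 36 then 2 else if d = 42 then 2 else 1)"

definition admissible_d :: "nat set" where
  "admissible_d = {3..22} \<union> {24, 26, 28, 30, 36, 42} \<union>
     {23,25,27,29,31,32,33,34,35,38,39,40,44,45,46,48,50,52,54,56,58,60,62,64,66,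
      70,72,78,80,84,90,96,102,120}"

definition qbound :: "nat \<Rightarrow> nat" where
  "qbound d = (if d = 3 then 47 else if d = 7 then 30 else if d \<in> {5, 11} then 20
     else if d \<in> {8, 13, 19} then 18 else 16)"

end

theory Submission
  imports Defs "Jordan_Normal_Form.Char_Poly" "HOL-Number_Theory.Totient"
    "HOL-Number_Theory.Prime_Powers" "HOL-Library.Code_Binary_Nat"
begin

text \<open>
  Put \<open>s = 4 sin\<^sup>2(\<pi>/d)\<close> and \<open>n = [F\<^sub>d : \<rat>] = \<phi>(d)/2\<close>. The conjugates of \<open>s\<close> are the numbers
  \<open>4 sin\<^sup>2(\<pi>k/d)\<close> with \<open>k\<close> prime to \<open>d\<close>; each is taken by exactly \<open>m\<close> of the \<open>nm\<close> embeddings of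
  \<open>K\<close>, and their product is \<open>\<gamma> = exp (\<Lambda>(d))\<close>, which is \<open>p\<close> for a power of a prime \<open>p\<close> and
  \<open>1\<close> otherwise. If \<open>q\<close> is an integral polynomial with \<open>q(\<alpha>, s) \<noteq> 0\<close>, then \<open>q(\<alpha>, s)\<close> has norm at
  least \<open>1\<close> in absolute value. If moreover \<open>|q(a, b)| \<le> b\<^sup>k G\<close> for \<open>0 < a < b\<close>, then
  \<open>s\<^sup>k G \<le> |q(\<alpha>, s)| (\<gamma>\<^sup>k G\<^sup>n)\<^sup>m\<close>, which bounds \<open>m\<close> as soon as \<open>\<gamma>\<^sup>k G\<^sup>n < 1\<close>.

  For most \<open>d\<close> the choice \<open>q = a (b - a)\<close>, \<open>k = 2\<close>, \<open>G = 1/4\<close> suffices. For the remaining \<open>d\<close>, mostly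
  odd prime powers, one multiplies in further factors which are small on the interval; in terms of
  \<open>w = a (b - a)/b\<^sup>2 \<in> [0, 1/4]\<close> these are \<open>1 - 4w\<close>, \<open>1 - 5w\<close>, \<open>1 - 7w\<close>, \<open>1 - 9w\<close> and \<open>2 - 9w\<close>.
  For \<open>d = 3, 5, 7\<close> some of them are integral without being multiplied by \<open>b\<^sup>2\<close>, because \<open>d/b\<^sup>2\<close>
  (respectively \<open>9/b\<^sup>2\<close>) is integral.

  A nontrivial embedding of \<open>K\<close> cannot fix \<open>\<alpha> > 4 \<ge> s\<close>, hence \<open>K = \<rat>(\<alpha>)\<close>.
\<close>

section \<open>Algebraic integers\<close>

text \<open>Only the identity takes \<open>\<alpha>\<close> outside the interval from 0 to the
  conjugate of \<open>s\<close>, and there \<open>|q|\<close> is below \<open>256^2\<close> for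
  \<open>q = a (b - a)\<close>. This single large factor must be outweighed by
  \<open>(gamma^2 / 4^n)^m\<close>. As \<open>s\<close> is of order \<open>1/d^2\<close> while
  \<open>4^n = 2^totient d\<close> grows faster than any power of \<open>d\<close>, an estimate of
  Euler's function settles \<open>d \<ge> 210\<close> and leaves a finite computation. A prime power
  costs \<open>gamma = p\<close>, which is why small odd primes are the hard cases. Existence and
  degree are the same question: where \<open>d\<close> is to be excluded, the bound obtained is
  \<open>m < 1\<close>.

  Embeddings are not counted as maps. A primitive element \<open>\<theta> = \<alpha> + l s\<close>
  turns them into the real roots of its minimal polynomial, \<open>\<alpha>\<close> and
  \<open>s\<close> into rational polynomials in \<open>\<theta>\<close>, and norms into products
  over roots. No Galois theory enters: characteristic polynomials of rational matrices give the
  fibre sizes, and counting common roots of two polynomials gives the degrees. The fibre size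
  \<open>m\<close> bounds \<open>[K : F_d]\<close> from above, which is the direction asked
  for.\<close>

lemma algebraic_int_if_int_eigenvector:
  fixes x :: "'a::field_char_0" and v :: "nat \<Rightarrow> 'a" and M :: "nat \<Rightarrow> nat \<Rightarrow> int"
  assumes eig: "\<And>i. i < n \<Longrightarrow> (\<Sum>j<n. of_int (M i j) * v j) = x * v i"
    and nz: "i0 < n" "v i0 \<noteq> 0"
  shows "algebraic_int x"
proof -
  define A where "A = mat n n (\<lambda>(i,j). M i j)"
  have A: "A \<in> carrier_mat n n" by (simp add: A_def)
  have B: "map_mat (of_int :: int \<Rightarrow> 'a) A \<in> carrier_mat n n" using A by simp
  have "map_mat (of_int :: int \<Rightarrow> 'a) A *\<^sub>v vec n v = x \<cdot>\<^sub>v vec n v"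
  proof (rule eq_vecI)
    fix i assume "i < dim_vec (x \<cdot>\<^sub>v vec n v)"
    hence i: "i < n" by simp
    have "(map_mat (of_int :: int \<Rightarrow> 'a) A *\<^sub>v vec n v) $ i = (\<Sum>j\<in>{0..<n}. of_int (M i j) * v j)"
      using i by (simp add: A_def scalar_prod_def)
    also have "\<dots> = x * v i" using eig[OF i] by (simp add: atLeast0LessThan)
    finally show "(map_mat (of_int :: int \<Rightarrow> 'a) A *\<^sub>v vec n v) $ i = (x \<cdot>\<^sub>v vec n v) $ i"
      using i by simp
  qed (use A in auto)
  moreover have "vec n v \<noteq> 0\<^sub>v n"
    using nz by (metis index_vec index_zero_vec(1))
  ultimately have "eigenvalue (map_mat (of_int :: int \<Rightarrow> 'a) A) x"
    using A unfolding eigenvalue_def eigenvector_def by (intro exI[of _ "vec n v"]) auto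
  hence "poly (char_poly (map_mat (of_int :: int \<Rightarrow> 'a) A)) x = 0"
    using eigenvalue_root_char_poly[OF B] by simp
  hence "poly (map_poly of_int (char_poly A)) x = 0"
    using of_int_hom.char_poly_hom[OF A, where 'a = 'a] by simp
  moreover have "lead_coeff (char_poly A) = 1" using degree_monic_char_poly[OF A] by simp
  ultimately show ?thesis unfolding algebraic_int_altdef_ipoly by blast
qed

lemma algebraic_int_power_reduce:
  fixes x :: "'a::field_char_0"
  assumes "algebraic_int x"
  obtains n c where "n > 0" "x ^ n = (\<Sum>i<n. of_int (c i) * x ^ i)"
proof -
  obtain p where p: "poly (map_poly of_int p) x = 0" "lead_coeff p = 1"
    using assms algebraic_int_altdef_ipoly by blast
  define n where "n = degree p"
  have npos: "n > 0"
  proof (rule ccontr)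
    assume "\<not> n > 0"
    hence "p = [:1:]" using p(2) degree0_coeffs[of p] by (auto simp: n_def)
    thus False using p(1) by simp
  qed
  have "degree (map_poly of_int p :: 'a poly) = n"
    by (simp add: n_def)
  hence "0 = (\<Sum>i\<le>n. of_int (coeff p i) * x ^ i)"
    using p(1) by (simp add: poly_altdef)
  also have "\<dots> = (\<Sum>i<n. of_int (coeff p i) * x ^ i) + x ^ n"
    using p(2) by (simp add: n_def lessThan_Suc_atMost[symmetric])
  finally have "x ^ n = - (\<Sum>i<n. of_int (coeff p i) * x ^ i)"
    by (metis add.commute eq_neg_iff_add_eq_0)
  hence "x ^ n = (\<Sum>i<n. of_int (- coeff p i) * x ^ i)"
    by (simp add: sum_negf)
  thus ?thesis by (rule that[OF npos])
qed

definition zspan :: "(nat \<Rightarrow> 'a::field_char_0) \<Rightarrow> nat \<Rightarrow> 'a set" where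
  "zspan v n = {y. \<exists>c. y = (\<Sum>j<n. of_int (c j) * v j)}"

lemma zspan_base: "j < n \<Longrightarrow> v j \<in> zspan v n"
proof -
  assume j: "j < n"
  have "(\<Sum>i<n. of_int (if i = j then 1 else 0) * v i) = (\<Sum>i<n. if i = j then v i else 0)"
    by (intro sum.cong) auto
  also have "\<dots> = v j" using j by simp
  finally have "v j = (\<Sum>i<n. of_int (if i = j then 1 else 0) * v i)" by (rule sym)
  thus ?thesis unfolding zspan_def mem_Collect_eq by (rule exI[of _ "\<lambda>i. if i = j then 1 else 0"])
qed

lemma zspan_add: "x \<in> zspan v n \<Longrightarrow> y \<in> zspan v n \<Longrightarrow> x + y \<in> zspan v n"
proof -
  assume "x \<in> zspan v n" "y \<in> zspan v n"
  then obtain c d where "x = (\<Sum>j<n. of_int (c j) * v j)" "y = (\<Sum>j<n. of_int (d j) * v j)"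
    unfolding zspan_def by auto
  hence "x + y = (\<Sum>j<n. of_int (c j + d j) * v j)"
    by (simp add: sum.distrib algebra_simps)
  thus ?thesis unfolding zspan_def mem_Collect_eq by (rule exI[of _ "\<lambda>j. c j + d j"])
qed

lemma zspan_smult: "x \<in> zspan v n \<Longrightarrow> of_int k * x \<in> zspan v n"
proof -
  assume "x \<in> zspan v n"
  then obtain c where "x = (\<Sum>j<n. of_int (c j) * v j)"
    unfolding zspan_def by auto
  hence "of_int k * x = (\<Sum>j<n. of_int (k * c j) * v j)"
    by (simp add: sum_distrib_left algebra_simps)
  thus ?thesis unfolding zspan_def mem_Collect_eq by (rule exI[of _ "\<lambda>j. k * c j"])
qed

lemma zspan_0: "0 \<in> zspan v n"
  unfolding zspan_def mem_Collect_eq by (rule exI[of _ "\<lambda>_. 0"]) simp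

lemma zspan_sum: "(\<And>i. i \<in> I \<Longrightarrow> f i \<in> zspan v n) \<Longrightarrow> sum f I \<in> zspan v n"
  by (induction I rule: infinite_finite_induct) (auto intro: zspan_0 zspan_add)

lemma zspan_mult_closed:
  assumes "\<And>j. j < n \<Longrightarrow> x * v j \<in> zspan v n" "y \<in> zspan v n"
  shows "x * y \<in> zspan v n"
proof -
  obtain c where c: "y = (\<Sum>j<n. of_int (c j) * v j)"
    using assms(2) unfolding zspan_def by auto
  have "x * y = (\<Sum>j<n. of_int (c j) * (x * v j))"
    by (simp add: c sum_distrib_left algebra_simps)
  also have "\<dots> \<in> zspan v n" by (intro zspan_sum zspan_smult assms(1)) auto
  finally show ?thesis .
qed

text \<open>Multiplication by \<open>x\<close> acts on the generators by an integer matrix with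
  eigenvalue \<open>x\<close>, and the characteristic polynomial of that matrix is monic and
  integral.\<close>

lemma algebraic_int_if_zspan_stable:
  assumes "\<And>j. j < n \<Longrightarrow> x * v j \<in> zspan v n" "i0 < n" "v i0 \<noteq> 0"
  shows "algebraic_int x"
proof -
  have "\<forall>j. \<exists>c. j < n \<longrightarrow> x * v j = (\<Sum>k<n. of_int (c k) * v k)"
    using assms(1) unfolding zspan_def by blast
  then obtain M where "\<And>j. j < n \<Longrightarrow> x * v j = (\<Sum>k<n. of_int (M j k) * v k)"
    by metis
  thus ?thesis using assms(2,3) by (intro algebraic_int_if_int_eigenvector[of n M v x i0]) auto
qed

text \<open>Both closure properties come from the same finitely generated module \<open>\<int>[x, y]\<close>,
  which is stable under multiplication by \<open>x\<close> and by \<open>y\<close>.\<close>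

lemma algebraic_int_plus_times:
  fixes x y :: "'a::field_char_0"
  assumes "algebraic_int x" "algebraic_int y"
  shows "algebraic_int (x + y) \<and> algebraic_int (x * y)"
proof -
  obtain n c where n: "n > 0" "x ^ n = (\<Sum>i<n. of_int (c i) * x ^ i)"
    using algebraic_int_power_reduce[OF assms(1)] by blast
  obtain m e where m: "m > 0" "y ^ m = (\<Sum>i<m. of_int (e i) * y ^ i)"
    using algebraic_int_power_reduce[OF assms(2)] by blast
  \<comment> \<open>The pair of exponents \<open>(i, j)\<close> with \<open>i < n\<close>,
    \<open>j < m\<close> is coded as \<open>i * m + j\<close>.\<close>
  define v where "v k = x ^ (k div m) * y ^ (k mod m)" for k
  have idx: "x ^ i * y ^ j \<in> zspan v (n * m)" if "i < n" "j < m" for i j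
  proof -
    have "i * m + j < Suc i * m" using that by simp
    also have "\<dots> \<le> n * m" using that by (intro mult_le_mono) auto
    finally have "i * m + j < n * m" .
    moreover have "v (i * m + j) = x ^ i * y ^ j" using that by (simp add: v_def)
    ultimately show ?thesis using zspan_base by metis
  qed
  have X: "x * v k \<in> zspan v (n * m)" if k: "k < n * m" for k
  proof -
    define i j where "i = k div m" and "j = k mod m"
    have ij: "i < n" "j < m" using k m(1) by (auto simp: i_def j_def less_mult_imp_div_less)
    show ?thesis
    proof (cases "Suc i < n")
      case True
      have "x * v k = x ^ Suc i * y ^ j" by (simp add: v_def i_def j_def)
      thus ?thesis using idx[OF True ij(2)] by metis
    next
      case False
      hence "Suc i = n" using ij by simp
      moreover have "x * v k = x ^ Suc i * y ^ j" by (simp add: v_def i_def j_def)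
      ultimately have "x * v k = x ^ n * y ^ j" by metis
      also have "\<dots> = (\<Sum>i<n. of_int (c i) * (x ^ i * y ^ j))"
        by (simp add: n(2) sum_distrib_right mult.assoc)
      also have "\<dots> \<in> zspan v (n * m)" by (intro zspan_sum zspan_smult idx) (use ij in auto)
      finally show ?thesis .
    qed
  qed
  have Y: "y * v k \<in> zspan v (n * m)" if k: "k < n * m" for k
  proof -
    define i j where "i = k div m" and "j = k mod m"
    have ij: "i < n" "j < m" using k m(1) by (auto simp: i_def j_def less_mult_imp_div_less)
    show ?thesis
    proof (cases "Suc j < m")
      case True
      have "y * v k = x ^ i * y ^ Suc j" by (simp add: v_def i_def j_def)
      thus ?thesis using idx[OF ij(1) True] by metis
    next
      case False
      hence "Suc j = m" using ij by simp
      moreover have "y * v k = x ^ i * y ^ Suc j" by (simp add: v_def i_def j_def)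
      ultimately have "y * v k = x ^ i * y ^ m" by metis
      also have "\<dots> = (\<Sum>l<m. of_int (e l) * (x ^ i * y ^ l))"
        by (simp add: m(2) sum_distrib_left algebra_simps)
      also have "\<dots> \<in> zspan v (n * m)" by (intro zspan_sum zspan_smult idx) (use ij in auto)
      finally show ?thesis .
    qed
  qed
  have z: "0 < n * m" "v 0 \<noteq> 0" using n m by (auto simp: v_def)
  have "algebraic_int (x + y)"
  proof (rule algebraic_int_if_zspan_stable[where v = v and n = "n * m" and ?i0.0 = 0])
    fix j assume "j < n * m"
    thus "(x + y) * v j \<in> zspan v (n * m)" using X Y by (simp add: ring_distribs zspan_add)
  qed (use z in auto)
  moreover have "algebraic_int (x * y)"
  proof (rule algebraic_int_if_zspan_stable[where v = v and n = "n * m" and ?i0.0 = 0])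
    fix j assume "j < n * m"
    thus "(x * y) * v j \<in> zspan v (n * m)" using zspan_mult_closed[OF X Y] by (simp add: mult.assoc)
  qed (use z in auto)
  ultimately show ?thesis by blast
qed

lemmas algebraic_int_plus = algebraic_int_plus_times[THEN conjunct1]
  and algebraic_int_times = algebraic_int_plus_times[THEN conjunct2]

lemma algebraic_int_diff:
  fixes x y :: "'a::field_char_0"
  shows "algebraic_int x \<Longrightarrow> algebraic_int y \<Longrightarrow> algebraic_int (x - y)"
  using algebraic_int_plus[of x "-y"] by simp

lemma algebraic_int_prod:
  fixes f :: "'b \<Rightarrow> 'a::field_char_0"
  shows "(\<And>i. i \<in> I \<Longrightarrow> algebraic_int (f i)) \<Longrightarrow> algebraic_int (prod f I)"
  by (induction I rule: infinite_finite_induct) (auto intro: algebraic_int_times)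

lemma algebraic_int_sum:
  fixes f :: "'b \<Rightarrow> 'a::field_char_0"
  shows "(\<And>i. i \<in> I \<Longrightarrow> algebraic_int (f i)) \<Longrightarrow> algebraic_int (sum f I)"
  by (induction I rule: infinite_finite_induct) (auto intro: algebraic_int_plus)

lemma algebraic_int_power:
  fixes x :: "'a::field_char_0"
  shows "algebraic_int x \<Longrightarrow> algebraic_int (x ^ n)"
  by (induction n) (auto intro: algebraic_int_times)

section \<open>Minimal polynomials and conjugates\<close>

abbreviation rpoly :: "rat poly \<Rightarrow> 'a::field_char_0 \<Rightarrow> 'a" where
  "rpoly p x \<equiv> poly (map_poly of_rat p) x"

context
  fixes x :: "'a::field_char_0"
begin

interpretation m: map_poly_comm_ring_hom "of_rat :: rat \<Rightarrow> 'a" ..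

lemma rpoly_add: "rpoly (p + q) x = rpoly p x + rpoly q x"
  by (simp add: m.hom_add)

lemma rpoly_uminus: "rpoly (- p) x = - rpoly p x"
  by (simp add: m.hom_uminus)

lemma rpoly_diff: "rpoly (p - q) x = rpoly p x - rpoly q x"
  by (simp add: m.hom_minus)

lemma rpoly_mult: "rpoly (p * q) x = rpoly p x * rpoly q x"
  by (simp add: m.hom_mult)

lemma rpoly_pcompose: "rpoly (pcompose p q) x = rpoly p (rpoly q x)"
  by (simp add: of_rat_hom.map_poly_pcompose poly_pcompose)

lemma rpoly_const: "rpoly [:c:] x = of_rat c"
  by (simp add: of_rat_hom.map_poly_pCons_hom)

lemma rpoly_X: "rpoly [:0, 1:] x = x"
  by (simp add: of_rat_hom.map_poly_pCons_hom)

lemma rpoly_smult: "rpoly (Polynomial.smult c p) x = of_rat c * rpoly p x"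
  using rpoly_mult[of "[:c:]" p] by (simp add: rpoly_const)

end

lemma of_real_of_rat: "complex_of_real (of_rat r) = of_rat r"
  by (cases r) (simp add: of_rat_rat)

lemma rpoly_of_real: "rpoly p (complex_of_real x) = complex_of_real (rpoly p x)"
proof -
  have "map_poly of_rat p = map_poly complex_of_real (map_poly of_rat p)"
    by (intro poly_eqI) (simp add: coeff_map_poly of_real_of_rat)
  thus ?thesis by (metis of_real_hom.poly_map_poly)
qed

text \<open>Divisibility takes the place of irreducibility. The field of \<open>x\<close> is left
  open, since one rational \<open>f\<close> serves a real number and all its complex
  conjugates.\<close>

definition is_minpoly :: "rat poly \<Rightarrow> 'a::field_char_0 \<Rightarrow> bool" where
  "is_minpoly f x \<longleftrightarrow> lead_coeff f = 1 \<and> rpoly f x = 0 \<and> (\<forall>g. rpoly g x = 0 \<longrightarrow> f dvd g)"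

lemma is_minpolyD:
  assumes "is_minpoly f x"
  shows "lead_coeff f = 1" "rpoly f x = 0" "rpoly g x = 0 \<Longrightarrow> f dvd g"
  using assms by (auto simp: is_minpoly_def)

lemma is_minpoly_degree_pos:
  assumes "is_minpoly f x"
  shows "degree f > 0"
proof (rule ccontr)
  assume "\<not> degree f > 0"
  hence "f = [:1:]" using is_minpolyD(1)[OF assms] degree0_coeffs[of f] by auto
  thus False using is_minpolyD(2)[OF assms] by (simp add: rpoly_const)
qed

lemma is_minpoly_of_root:
  assumes "rpoly p x = 0" "p \<noteq> 0"
  shows "\<exists>f. is_minpoly f x"
proof -
  define P where "P q \<longleftrightarrow> q \<noteq> 0 \<and> rpoly q x = 0" for q
  define q where "q = arg_min degree P"
  have q: "P q" "\<And>r. P r \<Longrightarrow> degree q \<le> degree r"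
    using arg_min_nat_lemma[of P p degree] assms by (auto simp: q_def P_def)
  define f where "f = Polynomial.smult (inverse (lead_coeff q)) q"
  have qnz: "q \<noteq> 0" using q by (simp add: P_def)
  have f: "lead_coeff f = 1" "rpoly f x = 0" "degree f = degree q"
    using q(1) qnz by (auto simp: f_def P_def rpoly_smult)
  have fnz: "f \<noteq> 0" using f(1) by auto
  have "f dvd g" if g: "rpoly g x = 0" for g
  proof -
    have "rpoly (g mod f) x = 0"
      using rpoly_add[of "f * (g div f)" "g mod f" x] g f(2) by (simp add: rpoly_mult)
    hence "g mod f = 0"
      using q(2)[of "g mod f"] f(3) degree_mod_less'[OF fnz, of g] unfolding P_def
      by (metis leD)
    thus ?thesis by auto
  qed
  thus ?thesis using f unfolding is_minpoly_def by blast
qed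

lemma is_minpoly_exists:
  fixes x :: "'a::field_char_0"
  assumes "algebraic_int x"
  shows "\<exists>f. is_minpoly f x"
proof -
  obtain p :: "int poly" where p: "lead_coeff p = 1" "poly (map_poly of_int p) x = 0"
    using assms by (auto simp: algebraic_int_altdef_ipoly)
  have "map_poly of_rat (map_poly of_int p) = (map_poly of_int p :: 'a poly)"
    by (intro poly_eqI) (simp add: coeff_map_poly)
  hence "rpoly (map_poly of_int p) x = 0" using p by simp
  moreover have "map_poly rat_of_int p \<noteq> 0" using p by auto
  ultimately show ?thesis by (rule is_minpoly_of_root)
qed

text \<open>Irreducibility in the form used below; \<open>z\<close> may live in another field than
  \<open>x\<close>. If \<open>f = g * q\<close> with \<open>g\<close> minimal for \<open>z\<close>,
  then \<open>x\<close> is not a root of \<open>q\<close> for reasons of degree, so it is a root of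
  \<open>g\<close>, and \<open>f\<close> and \<open>g\<close> divide each other.\<close>

lemma is_minpoly_conjugate:
  assumes f: "is_minpoly f x" and z: "rpoly f z = 0"
  shows "is_minpoly f z"
proof -
  have fnz: "f \<noteq> 0" using is_minpolyD(1)[OF f] by auto
  obtain g where g: "is_minpoly g z" using is_minpoly_of_root[OF z fnz] by blast
  obtain q where q: "f = g * q" using is_minpolyD(3)[OF g z] by (auto elim: dvdE)
  have qnz: "g \<noteq> 0" "q \<noteq> 0" using q fnz by auto
  have "rpoly g x * rpoly q x = 0" using is_minpolyD(2)[OF f] q by (simp add: rpoly_mult)
  moreover have "rpoly q x \<noteq> 0"
  proof
    assume "rpoly q x = 0"
    hence "degree f \<le> degree q" using is_minpolyD(3)[OF f] qnz by (blast intro: dvd_imp_degree_le)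
    thus False using q qnz is_minpoly_degree_pos[OF g] by (simp add: degree_mult_eq)
  qed
  ultimately have "f dvd g" using is_minpolyD(3)[OF f] by simp
  moreover have "g dvd f" using q by simp
  ultimately have "f = g" using is_minpolyD(1)[OF f] is_minpolyD(1)[OF g] poly_dvd_antisym
    by metis
  thus ?thesis using g by simp
qed

text \<open>\<open>f\<close> is also the minimal polynomial of a supposed double root, so it would
  divide its own derivative.\<close>

lemma is_minpoly_rsquarefree:
  fixes x :: "'a::field_char_0"
  assumes f: "is_minpoly f x"
  shows "rsquarefree (map_poly of_rat f :: 'b::field_char_0 poly)"
  unfolding rsquarefree_roots
proof (intro allI notI, elim conjE)
  fix z :: 'b assume z: "rpoly f z = 0" "poly (pderiv (map_poly of_rat f)) z = 0"
  have "rpoly (pderiv f) z = 0" using z(2) by (simp add: of_rat_hom.map_poly_pderiv)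
  hence "f dvd pderiv f" by (rule is_minpolyD(3)[OF is_minpoly_conjugate[OF f z(1)]])
  moreover have "pderiv f \<noteq> 0" using is_minpoly_degree_pos[OF f] by (simp add: pderiv_eq_0_iff)
  ultimately have "degree f \<le> degree (pderiv f)" by (rule dvd_imp_degree_le)
  hence "degree f \<le> degree f - 1" by (simp only: degree_pderiv)
  thus False using is_minpoly_degree_pos[OF f] by simp
qed

definition conjs :: "rat poly \<Rightarrow> complex set" where
  "conjs f = {z. rpoly f z = 0}"

lemma is_minpoly_conjs:
  fixes x :: "'a::field_char_0"
  assumes f: "is_minpoly f x"
  shows "finite (conjs f)" "card (conjs f) = degree f"
    and "map_poly of_rat f = (\<Prod>z\<in>conjs f. [:-z, 1:])"
proof -
  have fnz: "(map_poly of_rat f :: complex poly) \<noteq> 0" using is_minpolyD(1)[OF f] by auto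
  show "finite (conjs f)" unfolding conjs_def using fnz poly_roots_finite by blast
  show "card (conjs f) = degree f"
    using is_minpoly_rsquarefree[OF f, where 'b = complex] rsquarefree_card_degree[OF fnz]
    by (simp add: conjs_def)
  show "map_poly of_rat f = (\<Prod>z\<in>conjs f. [:-z, 1:])"
    using complex_poly_decompose_rsquarefree[OF is_minpoly_rsquarefree[OF f]] is_minpolyD(1)[OF f]
    by (simp add: conjs_def)
qed

text \<open>A kernel vector is the coefficient list of a nonzero polynomial of degree below
  \<open>n\<close> with \<open>n\<close> roots.\<close>

lemma vandermonde_nonzero:
  fixes z :: "nat \<Rightarrow> 'a::field"
  assumes "inj_on z {..<n}"
  shows "det (mat n n (\<lambda>(i,j). z i ^ j)) \<noteq> 0"
proof
  assume "det (mat n n (\<lambda>(i,j). z i ^ j)) = 0"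
  then obtain v where v: "v \<in> carrier_vec n" "v \<noteq> 0\<^sub>v n" "mat n n (\<lambda>(i,j). z i ^ j) *\<^sub>v v = 0\<^sub>v n"
    using det_0_iff_vec_prod_zero_field[of "mat n n (\<lambda>(i,j). z i ^ j)" n] by auto
  define p where "p = (\<Sum>j<n. monom (v $ j) j)"
  have cp: "coeff p j = v $ j" if "j < n" for j
    using that by (simp add: p_def coeff_sum)
  have pz: "poly p (z i) = 0" if i: "i < n" for i
  proof -
    have "poly p (z i) = (\<Sum>j<n. v $ j * z i ^ j)" by (simp add: p_def poly_sum poly_monom)
    also have "\<dots> = (mat n n (\<lambda>(i,j). z i ^ j) *\<^sub>v v) $ i"
      using i v(1) by (auto simp: scalar_prod_def atLeast0LessThan mult.commute intro!: sum.cong)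
    also have "\<dots> = 0" using v(3) i by simp
    finally show ?thesis .
  qed
  have pnz: "p \<noteq> 0"
  proof
    assume "p = 0"
    hence "v = 0\<^sub>v n" using cp v(1) by (intro eq_vecI) auto
    thus False using v(2) by simp
  qed
  have npos: "n > 0" using v(1,2) by (cases n) auto
  have "degree p \<le> n - 1"
    unfolding p_def by (intro degree_sum_le) (auto intro: order.trans[OF degree_monom_le])
  moreover have "n \<le> degree p"
  proof -
    have "card (z ` {..<n}) \<le> card {x. poly p x = 0}"
      using pz pnz poly_roots_finite by (intro card_mono) auto
    also have "\<dots> \<le> degree p" using pnz by (rule card_poly_roots_bound)
    finally show ?thesis using assms by (simp add: card_image)
  qed
  ultimately show False using npos by simp
qed

text \<open>The matrix of multiplication by \<open>h(x)\<close> in the basis of powers of \<open>x\<close> is rational and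
  becomes diagonal, with entries \<open>h(z)\<close>, after conjugation by a Vandermonde matrix.\<close>

lemma conj_char_poly:
  fixes x :: "'a::field_char_0"
  assumes f: "is_minpoly f x"
  shows "\<exists>g. map_poly of_rat g = (\<Prod>z\<in>conjs f. [:- rpoly h z, 1:])"
proof -
  define n where "n = degree f"
  have fin: "finite (conjs f)" and card: "card (conjs f) = n"
    using is_minpoly_conjs[OF f] by (auto simp: n_def)
  obtain z where z: "bij_betw z {..<n} (conjs f)"
    using ex_bij_betw_nat_finite[OF fin] card by (auto simp: atLeast0LessThan)
  define M where "M = mat n n (\<lambda>(j,k). coeff ((h * monom 1 j) mod f) k)"
  define M' :: "complex mat" where "M' = map_mat of_rat M"
  define V where "V = mat n n (\<lambda>(k,i). z i ^ k)"
  define D where "D = mat n n (\<lambda>(i,j). if i = j then rpoly h (z i) else 0)"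
  have carr: "M \<in> carrier_mat n n" "M' \<in> carrier_mat n n" "V \<in> carrier_mat n n" "D \<in> carrier_mat n n"
    by (auto simp: M_def M'_def V_def D_def)
  have fnz: "f \<noteq> 0" using is_minpolyD(1)[OF f] by auto
  have npos: "n > 0" using is_minpoly_degree_pos[OF f] by (simp add: n_def)
  \<comment> \<open>Row \<open>j\<close> of \<open>M\<close> is the remainder of
    \<open>h X^j\<close> modulo \<open>f\<close>, which agrees with \<open>h X^j\<close> at every
    root of \<open>f\<close>. So the columns of \<open>V\<close> are eigenvectors.\<close>
  have key: "(\<Sum>k<n. of_rat (coeff ((h * monom 1 j) mod f) k) * z i ^ k) = rpoly h (z i) * z i ^ j"
    if i: "i < n" for i j
  proof -
    have zi: "rpoly f (z i) = 0" using z i by (auto simp: bij_betw_def conjs_def)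
    let ?r = "(h * monom 1 j) mod f"
    have dr: "degree ?r < n" using degree_mod_less'[OF fnz, of "h * monom 1 j"] npos
      by (cases "?r = 0") (auto simp: n_def)
    have "rpoly ?r (z i) = rpoly (h * monom 1 j) (z i)"
      using rpoly_add[of "f * ((h * monom 1 j) div f)" ?r "z i"] zi by (simp add: rpoly_mult)
    also have "\<dots> = rpoly h (z i) * z i ^ j"
      by (simp add: rpoly_mult map_poly_monom poly_monom)
    finally have "rpoly ?r (z i) = rpoly h (z i) * z i ^ j" .
    moreover have "rpoly ?r (z i) = (\<Sum>k<n. of_rat (coeff ?r k) * z i ^ k)"
    proof -
      have "rpoly ?r (z i) = (\<Sum>k\<le>degree ?r. of_rat (coeff ?r k) * z i ^ k)"
        by (simp add: poly_altdef)
      also have "\<dots> = (\<Sum>k<n. of_rat (coeff ?r k) * z i ^ k)"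
        using dr by (intro sum.mono_neutral_left) (auto simp: coeff_eq_0)
      finally show ?thesis .
    qed
    ultimately show ?thesis by simp
  qed
  have MV: "M' * V = V * D"
  proof (rule eq_matI)
    fix j i assume "j < dim_row (V * D)" "i < dim_col (V * D)"
    hence ji: "j < n" "i < n" using carr by auto
    have "(M' * V) $$ (j, i) = (\<Sum>k<n. of_rat (coeff ((h * monom 1 j) mod f) k) * z i ^ k)"
      using ji by (auto simp: M'_def M_def V_def scalar_prod_def atLeast0LessThan)
    also have "\<dots> = rpoly h (z i) * z i ^ j" by (rule key[OF ji(2)])
    also have "\<dots> = (\<Sum>k<n. if k = i then z k ^ j * rpoly h (z i) else 0)"
      using ji by simp
    also have "\<dots> = (\<Sum>k<n. z k ^ j * (if k = i then rpoly h (z k) else 0))"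
      by (intro sum.cong) auto
    also have "\<dots> = (V * D) $$ (j, i)"
      using ji by (simp add: D_def V_def scalar_prod_def atLeast0LessThan)
    finally show "(M' * V) $$ (j, i) = (V * D) $$ (j, i)" .
  qed (use carr in auto)
  have "transpose_mat V = mat n n (\<lambda>(i,j). z i ^ j)"
    by (auto simp: V_def transpose_mat_def)
  hence "det V \<noteq> 0"
    using vandermonde_nonzero[of z n] z det_transpose[OF carr(3)] by (auto simp: bij_betw_def)
  hence "V \<in> Units (ring_mat TYPE(complex) n True)" 
    by (rule det_non_zero_imp_unit[OF carr(3)])
  then obtain W where W: "W \<in> carrier_mat n n" "W * V = 1\<^sub>m n" "V * W = 1\<^sub>m n"
    by (auto simp: Units_def ring_mat_def)
  have "M' = M' * (V * W)" using W carr by simp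
  also have "\<dots> = V * D * W" using W carr MV by (metis assoc_mult_mat)
  finally have "similar_mat M' D"
    unfolding similar_mat_def similar_mat_wit_def using W carr
    by (intro exI[of _ V] exI[of _ W]) (auto simp: Let_def)
  hence "char_poly M' = char_poly D" by (rule char_poly_similar)
  also have "\<dots> = (\<Prod>a\<leftarrow>diag_mat D. [:- a, 1:])"
    by (rule char_poly_upper_triangular[OF carr(4)]) (auto simp: D_def)
  also have "diag_mat D = map (\<lambda>i. rpoly h (z i)) [0..<n]"
    by (auto simp: diag_mat_def D_def)
  also have "(\<Prod>a\<leftarrow>map (\<lambda>i. rpoly h (z i)) [0..<n]. [:- a, 1:]) = (\<Prod>i<n. [:- rpoly h (z i), 1:])"
    by (simp add: prod.list_conv_set_nth atLeast0LessThan)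
  also have "\<dots> = (\<Prod>z\<in>conjs f. [:- rpoly h z, 1:])"
    using prod.reindex_bij_betw[OF z, of "\<lambda>z. [:- rpoly h z, 1:]"] by simp
  finally have "char_poly M' = (\<Prod>z\<in>conjs f. [:- rpoly h z, 1:])" .
  moreover have "char_poly M' = map_poly of_rat (char_poly M)"
    unfolding M'_def by (rule of_rat_hom.char_poly_hom[OF carr(1)])
  ultimately show ?thesis by metis
qed

text \<open>Any root of \<open>g\<close> has \<open>f\<close> as its minimal polynomial, so a factor
  \<open>f\<close> can be split off until degree 0 is reached.\<close>

lemma rat_poly_roots_power:
  fixes x :: complex
  assumes f: "is_minpoly f x"
    and "lead_coeff g = 1" "\<And>z::complex. rpoly g z = 0 \<Longrightarrow> rpoly f z = 0"
  shows "\<exists>k. g = f ^ k"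
  using assms(2,3)
proof (induction "degree g" arbitrary: g rule: less_induct)
  case (less g)
  show ?case
  proof (cases "degree g = 0")
    case True
    hence "g = 1" using less.prems(1) degree0_coeffs[of g] by (auto simp: one_pCons)
    thus ?thesis by (intro exI[of _ 0]) simp
  next
    case False
    hence "\<not> constant (poly (map_poly of_rat g :: complex poly))"
      by (simp add: constant_degree)
    then obtain z :: complex where z: "rpoly g z = 0"
      using fundamental_theorem_of_algebra by blast
    have fz: "is_minpoly f z" using is_minpoly_conjugate[OF f] less.prems(2) z by blast
    obtain q where q: "g = f * q" using is_minpolyD(3)[OF fz z] by (auto elim: dvdE)
    have lq: "lead_coeff q = 1"
      using less.prems(1) is_minpolyD(1)[OF f] by (simp add: q lead_coeff_mult)
    hence qnz: "q \<noteq> 0" and fnz: "f \<noteq> 0" using is_minpolyD(1)[OF f] by auto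
    have "degree q < degree g"
      using is_minpoly_degree_pos[OF f] qnz fnz by (simp add: q degree_mult_eq)
    moreover have "rpoly f y = 0" if "rpoly q y = 0" for y :: complex
      using less.prems(2)[of y] that by (simp add: q rpoly_mult)
    ultimately obtain k where "q = f ^ k" using less.hyps lq by blast
    hence "g = f ^ Suc k" using q by simp
    thus ?thesis by blast
  qed
qed

lemma order_prod_linear:
  fixes c :: "'b \<Rightarrow> 'a::field"
  assumes "finite A"
  shows "order y (\<Prod>a\<in>A. [:- c a, 1:]) = card {a\<in>A. c a = y}"
  using assms
proof (induction A)
  case empty
  have "order y (1 :: 'a poly) = 0" by (rule order_0I) simp
  thus ?case by simp
next
  case (insert a A)
  have nz: "[:- c a, 1:] * (\<Prod>a\<in>A. [:- c a, 1:]) \<noteq> 0"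
    using insert.hyps by (intro no_zero_divisors) (simp_all add: prod_zero_iff)
  have lin: "order y [:- c a, 1:] = (if c a = y then 1 else 0)"
  proof (cases "c a = y")
    case True
    have "order y ([:- y, 1:] ^ 1) = 1" by (rule order_power_n_n)
    thus ?thesis using True by simp
  next
    case False
    thus ?thesis by (simp add: order_0I)
  qed
  have "{b \<in> insert a A. c b = y} = (if c a = y then insert a {b\<in>A. c b = y} else {b\<in>A. c b = y})"
    by auto
  hence "card {b \<in> insert a A. c b = y} = (if c a = y then 1 else 0) + card {b\<in>A. c b = y}"
    using insert.hyps by simp
  moreover have "order y ([:- c a, 1:] * (\<Prod>a\<in>A. [:- c a, 1:])) =
      order y [:- c a, 1:] + order y (\<Prod>a\<in>A. [:- c a, 1:])"
    by (rule order_mult[OF nz])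
  ultimately show ?case
    unfolding prod.insert[OF insert.hyps] by (simp only: lin insert.IH)
qed

text \<open>\<open>f\<close> divides the composite of \<open>g\<close> and \<open>h\<close>, since
  that composite vanishes at \<open>x\<close>.\<close>

lemma rpoly_conj_root:
  assumes f: "is_minpoly f x" and g: "rpoly g (rpoly h x) = 0" and z: "rpoly f z = 0"
  shows "rpoly g (rpoly h z) = 0"
proof -
  have "rpoly (pcompose g h) x = 0" using g by (simp add: rpoly_pcompose)
  hence "f dvd pcompose g h" by (rule is_minpolyD(3)[OF f])
  then obtain q where "pcompose g h = f * q" by (auto elim: dvdE)
  hence "rpoly (pcompose g h) z = 0" using z by (simp add: rpoly_mult)
  thus ?thesis by (simp add: rpoly_pcompose)
qed

text \<open>The characteristic polynomial of multiplication by \<open>h(x)\<close> has only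
  conjugates of \<open>h(x)\<close> as roots, hence is a power of \<open>g\<close>. As
  \<open>g\<close> is squarefree, the exponent is the size of every fibre.\<close>

lemma conj_fibres:
  fixes x :: complex
  assumes f: "is_minpoly f x" and g: "is_minpoly g (rpoly h x)"
  obtains m where "m > 0" "\<And>y. y \<in> conjs g \<Longrightarrow> card {z\<in>conjs f. rpoly h z = y} = m"
    "card (conjs f) = m * card (conjs g)"
proof -
  have fin: "finite (conjs f)" "finite (conjs g)" using is_minpoly_conjs[OF f] is_minpoly_conjs[OF g] by auto
  obtain c where c: "map_poly of_rat c = (\<Prod>z\<in>conjs f. [:- rpoly h z, 1:])"
    using conj_char_poly[OF f] by blast
  have map: "rpoly h z \<in> conjs g" if "z \<in> conjs f" for z
    using rpoly_conj_root[OF f is_minpolyD(2)[OF g]] that by (auto simp: conjs_def)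
  have "lead_coeff (map_poly of_rat c :: complex poly) = 1"
    unfolding c by (simp add: lead_coeff_prod)
  hence lc: "lead_coeff c = 1" by simp
  have rt: "rpoly g y = 0" if "rpoly c y = 0" for y :: complex
  proof -
    have "(\<Prod>z\<in>conjs f. y - rpoly h z) = 0" using that by (simp add: c poly_prod algebra_simps)
    then obtain z where "z \<in> conjs f" "y = rpoly h z" using fin by auto
    thus ?thesis using map by (auto simp: conjs_def)
  qed
  obtain k where k: "c = g ^ k" using rat_poly_roots_power[OF g lc rt] by blast
  have gnz: "(map_poly of_rat g :: complex poly) \<noteq> 0" using is_minpolyD(1)[OF g] by auto
  interpret m: map_poly_comm_ring_hom "of_rat :: rat \<Rightarrow> complex" ..
  have card: "card {z\<in>conjs f. rpoly h z = y} = k" if y: "y \<in> conjs g" for y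
  proof -
    have "card {z\<in>conjs f. rpoly h z = y} = order y (map_poly of_rat c)"
      unfolding c using order_prod_linear[OF fin(1)] by metis
    also have "\<dots> = order y (map_poly of_rat g ^ k :: complex poly)" by (simp add: k m.hom_power)
    also have "\<dots> = k * order y (map_poly of_rat g :: complex poly)"
      using gnz by (induction k) (auto simp: order_mult order_0I)
    also have "order y (map_poly of_rat g :: complex poly) = 1"
      using rsquarefree_root_order[OF is_minpoly_rsquarefree[OF g]] y gnz by (simp add: conjs_def)
    finally show ?thesis by simp
  qed
  have "x \<in> conjs f" using is_minpolyD(2)[OF f] by (simp add: conjs_def)
  hence "x \<in> {z\<in>conjs f. rpoly h z = rpoly h x}" "rpoly h x \<in> conjs g" using map by auto
  hence kpos: "k > 0" using card fin
    by (metis (no_types, lifting) card_gt_0_iff empty_iff finite_subset mem_Collect_eq subsetI)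
  have "card (conjs f) = (\<Sum>y\<in>conjs g. card {z\<in>conjs f. rpoly h z = y})"
    using map fin by (subst card_UN_disjoint[symmetric]) (auto intro!: arg_cong[where f = card])
  also have "\<dots> = k * card (conjs g)" using card by simp
  finally show ?thesis using that kpos card by blast
qed

text \<open>Up to sign the norm is the constant term of a rational polynomial and a product of
  nonzero algebraic integers, hence a nonzero rational integer.\<close>

lemma rat_algebraic_int_prod_ge_1:
  fixes x :: complex
  assumes f: "is_minpoly f x" and h: "algebraic_int (rpoly h x)" "rpoly h x \<noteq> 0"
  shows "(\<Prod>z\<in>conjs f. norm (rpoly h z)) \<ge> 1"
proof -
  have fin: "finite (conjs f)" using is_minpoly_conjs[OF f] by auto
  obtain c where c: "map_poly of_rat c = (\<Prod>z\<in>conjs f. [:- rpoly h z, 1:])"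
    using conj_char_poly[OF f] by blast
  obtain p where p: "lead_coeff p = 1" "poly (map_poly of_int p) (rpoly h x) = 0"
    using h(1) by (auto simp: algebraic_int_altdef_ipoly)
  have ip: "map_poly of_rat (map_poly of_int p) = (map_poly of_int p :: complex poly)"
    by (intro poly_eqI) (simp add: coeff_map_poly)
  have ai: "algebraic_int (rpoly h z)" if z: "z \<in> conjs f" for z
  proof -
    have "rpoly (map_poly of_int p) (rpoly h z) = 0"
      using rpoly_conj_root[OF f, of "map_poly of_int p" h z] z p(2) ip by (simp add: conjs_def)
    thus ?thesis using p(1) unfolding algebraic_int_altdef_ipoly ip by blast
  qed
  have nz: "rpoly h z \<noteq> 0" if z: "z \<in> conjs f" for z
  proof
    assume "rpoly h z = 0"
    hence "f dvd h" using is_minpolyD(3)[OF is_minpoly_conjugate[OF f]] z by (auto simp: conjs_def)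
    then obtain q where "h = f * q" by (auto elim: dvdE)
    thus False using h(2) is_minpolyD(2)[OF f] by (simp add: rpoly_mult)
  qed
  define P where "P = (\<Prod>z\<in>conjs f. - rpoly h z)"
  have "P = poly (map_poly of_rat c) 0" unfolding c by (simp add: P_def poly_prod)
  also have "\<dots> = of_rat (poly c 0)" by (metis of_rat_0 of_rat_hom.poly_map_poly)
  finally have "P \<in> \<rat>" by simp
  moreover have "algebraic_int P" unfolding P_def by (intro algebraic_int_prod) (auto intro: ai)
  ultimately have "P \<in> \<int>" by (intro rational_algebraic_int_is_int)
  moreover have "P \<noteq> 0" using nz fin by (simp add: P_def)
  ultimately have "norm P \<ge> 1" by (auto elim!: Ints_cases)
  moreover have "norm P = (\<Prod>z\<in>conjs f. norm (rpoly h z))"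
    by (simp add: P_def prod_norm[symmetric])
  ultimately show ?thesis by simp
qed

text \<open>The coefficients are rational, and they are algebraic integers because the linear
  factors have algebraic integers as coefficients. The induction runs over subsets of the
  conjugates, where the partial products need not be rational.\<close>

lemma is_minpoly_int_coeffs:
  fixes x :: complex
  assumes f: "is_minpoly f x" and x: "algebraic_int x"
  shows "coeff f i \<in> \<int>"
proof -
  have fin: "finite (conjs f)" using is_minpoly_conjs[OF f] by auto
  have ai: "algebraic_int z" if z: "z \<in> conjs f" for z
  proof -
    obtain p where p: "lead_coeff p = 1" "poly (map_poly of_int p) x = 0"
      using x by (auto simp: algebraic_int_altdef_ipoly)
    have ip: "map_poly of_rat (map_poly of_int p) = (map_poly of_int p :: complex poly)"
      by (intro poly_eqI) (simp add: coeff_map_poly)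
    have "rpoly (map_poly of_int p) (rpoly [:0, 1:] z) = 0"
      using rpoly_conj_root[OF f, of "map_poly of_int p" "[:0, 1:]" z] z p(2) ip
      by (simp add: conjs_def rpoly_X)
    thus ?thesis using p(1) unfolding algebraic_int_altdef_ipoly ip rpoly_X by blast
  qed
  have "\<forall>i. algebraic_int (coeff (\<Prod>z\<in>A. [:-z, 1:]) i)" if "A \<subseteq> conjs f" for A
    using finite_subset[OF that fin] that
  proof (induction A)
    case empty
    show ?case by (auto simp: coeff_1)
  next
    case (insert a A)
    define q where "q = (\<Prod>z\<in>A. [:-z, 1:])"
    have q: "algebraic_int (coeff q i)" for i using insert by (simp add: q_def)
    have c: "coeff ([:-a, 1:] * q) i = (if i = 0 then 0 else coeff q (i - 1)) - a * coeff q i" for i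
      by (cases i) simp_all
    have "algebraic_int (coeff ([:-a, 1:] * q) i)" for i
      unfolding c using insert.prems q ai[of a]
      by (cases "i = 0") (auto intro!: algebraic_int_diff algebraic_int_times)
    thus ?case unfolding prod.insert[OF insert.hyps] q_def by blast
  qed
  hence "algebraic_int (coeff (map_poly of_rat f :: complex poly) i)"
    using is_minpoly_conjs(3)[OF f] by simp
  hence "algebraic_int (complex_of_rat (coeff f i))" by (simp add: coeff_map_poly)
  hence "complex_of_rat (coeff f i) \<in> \<int>" by (intro rational_algebraic_int_is_int) auto
  then obtain k where "complex_of_rat (coeff f i) = of_int k" by (rule Ints_cases)
  also have "\<dots> = of_rat (of_int k)" by simp
  finally have "coeff f i = of_int k" by (simp only: of_rat_eq_iff)
  thus ?thesis by simp
qed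

section \<open>Roots of unity\<close>

text \<open>Congruence modulo \<open>p\<close> in the ring of all algebraic integers; it replaces
  reduction of polynomials to the field with \<open>p\<close> elements.\<close>

definition alg_cong :: "nat \<Rightarrow> complex \<Rightarrow> complex \<Rightarrow> bool" where
  "alg_cong p x y \<longleftrightarrow> algebraic_int ((x - y) / of_nat p)"

lemma alg_cong_trans: "alg_cong p x y \<Longrightarrow> alg_cong p y z \<Longrightarrow> alg_cong p x z"
  unfolding alg_cong_def using algebraic_int_plus[of "(x - y) / of_nat p" "(y - z) / of_nat p"]
  by (simp add: diff_divide_distrib)

lemma alg_cong_add: "alg_cong p x y \<Longrightarrow> alg_cong p u v \<Longrightarrow> alg_cong p (x + u) (y + v)"
  unfolding alg_cong_def using algebraic_int_plus[of "(x - y) / of_nat p" "(u - v) / of_nat p"]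
  by (simp add: diff_divide_distrib add_divide_distrib algebra_simps)

lemma alg_cong_mult: "algebraic_int u \<Longrightarrow> alg_cong p x y \<Longrightarrow> alg_cong p (u * x) (u * y)"
  unfolding alg_cong_def using algebraic_int_times[of u "(x - y) / of_nat p"]
  by (simp add: algebra_simps)

lemma alg_cong_binomial:
  assumes p: "prime p" and x: "algebraic_int x" and y: "algebraic_int y"
  shows "alg_cong p ((x + y) ^ p) (x ^ p + y ^ p)"
proof -
  have p0: "p > 0" using p prime_gt_0_nat by blast
  have split: "{..p} = insert 0 (insert p {0<..<p})" using p0 by auto
  have "(x + y) ^ p = (\<Sum>k\<le>p. of_nat (p choose k) * x ^ k * y ^ (p - k))"
    by (rule binomial_ring)
  also have "\<dots> = y ^ p + x ^ p + (\<Sum>k\<in>{0<..<p}. of_nat (p choose k) * x ^ k * y ^ (p - k))"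
    unfolding split using p0 by simp
  finally have "((x + y) ^ p - (x ^ p + y ^ p)) / of_nat p =
      (\<Sum>k\<in>{0<..<p}. of_nat (p choose k) * x ^ k * y ^ (p - k)) / of_nat p" by simp
  also have "\<dots> = (\<Sum>k\<in>{0<..<p}. of_nat ((p choose k) div p) * x ^ k * y ^ (p - k))"
    unfolding sum_divide_distrib
  proof (intro sum.cong refl)
    fix k assume "k \<in> {0<..<p}"
    hence "p dvd (p choose k)" using p by (intro dvd_choose_prime) auto
    then obtain c where "p choose k = p * c" by (auto elim: dvdE)
    thus "of_nat (p choose k) * x ^ k * y ^ (p - k) / of_nat p =
        of_nat ((p choose k) div p) * x ^ k * y ^ (p - k)" using p0 by simp
  qed
  also have "algebraic_int \<dots>"
    by (intro algebraic_int_sum algebraic_int_times algebraic_int_power x y) auto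
  finally show ?thesis unfolding alg_cong_def .
qed

lemma alg_cong_uminus: "alg_cong p x y \<Longrightarrow> alg_cong p (- x) (- y)"
  using alg_cong_mult[of "- 1" p x y] by simp

lemma alg_cong_frobenius_nat:
  assumes p: "prime p"
  shows "alg_cong p (of_nat n ^ p) (of_nat n)"
proof (induction n)
  case 0
  show ?case using prime_gt_0_nat[OF p] by (simp add: alg_cong_def zero_power)
next
  case (Suc n)
  have "alg_cong p ((of_nat n + 1) ^ p) (of_nat n ^ p + 1 ^ p)"
    by (rule alg_cong_binomial[OF p]) auto
  moreover have "alg_cong p (of_nat n ^ p + 1 ^ p) (of_nat n + 1)"
    using alg_cong_add[OF Suc.IH, of 1 1] by (simp add: alg_cong_def)
  ultimately have "alg_cong p ((of_nat n + 1) ^ p) (of_nat n + 1)"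
    by (rule alg_cong_trans)
  thus ?case by (simp add: add.commute)
qed

lemma alg_cong_frobenius_int:
  assumes p: "prime p"
  shows "alg_cong p (of_int c ^ p) (of_int c)"
proof (cases c rule: int_cases4)
  case (nonneg n)
  thus ?thesis using alg_cong_frobenius_nat[OF p, of n] by simp
next
  case (neg n)
  \<comment> \<open>Expanding \<open>(n - n)^p\<close> gives \<open>(-n)^p\<close> congruent to
    \<open>-(n^p)\<close> without separating \<open>p = 2\<close> from odd \<open>p\<close>.\<close>
  have "alg_cong p ((of_nat n + - of_nat n) ^ p) (of_nat n ^ p + (- of_nat n) ^ p)"
    by (rule alg_cong_binomial[OF p]) auto
  hence "alg_cong p 0 (of_nat n ^ p + (- of_nat n) ^ p)"
    using prime_gt_0_nat[OF p] by (simp add: zero_power)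
  hence "alg_cong p (- 0) (- (of_nat n ^ p + (- of_nat n) ^ p))"
    by (rule alg_cong_uminus)
  hence 1: "alg_cong p ((- of_nat n) ^ p) (- (of_nat n ^ p))"
    unfolding alg_cong_def by (simp add: algebra_simps)
  have "alg_cong p (- (of_nat n ^ p)) (- of_nat n)"
    by (rule alg_cong_uminus[OF alg_cong_frobenius_nat[OF p]])
  with 1 show ?thesis using neg alg_cong_trans by fastforce
qed

lemma algebraic_int_poly:
  assumes "algebraic_int (z :: complex)"
  shows "algebraic_int (poly (map_poly of_int g) z)"
  using assms by (auto simp: poly_altdef intro!: algebraic_int_sum algebraic_int_times algebraic_int_power)

lemma alg_cong_frobenius:
  assumes p: "prime p" and z: "algebraic_int z"
  shows "alg_cong p (poly (map_poly of_int g) z ^ p) (poly (map_poly of_int g) (z ^ p))"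
proof (induction g)
  case 0
  show ?case using p prime_gt_0_nat[of p] by (simp add: alg_cong_def zero_power)
next
  case (pCons c g)
  let ?G = "poly (map_poly of_int g) :: complex \<Rightarrow> complex"
  have ai: "algebraic_int (z * ?G z)" by (intro algebraic_int_times z algebraic_int_poly)
  have 1: "alg_cong p ((of_int c + z * ?G z) ^ p) (of_int c ^ p + (z * ?G z) ^ p)"
    using alg_cong_binomial[OF p _ ai, of "of_int c"] by simp
  have "alg_cong p (z ^ p * ?G z ^ p) (z ^ p * ?G (z ^ p))"
    by (intro alg_cong_mult algebraic_int_power z pCons.IH)
  hence 2: "alg_cong p (of_int c ^ p + (z * ?G z) ^ p) (of_int c + z ^ p * ?G (z ^ p))"
    using alg_cong_add[OF alg_cong_frobenius_int[OF p, of c]] by (simp add: power_mult_distrib)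
  show ?case using alg_cong_trans[OF 1 2] by (simp add: of_int_hom.map_poly_pCons_hom)
qed

lemma monom_minus_1_factor:
  assumes d: "d > 0"
  shows "monom 1 d - 1 = (\<Prod>w | w ^ d = (1::complex). [:- w, 1:])"
proof -
  let ?P = "monom 1 d - 1 :: complex poly"
  have "rsquarefree ?P"
    unfolding rsquarefree_roots
  proof (intro allI notI, elim conjE)
    fix a assume a: "poly ?P a = 0" "poly (pderiv ?P) a = 0"
    hence "a ^ d = 1" "of_nat d * a ^ (d - 1) = 0"
      by (auto simp: poly_monom pderiv_diff pderiv_monom)
    thus False using d by (auto simp: power_0_left)
  qed
  moreover have "lead_coeff ?P = 1"
  proof -
    have "degree ?P = d" using d by (intro antisym degree_diff_le) (auto intro: le_degree simp: degree_monom_eq)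
    thus ?thesis using d by simp
  qed
  ultimately show ?thesis
    using complex_poly_decompose_rsquarefree[of ?P] by (simp add: poly_monom)
qed

text \<open>Both sides are the value at \<open>y\<close> of the derivative of
  \<open>X^d - 1\<close>, once from the factorisation and once directly.\<close>

lemma prod_roots_unity_diff:
  assumes d: "d > 0" and y: "y ^ d = (1::complex)"
  shows "(\<Prod>w\<in>{w. w ^ d = 1} - {y}. y - w) = of_nat d * y ^ (d - 1)"
proof -
  let ?R = "{w::complex. w ^ d = 1}"
  have fin: "finite ?R" using d finite_roots_unity[of d] by simp
  define B where "B = (\<Prod>w\<in>?R - {y}. [:- w, 1:])"
  have "monom 1 d - 1 = [:- y, 1:] * B"
    unfolding monom_minus_1_factor[OF d] B_def using fin y by (subst prod.remove[of _ y]) auto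
  hence "poly (pderiv (monom 1 d - 1)) y = poly (pderiv ([:- y, 1:] * B)) y" by simp
  moreover have "poly (pderiv ([:- y, 1:] * B)) y = poly B y"
    by (simp add: pderiv_mult pderiv_pCons del: mult_pCons_left)
  ultimately show ?thesis
    by (simp add: B_def poly_prod pderiv_diff pderiv_monom poly_monom)
qed

lemma rpoly_monom_minus_1: "rpoly (monom 1 d - 1) x = x ^ d - 1"
  by (simp add: rpoly_diff map_poly_monom poly_monom)

text \<open>Dedekind's argument. By Frobenius, \<open>f(z\<^sup>p)\<close> is divisible by \<open>p\<close> among the algebraic integers.
  If it is nonzero, then it divides the value \<open>d z\<^bsup>p(d-1)\<^esup>\<close> of the derivative of \<open>X\<^sup>d - 1\<close>,
  so \<open>p\<close> divides \<open>d\<close>.\<close>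

lemma root_of_unity_conj_prime:
  fixes x :: complex
  assumes d: "d > 0" and x: "x ^ d = 1" and f: "is_minpoly f x"
    and z: "z \<in> conjs f" and p: "prime p" "\<not> p dvd d"
  shows "z ^ p \<in> conjs f"
proof (rule ccontr)
  assume nz: "z ^ p \<notin> conjs f"
  let ?R = "{w::complex. w ^ d = 1}"
  have fin: "finite ?R" using d finite_roots_unity[of d] by simp
  have p0: "p > 0" using p prime_gt_0_nat by blast
  have ai: "algebraic_int w" if "w ^ d = 1" for w :: complex
  proof (rule algebraic_int_root[of 1 "monom 1 d"])
    show "poly (monom 1 d) w = 1" using that by (simp add: poly_monom)
  qed (use d in \<open>auto simp: degree_monom_eq\<close>)
  have sub: "conjs f \<subseteq> ?R"
  proof
    fix w assume w: "w \<in> conjs f"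
    have "rpoly (monom 1 d - 1) (rpoly [:0, 1:] x) = 0"
      using x by (simp only: rpoly_X rpoly_monom_minus_1) simp
    from rpoly_conj_root[OF f this, of w] w show "w \<in> ?R"
      by (simp only: rpoly_X rpoly_monom_minus_1 conjs_def mem_Collect_eq) simp
  qed
  define y where "y = z ^ p"
  have zd: "z ^ d = 1" using z sub by auto
  have yd: "y ^ d = 1" using zd by (metis y_def power_mult mult.commute power_one)
  have g: "map_poly of_rat f = (map_poly of_int (map_poly floor f) :: complex poly)"
  proof (intro poly_eqI)
    fix i
    obtain k where "coeff f i = of_int k"
      using is_minpoly_int_coeffs[OF f ai[OF x], of i] by (auto elim: Ints_cases)
    thus "coeff (map_poly of_rat f) i = (coeff (map_poly of_int (map_poly floor f)) i :: complex)"
      by (simp add: coeff_map_poly)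
  qed
  have "alg_cong p (rpoly f z ^ p) (rpoly f y)"
    unfolding g y_def by (rule alg_cong_frobenius[OF p(1) ai[OF zd]])
  moreover have "rpoly f z = 0" using z by (simp add: conjs_def)
  ultimately have "algebraic_int (- (rpoly f y / of_nat p))"
    using p0 by (simp add: alg_cong_def zero_power)
  hence fy: "algebraic_int (rpoly f y / of_nat p)" by (simp only: algebraic_int_minus_iff)
  have fprod: "rpoly f y = (\<Prod>w\<in>conjs f. y - w)"
    unfolding is_minpoly_conjs(3)[OF f] by (simp add: poly_prod)
  \<comment> \<open>As \<open>y\<close> is not a conjugate, all factors of \<open>rpoly f y\<close>
    occur in this product, and the cofactor is an algebraic integer.\<close>
  have "of_nat d * y ^ (d - 1) = (\<Prod>w\<in>?R - {y}. y - w)"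
    using prod_roots_unity_diff[OF d yd] by simp
  also have "?R - {y} = conjs f \<union> (?R - {y} - conjs f)" using sub nz by (auto simp: y_def)
  also have "(\<Prod>w\<in>\<dots>. y - w) = rpoly f y * (\<Prod>w\<in>?R - {y} - conjs f. y - w)"
    unfolding fprod using fin sub by (intro prod.union_disjoint) (auto intro: finite_subset)
  finally have e: "of_nat d * y ^ (d - 1) = rpoly f y * (\<Prod>w\<in>?R - {y} - conjs f. y - w)" .
  \<comment> \<open>The additional factor \<open>y\<close> completes \<open>y ^ (d - 1)\<close> to
    \<open>y ^ d = 1\<close>.\<close>
  have "algebraic_int (y * (rpoly f y / of_nat p * (\<Prod>w\<in>?R - {y} - conjs f. y - w)))"
    using yd by (intro algebraic_int_times fy algebraic_int_prod algebraic_int_diff ai) auto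
  also have "y * (rpoly f y / of_nat p * (\<Prod>w\<in>?R - {y} - conjs f. y - w)) =
      y * (of_nat d * y ^ (d - 1)) / of_nat p" unfolding e by simp
  also have "\<dots> = of_nat d * y ^ d / of_nat p" using d by (simp add: power_eq_if)
  also have "\<dots> = of_nat d / of_nat p" using yd by simp
  finally have "(of_nat d / of_nat p :: complex) \<in> \<int>"
    by (intro rational_algebraic_int_is_int) auto
  then obtain k where "(of_nat d / of_nat p :: complex) = of_int k" by (auto elim: Ints_cases)
  hence "(of_nat d :: complex) = of_int k * of_nat p" using p0 by (simp add: field_simps)
  hence "(of_int (int d) :: complex) = of_int (k * int p)" by simp
  hence "int d = k * int p" by (simp only: of_int_eq_iff)
  hence "int p dvd int d" by simp
  thus False using p(2) by simp
qed

text \<open>With a primitive root for \<open>x\<close> this is the irreducibility of the cyclotomic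
  polynomial. The prime factors of \<open>k\<close> are removed one at a time; none of them divides
  \<open>d\<close>.\<close>

lemma root_of_unity_conj_coprime:
  fixes x :: complex
  assumes d: "d > 0" and x: "x ^ d = 1" and f: "is_minpoly f x"
    and "z \<in> conjs f" "coprime k d" "k > 0"
  shows "z ^ k \<in> conjs f"
  using assms(4-6)
proof (induction k arbitrary: z rule: less_induct)
  case (less k)
  show ?case
  proof (cases "k = 1")
    case True
    thus ?thesis using less.prems by simp
  next
    case False
    then obtain p where p: "prime p" "p dvd k" using prime_factor_nat by blast
    then obtain l where l: "k = p * l" by (auto elim: dvdE)
    have "\<not> p dvd d" using p less.prems(2) by (metis coprime_common_divisor_nat prime_nat_iff less_irrefl)
    hence "z ^ p \<in> conjs f" using root_of_unity_conj_prime[OF d x f less.prems(1) p(1)] by blast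
    moreover have "l > 0" using l less.prems(3) by (cases l) auto
    moreover from this have "l < k" "coprime l d"
      using l less.prems p(1) prime_gt_1_nat[of p] by auto
    ultimately have "(z ^ p) ^ l \<in> conjs f" using less.IH by blast
    thus ?thesis by (simp add: l power_mult)
  qed
qed

section \<open>The conjugates of \<open>4 sin\<^sup>2(\<pi>/d)\<close>\<close>

text \<open>One representative of each pair \<open>k\<close>, \<open>d - k\<close>, since both give
  the same value of \<open>sin^2\<close>; for \<open>d \<ge> 3\<close> there are
  \<open>totient d / 2\<close> of them.\<close>

definition half_totatives :: "nat \<Rightarrow> nat set" where
  "half_totatives d = {k. 0 < k \<and> 2 * k < d \<and> coprime k d}"

definition sin2_conjs :: "nat \<Rightarrow> real set" where
  "sin2_conjs d = (\<lambda>k. 4 * sin (pi * real k / real d) ^ 2) ` half_totatives d"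

lemma finite_half_totatives [simp]: "finite (half_totatives d)"
  by (rule finite_subset[of _ "{..d}"]) (auto simp: half_totatives_def)

lemma totatives_split:
  assumes "d \<ge> 3"
  shows "totatives d = half_totatives d \<union> (\<lambda>k. d - k) ` half_totatives d"
    and "half_totatives d \<inter> (\<lambda>k. d - k) ` half_totatives d = {}"
    and "inj_on (\<lambda>k. d - k) (half_totatives d)"
proof -
  show "totatives d = half_totatives d \<union> (\<lambda>k. d - k) ` half_totatives d" (is "_ = ?B")
  proof
    show "totatives d \<subseteq> ?B"
    proof
      fix k assume "k \<in> totatives d"
      hence k: "0 < k" "k \<le> d" "coprime k d" by (auto simp: totatives_def)
      have "k \<noteq> d" using k assms by auto
      have "2 * k \<noteq> d"
      proof
        assume e: "2 * k = d"
        hence "k dvd d" by auto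
        hence "k = 1" using k(3) by (metis coprime_absorb_left nat_dvd_1_iff_1 is_unit_gcd_iff gcd_nat.absorb1)
        thus False using e assms by simp
      qed
      show "k \<in> ?B"
      proof (cases "2 * k < d")
        case True
        thus ?thesis using k by (auto simp: half_totatives_def)
      next
        case False
        have "coprime (d - k) d" using k(2,3)
          by (metis coprime_commute coprime_diff_one_left_nat diff_diff_cancel gcd_diff2_nat coprime_iff_gcd_eq_1)
        hence "d - k \<in> half_totatives d" using False \<open>2 * k \<noteq> d\<close> \<open>k \<noteq> d\<close> k
          by (auto simp: half_totatives_def)
        moreover have "k = d - (d - k)" using k by simp
        ultimately show ?thesis by blast
      qed
    qed
    show "?B \<subseteq> totatives d"
    proof
      fix k assume "k \<in> ?B"
      then consider "k \<in> half_totatives d" | j where "j \<in> half_totatives d" "k = d - j" by auto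
      thus "k \<in> totatives d"
      proof cases
        case 1
        thus ?thesis by (auto simp: half_totatives_def totatives_def)
      next
        case 2
        have "coprime (d - j) d" using 2
          by (auto simp: half_totatives_def coprime_iff_gcd_eq_1 gcd_diff2_nat)
        thus ?thesis using 2 by (auto simp: half_totatives_def totatives_def)
      qed
    qed
  qed
qed (auto simp: half_totatives_def inj_on_def)

lemma totient_eq_half:
  assumes "d \<ge> 3"
  shows "totient d = 2 * card (half_totatives d)"
proof -
  have "totient d = card (half_totatives d \<union> (\<lambda>k. d - k) ` half_totatives d)"
    by (simp add: totient_def totatives_split(1)[OF assms])
  also have "\<dots> = card (half_totatives d) + card ((\<lambda>k. d - k) ` half_totatives d)"
    by (intro card_Un_disjoint totatives_split(2)[OF assms]) auto
  finally show ?thesis by (simp add: card_image[OF totatives_split(3)[OF assms]])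
qed

lemma sin_half_totative_pos:
  assumes "0 < k" "k < d"
  shows "sin (pi * real k / real d) > 0"
  using assms by (intro sin_gt_zero) (auto simp: field_simps)

lemma inj_on_sin2:
  "inj_on (\<lambda>k. 4 * sin (pi * real k / real d) ^ 2) (half_totatives d)"
proof (rule inj_onI)
  fix k l assume k: "k \<in> half_totatives d" and l: "l \<in> half_totatives d"
    and e: "4 * sin (pi * real k / real d) ^ 2 = 4 * sin (pi * real l / real d) ^ 2"
  have b: "0 < d" "0 < k" "2 * k < d" "0 < l" "2 * l < d" using k l by (auto simp: half_totatives_def)
  have eq: "sin (pi * real k / real d) = sin (pi * real l / real d)"
    using e sin_half_totative_pos[of k d] sin_half_totative_pos[of l d] b
    by (simp add: power2_eq_iff_nonneg)
  have up: "pi * real j / real d \<le> pi / 2" if "2 * j < d" for j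
  proof -
    have "real (2 * j) \<le> real d" using that by (simp only: of_nat_le_iff)
    hence "real j / real d \<le> 1 / 2" using b(1) by (simp add: field_simps)
    hence "pi * (real j / real d) \<le> pi * (1 / 2)" by (intro mult_left_mono) auto
    thus ?thesis by simp
  qed
  have lo: "- (pi / 2) \<le> pi * real j / real d" for j
    by (rule order.trans[of _ 0]) simp_all
  have "pi * real k / real d = pi * real l / real d"
    by (rule sin_inj_pi[OF lo up[OF b(3)] lo up[OF b(5)] eq])
  thus "k = l" using b by simp
qed

lemma card_sin2_conjs: "card (sin2_conjs d) = card (half_totatives d)"
  unfolding sin2_conjs_def by (rule card_image[OF inj_on_sin2])

section \<open>The product of the conjugates\<close>

lemma norm_1_minus_cis: "norm (1 - cis t) = 2 * \<bar>sin (t / 2)\<bar>"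
proof -
  have "norm (1 - cis t) ^ 2 = (1 - cos t) ^ 2 + sin t ^ 2"
    by (simp add: cmod_power2)
  also have "\<dots> = 2 - 2 * cos t" using sin_cos_squared_add[of t] by (simp add: power2_eq_square algebra_simps)
  also have "\<dots> = (2 * \<bar>sin (t / 2)\<bar>) ^ 2"
    using cos_double_sin[of "t / 2"] by (simp add: power_mult_distrib)
  finally show ?thesis by (rule power2_eq_imp_eq) auto
qed

text \<open>The product of \<open>1 - w\<close> over the \<open>d\<close>-th roots of unity
  \<open>w\<close> other than 1 is \<open>d\<close>. Logarithms are taken so that the result can be
  compared with the divisor sum of \<open>mangoldt\<close>.\<close>

lemma sum_ln_sin:
  assumes d: "d > 0"
  shows "(\<Sum>k\<in>{0<..<d}. ln (2 * sin (pi * (real k / real d)))) = ln (real d)"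
proof -
  let ?c = "\<lambda>k. cis (2 * pi * real k / real d)"
  have bij: "bij_betw ?c {..<d} {z. z ^ d = 1}" by (rule Complex.bij_betw_roots_unity[OF d])
  have "bij_betw ?c ({..<d} - {0}) ({z. z ^ d = 1} - {?c 0})"
    using bij d by (intro bij_betw_DiffI) (auto simp: bij_betw_def)
  hence bij': "bij_betw ?c {0<..<d} ({z. z ^ d = 1} - {1})"
    using d by (auto simp: greaterThanLessThan_def elim!: back_subst[of "\<lambda>A. bij_betw _ A _"])
  have "(\<Prod>w\<in>{z::complex. z ^ d = 1} - {1}. 1 - w) = of_nat d"
    using prod_roots_unity_diff[OF d, of 1] by simp
  hence "norm (\<Prod>w\<in>{z::complex. z ^ d = 1} - {1}. 1 - w) = real d" by simp
  hence "(\<Prod>w\<in>{z::complex. z ^ d = 1} - {1}. norm (1 - w)) = real d" by (simp add: prod_norm)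
  hence "(\<Prod>k\<in>{0<..<d}. norm (1 - ?c k)) = real d"
    using prod.reindex_bij_betw[OF bij', of "\<lambda>w. norm (1 - w)"] by simp
  also have "(\<Prod>k\<in>{0<..<d}. norm (1 - ?c k)) = (\<Prod>k\<in>{0<..<d}. 2 * sin (pi * (real k / real d)))"
  proof (intro prod.cong refl)
    fix k assume "k \<in> {0<..<d}"
    hence "sin (pi * real k / real d) > 0" by (intro sin_half_totative_pos) auto
    thus "norm (1 - ?c k) = 2 * sin (pi * (real k / real d))" by (simp add: norm_1_minus_cis)
  qed
  finally have e: "ln (\<Prod>k\<in>{0<..<d}. 2 * sin (pi * (real k / real d))) = ln (real d)" by simp
  have nz: "2 * sin (pi * (real i / real d)) \<noteq> 0" if "i \<in> {0<..<d}" for i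
    using sin_half_totative_pos[of i d] that by auto
  have "ln (\<Prod>k\<in>{0<..<d}. 2 * sin (pi * (real k / real d))) =
      (\<Sum>k\<in>{0<..<d}. ln (2 * sin (pi * (real k / real d))))"
    by (intro ln_prod nz) auto
  thus ?thesis using e by simp
qed

text \<open>Each fraction is put in lowest terms. Denominator 1 is left out because the fractions
  lie strictly between 0 and 1.\<close>

lemma sum_fractions_by_denominator:
  fixes F :: "real \<Rightarrow> real"
  assumes d: "d > 0"
  shows "(\<Sum>k\<in>{0<..<d}. F (real k / real d)) =
    (\<Sum>e | e dvd d \<and> e \<noteq> 1. \<Sum>k\<in>totatives e. F (real k / real e))"
proof -
  have fin: "finite {e. e dvd d \<and> e \<noteq> 1}" using d by (auto intro: finite_subset[of _ "{..d}"] dvd_imp_le)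
  have "(\<Sum>e | e dvd d \<and> e \<noteq> 1. \<Sum>k\<in>totatives e. F (real k / real e)) =
      (\<Sum>(e, k)\<in>(SIGMA e:{e. e dvd d \<and> e \<noteq> 1}. totatives e). F (real k / real e))"
    using fin by (subst sum.Sigma) auto
  also have "\<dots> = (\<Sum>k\<in>{0<..<d}. F (real k / real d))"
  proof (rule sum.reindex_bij_witness[where i = "\<lambda>x. (d div gcd x d, x div gcd x d)"
        and j = "\<lambda>(e, k). k * (d div e)"])
    fix a assume a: "a \<in> (SIGMA e:{e. e dvd d \<and> e \<noteq> 1}. totatives e)"
    then obtain e k where ek: "a = (e, k)" "e dvd d" "e \<noteq> 1" "0 < k" "k \<le> e" "coprime k e"
      by (auto simp: totatives_def)
    obtain c where c: "d = e * c" using ek(2) by (auto elim: dvdE)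
    have pos: "e > 0" "c > 0" using d c by auto
    have ke: "k < e" using ek by (metis coprime_self le_neq_implies_less nat_dvd_1_iff_1)
    have g: "gcd (k * c) d = c" using ek(6) by (simp add: c gcd_mult_right_right_cancel gcd_mult_distrib_nat[symmetric]
          mult.commute[of _ c] coprime_iff_gcd_eq_1[symmetric])
    have dc: "d div e = c" using c pos by simp
    show "(d div gcd (case a of (e, k) \<Rightarrow> k * (d div e)) d,
        (case a of (e, k) \<Rightarrow> k * (d div e)) div gcd (case a of (e, k) \<Rightarrow> k * (d div e)) d) = a"
      using ek(1) g dc pos c by simp
    show "(case a of (e, k) \<Rightarrow> k * (d div e)) \<in> {0<..<d}"
      using ek(1,4) dc pos ke c by simp
    show "F (real (case a of (e, k) \<Rightarrow> k * (d div e)) / real d) = (case a of (e, k) \<Rightarrow> F (real k / real e))"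
      using ek(1) dc pos c by simp
  next
    fix x assume x: "x \<in> {0<..<d}"
    define g where "g = gcd x d"
    have gpos: "g > 0" using d by (simp add: g_def)
    obtain u v where uv: "x = u * g" "d = v * g" "coprime u v"
      using gcd_coprime_exists[of x d] gpos unfolding g_def by blast
    have "v \<noteq> 1" using x uv gpos by auto
    have "0 < u" "u < v" using x uv by auto
    show "(d div gcd x d, x div gcd x d) \<in> (SIGMA e:{e. e dvd d \<and> e \<noteq> 1}. totatives e)"
      using uv gpos \<open>v \<noteq> 1\<close> \<open>0 < u\<close> \<open>u < v\<close> unfolding g_def[symmetric] by (simp add: totatives_def)
    show "(case (d div gcd x d, x div gcd x d) of (e, k) \<Rightarrow> k * (d div e)) = x"
      using uv gpos \<open>0 < u\<close> \<open>u < v\<close> unfolding g_def[symmetric] by simp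
  qed
  finally show ?thesis by simp
qed

text \<open>Both sides, summed over the divisors of \<open>d\<close> other than 1, give
  \<open>ln d\<close>; the terms for proper divisors agree by induction, so the remaining ones
  do.\<close>

lemma sum_ln_sin_totatives:
  "d \<ge> 2 \<Longrightarrow> (\<Sum>k\<in>totatives d. ln (2 * sin (pi * (real k / real d)))) = mangoldt d"
proof (induction d rule: less_induct)
  case (less d)
  define L where "L e = (\<Sum>k\<in>totatives e. ln (2 * sin (pi * (real k / real e))))" for e
  let ?D = "{e. e dvd d \<and> e \<noteq> 1}"
  have d: "d > 0" using less.prems by simp
  have fin: "finite ?D" using d by (auto intro: finite_subset[of _ "{..d}"] dvd_imp_le)
  have dD: "d \<in> ?D" using less.prems by auto
  have 1: "(\<Sum>e\<in>?D. L e) = ln (real d)"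
    using sum_fractions_by_denominator[OF d, of "\<lambda>x. ln (2 * sin (pi * x))"] sum_ln_sin[OF d]
    by (simp add: L_def)
  have "(\<Sum>e | e dvd d. mangoldt e :: real) = ln (real d)" using mangoldt_sum[of d, where 'a = real] d by simp
  moreover have "(\<Sum>e | e dvd d. mangoldt e :: real) = (\<Sum>e\<in>?D. mangoldt e)"
    using d by (intro sum.mono_neutral_right) (auto intro: finite_subset[of _ "{..d}"] dvd_imp_le)
  ultimately have 2: "(\<Sum>e\<in>?D. mangoldt e :: real) = ln (real d)" by simp
  have "L e = mangoldt e" if "e \<in> ?D - {d}" for e
  proof -
    have "e < d" "e \<noteq> 0" using that d by (auto intro: le_neq_trans dvd_imp_le)
    hence "2 \<le> e" using that by auto
    thus ?thesis using less.IH[OF \<open>e < d\<close>] by (simp add: L_def)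
  qed
  hence "(\<Sum>e\<in>?D - {d}. L e) = (\<Sum>e\<in>?D - {d}. mangoldt e)" by (intro sum.cong) auto
  hence "L d = mangoldt d" using 1 2 sum.remove[OF fin dD, of L] sum.remove[OF fin dD, of "mangoldt :: nat \<Rightarrow> real"] by linarith
  thus ?case by (simp add: L_def)
qed

lemma prod_sin2_conjs:
  assumes d: "d \<ge> 3"
  shows "\<Prod>(sin2_conjs d) = exp (mangoldt d)"
proof -
  let ?s = "\<lambda>k. ln (2 * sin (pi * (real k / real d)))"
  have pos: "sin (pi * (real k / real d)) > 0" if "k \<in> half_totatives d" for k
    using sin_half_totative_pos[of k d] that by (auto simp: half_totatives_def)
  have "mangoldt d = (\<Sum>k\<in>totatives d. ?s k)" using sum_ln_sin_totatives[of d] d by simp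
  also have "\<dots> = (\<Sum>k\<in>half_totatives d. ?s k) + (\<Sum>k\<in>(\<lambda>k. d - k) ` half_totatives d. ?s k)"
    unfolding totatives_split(1)[OF d] by (intro sum.union_disjoint totatives_split(2)[OF d]) auto
  also have "(\<Sum>k\<in>(\<lambda>k. d - k) ` half_totatives d. ?s k) = (\<Sum>k\<in>half_totatives d. ?s k)"
  proof (subst sum.reindex[OF totatives_split(3)[OF d]], intro sum.cong refl)
    fix k assume "k \<in> half_totatives d"
    hence "pi * (real (d - k) / real d) = pi - pi * (real k / real d)"
      using d by (auto simp: half_totatives_def of_nat_diff field_simps)
    thus "(?s \<circ> (\<lambda>k. d - k)) k = ?s k" by simp
  qed
  also have "(\<Sum>k\<in>half_totatives d. ?s k) + (\<Sum>k\<in>half_totatives d. ?s k) =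
      (\<Sum>k\<in>half_totatives d. ln (4 * sin (pi * real k / real d) ^ 2))"
    unfolding sum.distrib[symmetric]
  proof (intro sum.cong refl)
    fix k assume "k \<in> half_totatives d"
    hence p: "sin (pi * (real k / real d)) > 0" by (rule pos)
    have "?s k + ?s k = ln ((2 * sin (pi * (real k / real d))) * (2 * sin (pi * (real k / real d))))"
      using p by (subst ln_mult) auto
    thus "?s k + ?s k = ln (4 * sin (pi * real k / real d) ^ 2)" by (simp add: power2_eq_square)
  qed
  also have "\<dots> = ln (\<Prod>k\<in>half_totatives d. 4 * sin (pi * real k / real d) ^ 2)"
    using pos by (intro ln_prod[symmetric]) fastforce+
  also have "(\<Prod>k\<in>half_totatives d. 4 * sin (pi * real k / real d) ^ 2) = \<Prod>(sin2_conjs d)"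
    unfolding sin2_conjs_def by (subst prod.reindex[OF inj_on_sin2]) (simp add: o_def)
  finally have "mangoldt d = ln (\<Prod>(sin2_conjs d))" .
  moreover have "\<Prod>(sin2_conjs d) > 0"
    using pos by (intro prod_pos) (fastforce simp: sin2_conjs_def)
  ultimately show ?thesis by simp
qed

section \<open>Conjugates through roots of unity\<close>

lemma cis_root_of_unity: "d > 0 \<Longrightarrow> cis (2 * pi / real d) ^ d = 1"
  by (simp add: Complex.DeMoivre)

text \<open>Writing the inverse of a root of unity as its power \<open>d - 1\<close> makes
  \<open>4 sin^2\<close> a polynomial in it, the same one for all \<open>k\<close>.\<close>

lemma sin2_eq_cis:
  assumes d: "d > 0"
  shows "complex_of_real (4 * sin (pi * real k / real d) ^ 2) =
    2 - cis (2 * pi / real d) ^ k - (cis (2 * pi / real d) ^ k) ^ (d - 1)"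
proof -
  define z where "z = cis (2 * pi / real d) ^ k"
  have zc: "z = cis (2 * (pi * real k / real d))" by (simp add: z_def Complex.DeMoivre algebra_simps)
  have "z ^ d = (cis (2 * pi / real d) ^ d) ^ k"
    by (simp only: z_def power_mult[symmetric] mult.commute)
  hence zd: "z ^ d = 1" by (simp add: cis_root_of_unity[OF d])
  hence "z * z ^ (d - 1) = 1" using d by (simp add: power_eq_if)
  moreover have "z * cnj z = 1" by (simp add: zc cis_cnj cis_mult)
  ultimately have "z ^ (d - 1) = cnj z" by (metis mult.assoc mult.commute mult_1_left)
  hence "2 - z - z ^ (d - 1) = of_real (2 - 2 * cos (2 * (pi * real k / real d)))"
    by (simp add: zc complex_eq_iff)
  also have "2 - 2 * cos (2 * (pi * real k / real d)) = 4 * sin (pi * real k / real d) ^ 2"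
    using cos_double_sin[of "pi * real k / real d"] by linarith
  finally show ?thesis by (simp add: z_def)
qed

lemma algebraic_int_root_of_unity: "d > 0 \<Longrightarrow> w ^ d = 1 \<Longrightarrow> algebraic_int (w :: complex)"
  by (rule algebraic_int_root[of 1 "monom 1 d"]) (auto simp: degree_monom_eq poly_monom)

lemma algebraic_int_4_sin2:
  assumes d: "d > 0"
  shows "algebraic_int (4 * sin (pi / real d) ^ 2)"
proof -
  have z: "algebraic_int (cis (2 * pi / real d))"
    using algebraic_int_root_of_unity[OF d cis_root_of_unity[OF d]] .
  have "algebraic_int (complex_of_real (4 * sin (pi * real 1 / real d) ^ 2))"
    unfolding sin2_eq_cis[OF d] by (intro algebraic_int_diff algebraic_int_power z) auto
  hence "algebraic_int (complex_of_real (4 * sin (pi / real d) ^ 2))" by simp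
  thus ?thesis by (simp only: algebraic_int_of_real_iff)
qed

lemma conjs_sin2:
  assumes d: "d \<ge> 3" and g: "is_minpoly g (complex_of_real (4 * sin (pi / real d) ^ 2))"
  shows "conjs g = complex_of_real ` sin2_conjs d"
proof -
  define z where "z = cis (2 * pi / real d)"
  have d0: "d > 0" using d by simp
  have zd: "z ^ d = 1" using cis_root_of_unity[OF d0] by (simp add: z_def)
  obtain f where f: "is_minpoly f z"
    using is_minpoly_exists[OF algebraic_int_root_of_unity[OF d0 zd]] by blast
  define h :: "rat poly" where "h = [:2, -1:] - monom 1 (d - 1)"
  have h: "rpoly h w = 2 - w - w ^ (d - 1)" for w :: complex
    by (simp add: h_def rpoly_diff map_poly_monom poly_monom of_rat_hom.map_poly_pCons_hom)
  have hk: "rpoly h (z ^ k) = complex_of_real (4 * sin (pi * real k / real d) ^ 2)" for k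
    by (simp only: h z_def sin2_eq_cis[OF d0])
  have g': "is_minpoly g (rpoly h z)" using g hk[of 1] by simp
  obtain m where m: "m > 0" "\<And>y. y \<in> conjs g \<Longrightarrow> card {w\<in>conjs f. rpoly h w = y} = m"
    using conj_fibres[OF f g'] by blast
  show ?thesis
  proof
    show "complex_of_real ` sin2_conjs d \<subseteq> conjs g"
    proof
      fix y assume "y \<in> complex_of_real ` sin2_conjs d"
      then obtain k where k: "k \<in> half_totatives d" "y = rpoly h (z ^ k)"
        unfolding sin2_conjs_def hk by auto
      have "z \<in> conjs f" using is_minpolyD(2)[OF f] by (simp add: conjs_def)
      hence "z ^ k \<in> conjs f"
        using root_of_unity_conj_coprime[OF d0 zd f, of z k] k by (simp add: half_totatives_def)
      hence "rpoly g (rpoly h (z ^ k)) = 0"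
        using rpoly_conj_root[OF f is_minpolyD(2)[OF g'], of "z ^ k"] unfolding conjs_def by blast
      thus "y \<in> conjs g" unfolding k(2) conjs_def by blast
    qed
    show "conjs g \<subseteq> complex_of_real ` sin2_conjs d"
    proof
      fix y assume y: "y \<in> conjs g"
      hence "card {w\<in>conjs f. rpoly h w = y} = m" by (rule m(2))
      \<comment> \<open>Fibres have positive size, so every conjugate of
        \<open>4 sin^2(pi/d)\<close> comes from a conjugate \<open>w\<close> of the root of unity
        \<open>z\<close>.\<close>
      hence "{w\<in>conjs f. rpoly h w = y} \<noteq> {}" using m(1) by (metis card.empty less_irrefl)
      then obtain w where w: "w \<in> conjs f" "rpoly h w = y" by blast
      have root: "rpoly (monom 1 e - 1) u = u ^ e - 1" for e and u :: complex
        by (rule rpoly_monom_minus_1)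
      have fw: "is_minpoly f w" using is_minpoly_conjugate[OF f] w(1) unfolding conjs_def by blast
      \<comment> \<open>Conjugates satisfy the same equations, so \<open>w\<close> inherits the
        exact order \<open>d\<close> of \<open>z\<close>; a common factor of \<open>k\<close> and
        \<open>d\<close> would give it a smaller one.\<close>
      have pow: "z ^ e = 1" if "w ^ e = 1" for e
      proof -
        have "f dvd monom 1 e - 1" using that by (intro is_minpolyD(3)[OF fw]) (simp only: root, simp)
        then obtain q where q: "monom 1 e - 1 = f * q" by (auto elim: dvdE)
        have "z ^ e - 1 = rpoly f z * rpoly q z" unfolding root[symmetric] q by (rule rpoly_mult)
        thus ?thesis using is_minpolyD(2)[OF f] by simp
      qed
      have "f dvd monom 1 d - 1" using zd by (intro is_minpolyD(3)[OF f]) (simp only: root, simp)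
      then obtain q where q: "monom 1 d - 1 = f * q" by (auto elim: dvdE)
      have "w ^ d - 1 = rpoly f w * rpoly q w" unfolding root[symmetric] q by (rule rpoly_mult)
      hence "w ^ d = 1" using is_minpolyD(2)[OF fw] by simp
      then obtain k where k: "k < d" "w = cis (2 * pi * real k / real d)"
        using Complex.bij_betw_roots_unity[OF d0] unfolding bij_betw_def by blast
      have wk: "w = z ^ k" using k(2) by (simp add: z_def Complex.DeMoivre algebra_simps)
      have cop: "coprime k d"
      proof (rule ccontr)
        assume "\<not> coprime k d"
        hence c: "gcd k d \<noteq> 1" by (simp add: coprime_iff_gcd_eq_1)
        obtain e where e': "d = gcd k d * e" by (metis dvdE gcd_dvd2)
        obtain l where l: "k = gcd k d * l" by (metis dvdE gcd_dvd1)
        have "k * e = d * l" using e' l by (metis mult.assoc mult.commute)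
        hence "w ^ e = 1" unfolding wk using zd by (metis power_mult power_one)
        hence ze: "z ^ e = 1" by (rule pow)
        have e0: "0 < e" using e' d0 by (metis gr0I mult_0_right less_irrefl)
        have "gcd k d > 1" using c d0 by (metis One_nat_def gcd_pos_nat less_one linorder_neqE_nat neq0_conv)
        hence "1 * e < gcd k d * e" using e0 by (intro mult_strict_right_mono) auto
        hence e: "0 < e" "e < d" using e0 e' by auto
        have "cis (2 * pi * real e / real d) = cis (2 * pi * real 0 / real d)"
          using ze by (simp add: z_def Complex.DeMoivre algebra_simps)
        hence "e = 0" using Complex.bij_betw_roots_unity[OF d0] e d0 unfolding bij_betw_def inj_on_def by blast
        thus False using e by simp
      qed
      have k0: "k > 0" using cop d by (cases "k = 0") auto
      have "k \<in> totatives d" using cop k0 k(1) by (simp add: totatives_def)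
      then consider "k \<in> half_totatives d" | j where "j \<in> half_totatives d" "k = d - j"
        using totatives_split(1)[OF d] by blast
      thus "y \<in> complex_of_real ` sin2_conjs d"
      proof cases
        case 1
        thus ?thesis using w(2) unfolding wk hk sin2_conjs_def by blast
      next
        case 2
        have "pi * real k / real d = pi - pi * real j / real d"
          using 2 d by (auto simp: half_totatives_def of_nat_diff field_simps)
        hence "sin (pi * real k / real d) = sin (pi * real j / real d)" by simp
        hence "y = complex_of_real (4 * sin (pi * real j / real d) ^ 2)" using w(2) wk hk[of k] by simp
        thus ?thesis using 2(1) unfolding sin2_conjs_def by blast
      qed
    qed
  qed
qed

section \<open>Subfields of the reals\<close>

lemma is_subfieldD:
  assumes "is_subfield K"
  shows "0 \<in> K" "1 \<in> K" "x \<in> K \<Longrightarrow> y \<in> K \<Longrightarrow> x + y \<in> K" "x \<in> K \<Longrightarrow> y \<in> K \<Longrightarrow> x * y \<in> K"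
    "x \<in> K \<Longrightarrow> - x \<in> K" "x \<in> K \<Longrightarrow> inverse x \<in> K"
proof -
  show "x \<in> K \<Longrightarrow> inverse x \<in> K"
    using assms by (cases "x = 0") (auto simp: is_subfield_def)
qed (use assms in \<open>auto simp: is_subfield_def\<close>)

lemma is_subfield_diff: "is_subfield K \<Longrightarrow> x \<in> K \<Longrightarrow> y \<in> K \<Longrightarrow> x - y \<in> K"
  using is_subfieldD(3)[of K x "- y"] is_subfieldD(5)[of K y] by simp

lemma is_subfield_sum:
  "is_subfield K \<Longrightarrow> (\<And>i. i \<in> I \<Longrightarrow> f i \<in> K) \<Longrightarrow> sum f I \<in> K"
  by (induction I rule: infinite_finite_induct) (auto intro: is_subfieldD)

lemma is_subfield_power: "is_subfield K \<Longrightarrow> x \<in> K \<Longrightarrow> x ^ n \<in> K"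
  by (induction n) (auto intro: is_subfieldD)

lemma is_subfield_gen_field: "is_subfield (gen_field S)"
  unfolding gen_field_def is_subfield_def by blast

lemma gen_field_superset: "S \<subseteq> gen_field S"
  unfolding gen_field_def by blast

lemma gen_field_least: "is_subfield K \<Longrightarrow> S \<subseteq> K \<Longrightarrow> gen_field S \<subseteq> K"
  unfolding gen_field_def by blast

lemma is_subfield_of_nat: "is_subfield K \<Longrightarrow> of_nat n \<in> K"
  by (induction n) (auto intro: is_subfieldD)

lemma is_subfield_of_int: "is_subfield K \<Longrightarrow> of_int n \<in> K"
  by (cases n rule: int_cases4) (auto intro: is_subfieldD is_subfield_of_nat)

lemma is_subfield_of_rat:
  assumes "is_subfield K"
  shows "of_rat r \<in> K"
proof (cases r)
  case (Fract a b)
  have "of_int a * inverse (of_int b) \<in> K"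
    by (intro is_subfieldD(4,6)[OF assms] is_subfield_of_int[OF assms])
  thus ?thesis using Fract by (simp add: of_rat_rat field_simps)
qed

text \<open>Subfields are sets rather than types, so polynomials over \<open>L\<close> are real
  polynomials with a condition on the coefficients.\<close>

definition polys_over :: "real set \<Rightarrow> real poly set" where
  "polys_over L = {p. \<forall>i. coeff p i \<in> L}"

context
  fixes L :: "real set"
  assumes L: "is_subfield L"
begin

lemma polys_over_add: "p \<in> polys_over L \<Longrightarrow> q \<in> polys_over L \<Longrightarrow> p + q \<in> polys_over L"
  by (auto simp: polys_over_def intro: is_subfieldD(3)[OF L])

lemma polys_over_diff: "p \<in> polys_over L \<Longrightarrow> q \<in> polys_over L \<Longrightarrow> p - q \<in> polys_over L"
  by (auto simp: polys_over_def intro: is_subfield_diff[OF L])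

lemma polys_over_mult: "p \<in> polys_over L \<Longrightarrow> q \<in> polys_over L \<Longrightarrow> p * q \<in> polys_over L"
  by (auto simp: polys_over_def coeff_mult intro!: is_subfield_sum[OF L] is_subfieldD(4)[OF L])

lemma polys_over_smult: "c \<in> L \<Longrightarrow> q \<in> polys_over L \<Longrightarrow> Polynomial.smult c q \<in> polys_over L"
  by (auto simp: polys_over_def intro: is_subfieldD(4)[OF L])

lemma polys_over_0: "0 \<in> polys_over L"
  using is_subfieldD(1)[OF L] by (auto simp: polys_over_def)

lemma polys_over_pCons: "c \<in> L \<Longrightarrow> q \<in> polys_over L \<Longrightarrow> pCons c q \<in> polys_over L"
  by (auto simp: polys_over_def coeff_pCons split: nat.split)

lemma polys_over_pConsD: "pCons c q \<in> polys_over L \<Longrightarrow> c \<in> L \<and> q \<in> polys_over L"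
  by (auto simp: polys_over_def coeff_pCons split: nat.splits)

lemma polys_over_of_rat: "map_poly of_rat p \<in> polys_over L"
  by (auto simp: polys_over_def coeff_map_poly intro: is_subfield_of_rat[OF L])

lemma polys_over_pcompose:
  assumes "p \<in> polys_over L" "q \<in> polys_over L"
  shows "pcompose p q \<in> polys_over L"
  using assms(1)
proof (induction p)
  case 0
  show ?case by (simp add: polys_over_0)
next
  case (pCons c p)
  have "c \<in> L" "p \<in> polys_over L" using polys_over_pConsD[OF pCons.prems] by auto
  thus ?case using pCons.IH assms(2)
    by (auto simp: pcompose_pCons intro!: polys_over_add polys_over_mult polys_over_pCons polys_over_0)
qed

lemma poly_polys_over:
  assumes "p \<in> polys_over L" "x \<in> L"
  shows "poly p x \<in> L"
  using assms by (auto simp: poly_altdef polys_over_def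
      intro!: is_subfield_sum[OF L] is_subfieldD(4)[OF L] is_subfield_power[OF L])

lemma rpoly_in_subfield: "x \<in> L \<Longrightarrow> rpoly h x \<in> L"
  by (rule poly_polys_over[OF polys_over_of_rat])

text \<open>Division in the manner of Horner: \<open>X\<close> times the previous remainder plus the
  next coefficient, reduced by one multiple of \<open>p\<close>. This keeps all coefficients visibly
  in \<open>L\<close>.\<close>

lemma polys_over_division:
  assumes p: "p \<in> polys_over L" "lead_coeff p = 1" "degree p > 0"
    and P: "P \<in> polys_over L"
  shows "\<exists>q\<in>polys_over L. \<exists>r\<in>polys_over L. P = p * q + r \<and> degree r < degree p"
  using P
proof (induction P)
  case 0
  show ?case using p by (intro bexI[of _ 0]) (auto simp: polys_over_0)
next
  case (pCons a P)
  have aP: "a \<in> L" "P \<in> polys_over L" using polys_over_pConsD[OF pCons.prems] by auto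
  obtain q r where qr: "q \<in> polys_over L" "r \<in> polys_over L" "P = p * q + r" "degree r < degree p"
    using pCons.IH[OF aP(2)] by blast
  define c where "c = coeff (pCons a r) (degree p)"
  define r' where "r' = pCons a r - Polynomial.smult c p"
  have ar: "pCons a r \<in> polys_over L" using aP qr by (simp add: polys_over_pCons)
  hence cL: "c \<in> L" by (auto simp: c_def polys_over_def)
  have r': "r' \<in> polys_over L" unfolding r'_def by (intro polys_over_diff polys_over_smult ar cL p)
  have "coeff r' i = 0" if "i \<ge> degree p" for i
  proof (cases "i = degree p")
    case True
    thus ?thesis using p(2) by (simp add: r'_def c_def)
  next
    case False
    hence "i > degree p" using that by simp
    moreover have "degree (pCons a r) \<le> degree p" using qr(4) degree_pCons_le[of a r] by linarith
    ultimately show ?thesis by (simp add: r'_def coeff_eq_0)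
  qed
  hence dr: "degree r' < degree p" using p(3) by (metis degree_0 leading_coeff_0_iff not_le)
  have "pCons a P = p * pCons c q + r'"
    by (simp add: r'_def qr(3) algebra_simps)
  thus ?case using dr r' cL qr(1) by (intro bexI[of _ "pCons c q"] bexI[of _ r']) (auto intro: polys_over_pCons)
qed

end

section \<open>Degrees from common roots\<close>

lemma degree_dvd_prod_linear:
  fixes p :: "'a::field poly"
  assumes "finite R" "p dvd (\<Prod>r\<in>R. [:-r, 1:])"
  shows "degree p \<le> card {r\<in>R. poly p r = 0}"
proof -
  let ?P = "\<Prod>r\<in>R. [:-r, 1:]"
  obtain q where q: "?P = p * q" using assms(2) unfolding dvd_def by blast
  have Pnz: "?P \<noteq> 0" using assms(1) by (simp add: prod_zero_iff)
  hence nz: "p \<noteq> 0" "q \<noteq> 0" using q by auto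
  have "R \<subseteq> {r\<in>R. poly p r = 0} \<union> {r. poly q r = 0}"
  proof
    fix r assume r: "r \<in> R"
    have "poly ?P r = 0" using r assms(1) by (auto simp: poly_prod)
    thus "r \<in> {r\<in>R. poly p r = 0} \<union> {r. poly q r = 0}" using r by (simp add: q)
  qed
  hence "card R \<le> card ({r\<in>R. poly p r = 0} \<union> {r. poly q r = 0})"
    using assms(1) poly_roots_finite[OF nz(2)] by (intro card_mono) auto
  also have "\<dots> \<le> card {r\<in>R. poly p r = 0} + card {r. poly q r = 0}" by (rule card_Un_le)
  also have "card {r. poly q r = 0} \<le> degree q" by (rule card_poly_roots_bound[OF nz(2)])
  finally have "card R \<le> card {r\<in>R. poly p r = 0} + degree q" by simp
  moreover have "degree ?P = card R" by (subst degree_prod_eq_sum_degree) auto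
  moreover have "degree ?P = degree p + degree q" unfolding q by (rule degree_mult_eq[OF nz])
  ultimately show ?thesis by simp
qed

text \<open>The minimal polynomial of \<open>x\<close> over \<open>L\<close> divides both given polynomials, so its roots are
  simple and lie among the common roots.\<close>

lemma common_root_degree:
  assumes L: "is_subfield L" and R: "finite R" "(\<Prod>r\<in>R. [:-r, 1:]) \<in> polys_over L"
    and Q: "Q \<in> polys_over L" "poly Q x = 0" and x: "x \<in> R"
  shows "\<exists>p\<in>polys_over L. lead_coeff p = 1 \<and> poly p x = 0 \<and> degree p > 0 \<and>
    degree p \<le> card {r\<in>R. poly Q r = 0}"
proof -
  define I where "I p \<longleftrightarrow> p \<in> polys_over L \<and> lead_coeff p = 1 \<and> poly p x = 0" for p
  let ?P = "\<Prod>r\<in>R. [:-r, 1:]"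
  have Px: "poly ?P x = 0" using R x by (auto simp: poly_prod)
  have "lead_coeff ?P = 1" by (simp add: lead_coeff_prod)
  hence IP: "I ?P" using R Px by (simp add: I_def)
  define p where "p = arg_min degree I"
  have p: "I p" "\<And>q. I q \<Longrightarrow> degree p \<le> degree q"
    using arg_min_nat_lemma[of I ?P degree] IP by (auto simp: p_def)
  have p': "p \<in> polys_over L" "lead_coeff p = 1" "poly p x = 0" using p(1) by (auto simp: I_def)
  have dp: "degree p > 0"
  proof (rule ccontr)
    assume "\<not> degree p > 0"
    hence "p = [:1:]" using p'(2) degree0_coeffs[of p] by auto
    thus False using p'(3) by simp
  qed
  have dvd: "p dvd q" if q: "q \<in> polys_over L" "poly q x = 0" for q
  proof -
    obtain a r where ar: "r \<in> polys_over L" "q = p * a + r" "degree r < degree p"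
      using polys_over_division[OF L p'(1,2) dp q(1)] by blast
    have rx: "poly r x = 0" using ar(2) q(2) p'(3) by simp
    have "r = 0"
    proof (rule ccontr)
      assume r0: "r \<noteq> 0"
      define r' where "r' = Polynomial.smult (inverse (lead_coeff r)) r"
      have "lead_coeff r \<in> L" using ar(1) by (auto simp: polys_over_def)
      hence "r' \<in> polys_over L" unfolding r'_def
        by (intro polys_over_smult[OF L] is_subfieldD(6)[OF L] ar(1))
      moreover have "lead_coeff r' = 1" "poly r' x = 0" "degree r' = degree r"
        using r0 rx by (auto simp: r'_def)
      ultimately have "degree p \<le> degree r" using p(2)[of r'] by (simp add: I_def)
      thus False using ar(3) by simp
    qed
    thus ?thesis using ar(2) by simp
  qed
  have "p dvd ?P" by (rule dvd[OF R(2) Px])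
  hence "degree p \<le> card {r\<in>R. poly p r = 0}" by (rule degree_dvd_prod_linear[OF R(1)])
  also have "\<dots> \<le> card {r\<in>R. poly Q r = 0}"
  proof (intro card_mono)
    have "p dvd Q" by (rule dvd[OF Q])
    then obtain a where "Q = p * a" by (auto elim: dvdE)
    thus "{r\<in>R. poly p r = 0} \<subseteq> {r\<in>R. poly Q r = 0}" by auto
  qed (use R in auto)
  finally show ?thesis using p' dp by blast
qed

text \<open>A single common root leaves a monic polynomial of degree 1 over \<open>L\<close> with
  root \<open>x\<close>. This yields both the primitive element and the equality of \<open>K\<close>
  with the field generated by \<open>\<alpha>\<close>.\<close>

lemma common_root_unique:
  assumes L: "is_subfield L" and R: "finite R" "(\<Prod>r\<in>R. [:-r, 1:]) \<in> polys_over L"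
    and Q: "Q \<in> polys_over L" "poly Q x = 0" and x: "x \<in> R"
    and u: "\<And>r. r \<in> R \<Longrightarrow> poly Q r = 0 \<Longrightarrow> r = x"
  shows "x \<in> L"
proof -
  obtain p where p: "p \<in> polys_over L" "lead_coeff p = 1" "poly p x = 0" "degree p > 0"
    "degree p \<le> card {r\<in>R. poly Q r = 0}" using common_root_degree[OF L R Q x] by blast
  have "card {r\<in>R. poly Q r = 0} \<le> card {x}" using u by (intro card_mono) auto
  hence d: "degree p = 1" using p(4,5) by simp
  hence "poly p x = coeff p 0 + coeff p 1 * x" by (simp add: poly_altdef)
  hence "x = - coeff p 0" using p(2,3) d by simp
  moreover have "coeff p 0 \<in> L" using p(1) by (auto simp: polys_over_def)
  ultimately show ?thesis using is_subfieldD(5)[OF L] by simp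
qed

lemma fdeg_le:
  assumes L: "is_subfield L" and K: "is_subfield K" "x \<in> K"
    and gen: "\<And>y. y \<in> K \<Longrightarrow> \<exists>h\<in>polys_over L. y = poly h x"
    and p: "p \<in> polys_over L" "lead_coeff p = 1" "degree p > 0" "poly p x = 0"
  shows "fdeg K L \<le> degree p"
proof -
  \<comment> \<open>Powers of \<open>x\<close> may coincide as numbers, so \<open>B\<close> can have
    fewer than \<open>degree p\<close> elements; the coefficients of equal powers are added up
    below.\<close>
  define B where "B = (\<lambda>j. x ^ j) ` {..<degree p}"
  have B: "finite B" "B \<subseteq> K" "card B \<le> degree p"
    using is_subfield_power[OF K(1) K(2)] card_image_le[of "{..<degree p}" "\<lambda>j. x ^ j"]
    by (auto simp: B_def)
  have "\<exists>c. (\<forall>b\<in>B. c b \<in> L) \<and> y = (\<Sum>b\<in>B. c b * b)" if y: "y \<in> K" for y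
  proof -
    obtain h where h: "h \<in> polys_over L" "y = poly h x" using gen[OF y] by blast
    obtain q r where qr: "r \<in> polys_over L" "h = p * q + r" "degree r < degree p"
      using polys_over_division[OF L p(1-3) h(1)] by blast
    have "y = poly r x" using h(2) qr(2) p(4) by simp
    also have "\<dots> = (\<Sum>j\<le>degree r. coeff r j * x ^ j)" by (simp add: poly_altdef)
    also have "\<dots> = (\<Sum>j<degree p. coeff r j * x ^ j)"
      using qr(3) by (intro sum.mono_neutral_left) (auto simp: coeff_eq_0)
    also have "\<dots> = (\<Sum>b\<in>B. \<Sum>j | j \<in> {..<degree p} \<and> x ^ j = b. coeff r j * x ^ j)"
      unfolding B_def by (rule sum.image_gen) simp
    also have "\<dots> = (\<Sum>b\<in>B. (\<Sum>j | j \<in> {..<degree p} \<and> x ^ j = b. coeff r j) * b)"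
      by (intro sum.cong refl) (simp add: sum_distrib_right)
    finally have "y = (\<Sum>b\<in>B. (\<Sum>j | j \<in> {..<degree p} \<and> x ^ j = b. coeff r j) * b)" .
    moreover have "(\<Sum>j | j \<in> {..<degree p} \<and> x ^ j = b. coeff r j) \<in> L" for b
      using qr(1) by (intro is_subfield_sum[OF L]) (auto simp: polys_over_def)
    ultimately show ?thesis
      by (intro exI[of _ "\<lambda>b. \<Sum>j | j \<in> {..<degree p} \<and> x ^ j = b. coeff r j"]) auto
  qed
  hence "\<exists>B'. finite B' \<and> B' \<subseteq> K \<and> card B' = card B \<and>
      (\<forall>y\<in>K. \<exists>c. (\<forall>b\<in>B'. c b \<in> L) \<and> y = (\<Sum>b\<in>B'. c b * b))"
    using B by (intro exI[of _ B]) auto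
  hence "fdeg K L \<le> card B" unfolding fdeg_def by (rule Least_le)
  thus ?thesis using B(3) by simp
qed

section \<open>Simple extensions of the rationals and their embeddings\<close>

lemma is_minpoly_of_real: "is_minpoly f (complex_of_real x) \<longleftrightarrow> is_minpoly f x"
  by (simp add: is_minpoly_def rpoly_of_real)

lemma rpoly_inverse:
  fixes x :: real
  assumes x: "algebraic_int x" and y: "rpoly h x \<noteq> 0"
  shows "\<exists>k. inverse (rpoly h x) = rpoly k x"
proof -
  obtain f where f: "is_minpoly f x" using is_minpoly_exists[OF x] by blast
  have f': "is_minpoly f (complex_of_real x)" using f by (simp only: is_minpoly_of_real)
  \<comment> \<open>This serves to show that \<open>h(x)\<close> is algebraic. Its inverse is then
    read off from its minimal polynomial, whose constant term \<open>a\<close> is nonzero.\<close>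
  obtain c where c: "map_poly of_rat c = (\<Prod>z\<in>conjs f. [:- rpoly h z, 1:])"
    using conj_char_poly[OF f] by blast
  have "complex_of_real x \<in> conjs f" using is_minpolyD(2)[OF f'] by (simp only: conjs_def mem_Collect_eq)
  hence "rpoly c (rpoly h (complex_of_real x)) = 0"
    using is_minpoly_conjs(1)[OF f] unfolding c poly_prod by (intro prod_zero) auto
  hence c0: "rpoly c (rpoly h x) = 0" by (simp only: rpoly_of_real of_real_eq_0_iff)
  have "c \<noteq> 0"
  proof
    assume "c = 0"
    hence "(\<Prod>z\<in>conjs f. [:- rpoly h z, 1:]) = 0" using c by simp
    thus False using is_minpoly_conjs(1)[OF f] by (simp add: prod_zero_iff)
  qed
  then obtain g where g: "is_minpoly g (rpoly h x)" using is_minpoly_of_root[OF c0] by blast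
  obtain a q where gq: "g = pCons a q" by (cases g)
  have q0: "q \<noteq> 0" using is_minpoly_degree_pos[OF g] by (auto simp: gq split: if_splits)
  have e: "of_rat a + rpoly h x * rpoly q (rpoly h x) = 0"
    using is_minpolyD(2)[OF g] by (simp add: gq of_rat_hom.map_poly_pCons_hom)
  have a0: "a \<noteq> 0"
  proof
    assume "a = 0"
    hence "rpoly q (rpoly h x) = 0" using e y by simp
    hence "g dvd q" by (rule is_minpolyD(3)[OF g])
    hence "degree g \<le> degree q" using q0 by (rule dvd_imp_degree_le)
    thus False using q0 by (simp add: gq)
  qed
  have "inverse (rpoly h x) = of_rat (- inverse a) * rpoly q (rpoly h x)"
  proof -
    define A Y Q where "A = real_of_rat a" and "Y = rpoly h x" and "Q = rpoly q (rpoly h x)"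
    have "A \<noteq> 0" "Y \<noteq> 0" "A = - (Y * Q)" using a0 y e by (auto simp: A_def Y_def Q_def)
    hence "inverse Y = - inverse A * Q" by (simp add: field_simps)
    thus ?thesis by (simp add: A_def Y_def Q_def of_rat_minus of_rat_inverse)
  qed
  also have "\<dots> = rpoly (Polynomial.smult (- inverse a) (pcompose q h)) x"
    by (simp only: rpoly_smult rpoly_pcompose)
  finally show ?thesis by blast
qed

lemma gen_field_simple:
  assumes x: "algebraic_int (x::real)"
  shows "gen_field {x} = range (\<lambda>h. rpoly h x)"
proof
  have "is_subfield (range (\<lambda>h. rpoly h x))"
    unfolding is_subfield_def
  proof (intro conjI ballI impI)
    show "0 \<in> range (\<lambda>h. rpoly h x)" by (rule range_eqI[of _ _ 0]) simp
    show "1 \<in> range (\<lambda>h. rpoly h x)" by (rule range_eqI[of _ _ 1]) simp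
    fix y z assume yz: "y \<in> range (\<lambda>h. rpoly h x)" "z \<in> range (\<lambda>h. rpoly h x)"
    then obtain h k where hk: "y = rpoly h x" "z = rpoly k x" by blast
    show "y + z \<in> range (\<lambda>h. rpoly h x)" unfolding hk rpoly_add[symmetric] by blast
    show "y * z \<in> range (\<lambda>h. rpoly h x)" unfolding hk rpoly_mult[symmetric] by blast
  next
    fix y assume y: "y \<in> range (\<lambda>h. rpoly h x)"
    then obtain h where h: "y = rpoly h x" by blast
    show "- y \<in> range (\<lambda>h. rpoly h x)" unfolding h rpoly_uminus[symmetric] by blast
    show "inverse y \<in> range (\<lambda>h. rpoly h x)" if "y \<noteq> 0"
      using rpoly_inverse[OF x, of h] that unfolding h by blast
  qed
  moreover have "x \<in> range (\<lambda>h. rpoly h x)" by (rule range_eqI[of _ _ "[:0, 1:]"]) (simp only: rpoly_X)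
  ultimately show "gen_field {x} \<subseteq> range (\<lambda>h. rpoly h x)" by (intro gen_field_least) auto
  show "range (\<lambda>h. rpoly h x) \<subseteq> gen_field {x}"
    using rpoly_in_subfield[OF is_subfield_gen_field, of x] gen_field_superset[of "{x}"] by auto
qed

text \<open>The value at \<open>y\<close> is computed from some polynomial representing
  \<open>y\<close>; two representatives differ by a multiple of \<open>f\<close>, which vanishes at
  \<open>z\<close>.\<close>

lemma embedding_exists:
  assumes f: "is_minpoly f x" and z: "rpoly f z = 0"
  shows "\<exists>\<sigma>. \<forall>h. \<sigma> (rpoly h x) = rpoly h z"
proof (intro exI allI)
  fix h
  define k where "k = (SOME k. rpoly k x = rpoly h x)"
  have "rpoly k x = rpoly h x" unfolding k_def by (rule someI[of _ h]) simp
  hence "rpoly (k - h) x = 0" by (simp only: rpoly_diff) simp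
  hence "f dvd k - h" by (rule is_minpolyD(3)[OF f])
  then obtain q where q: "k - h = f * q" by (auto elim: dvdE)
  have "rpoly k z - rpoly h z = rpoly f z * rpoly q z" unfolding rpoly_diff[symmetric] q by (rule rpoly_mult)
  thus "(\<lambda>y. rpoly (SOME k. rpoly k x = y) z) (rpoly h x) = rpoly h z"
    using z by (simp add: k_def)
qed

section \<open>The norm inequality\<close>

text \<open>Integral polynomials in two variables, kept as functions so that each auxiliary
  \<open>q\<close> can be written as a plain term in \<open>a\<close> and \<open>b\<close>.\<close>

inductive int_poly2 :: "(real \<Rightarrow> real \<Rightarrow> real) \<Rightarrow> bool" where
  const: "int_poly2 (\<lambda>a b. of_int c)"
| fst: "int_poly2 (\<lambda>a b. a)"
| snd: "int_poly2 (\<lambda>a b. b)"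
| add: "int_poly2 q \<Longrightarrow> int_poly2 r \<Longrightarrow> int_poly2 (\<lambda>a b. q a b + r a b)"
| mult: "int_poly2 q \<Longrightarrow> int_poly2 r \<Longrightarrow> int_poly2 (\<lambda>a b. q a b * r a b)"

lemma int_poly2_numeral: "int_poly2 (\<lambda>a b. numeral n)"
  using int_poly2.const[of "numeral n"] by simp

lemma int_poly2_one: "int_poly2 (\<lambda>a b. 1)"
  using int_poly2.const[of 1] by simp

lemma int_poly2_diff: "int_poly2 q \<Longrightarrow> int_poly2 r \<Longrightarrow> int_poly2 (\<lambda>a b. q a b - r a b)"
  using int_poly2.add[OF _ int_poly2.mult[OF int_poly2.const[of "- 1"]], of q r] by simp

lemma int_poly2_power: "int_poly2 q \<Longrightarrow> int_poly2 (\<lambda>a b. q a b ^ n)"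
  by (induction n) (auto intro: int_poly2_one int_poly2.mult)

lemmas int_poly2_intros = int_poly2.fst int_poly2.snd int_poly2.add int_poly2.mult
  int_poly2_numeral int_poly2_one int_poly2_diff int_poly2_power

lemma int_poly2_algebraic_int:
  "int_poly2 q \<Longrightarrow> algebraic_int a \<Longrightarrow> algebraic_int b \<Longrightarrow> algebraic_int (q a b)"
  by (induction rule: int_poly2.induct) (auto intro: algebraic_int_plus algebraic_int_times)

lemma int_poly2_rpoly:
  "int_poly2 q \<Longrightarrow> \<exists>h. \<forall>t. q (rpoly h1 t) (rpoly h2 t) = rpoly h t"
proof (induction rule: int_poly2.induct)
  case (const c)
  show ?case by (intro exI[of _ "[:of_int c:]"]) (simp add: rpoly_const)
next
  case (add q r)
  then obtain h k where "\<forall>t. q (rpoly h1 t) (rpoly h2 t) = rpoly h t"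
    "\<forall>t. r (rpoly h1 t) (rpoly h2 t) = rpoly k t" by blast
  thus ?case by (intro exI[of _ "h + k"]) (simp only: rpoly_add, simp)
next
  case (mult q r)
  then obtain h k where "\<forall>t. q (rpoly h1 t) (rpoly h2 t) = rpoly h t"
    "\<forall>t. r (rpoly h1 t) (rpoly h2 t) = rpoly k t" by blast
  thus ?case by (intro exI[of _ "h * k"]) (simp only: rpoly_mult, simp)
qed blast+

lemma real_conjs:
  assumes f: "is_minpoly f (x::real)" and real: "conjs f \<subseteq> \<real>"
  shows "conjs f = complex_of_real ` {t. rpoly f t = 0}" "finite {t::real. rpoly f t = 0}"
    "card {t::real. rpoly f t = 0} = card (conjs f)"
    "map_poly of_rat f = (\<Prod>r\<in>{t::real. rpoly f t = 0}. [:-r, 1:])"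
proof -
  show c: "conjs f = complex_of_real ` {t. rpoly f t = 0}"
  proof
    show "conjs f \<subseteq> complex_of_real ` {t. rpoly f t = 0}"
    proof
      fix z assume z: "z \<in> conjs f"
      then obtain t where t: "z = complex_of_real t" using real by (auto elim: Reals_cases)
      have "rpoly f t = 0" using z unfolding conjs_def t mem_Collect_eq rpoly_of_real by simp
      thus "z \<in> complex_of_real ` {t. rpoly f t = 0}" using t by blast
    qed
    show "complex_of_real ` {t. rpoly f t = 0} \<subseteq> conjs f"
      unfolding conjs_def by (auto simp only: rpoly_of_real mem_Collect_eq of_real_0)
  qed
  have inj: "inj_on complex_of_real A" for A by (auto simp: inj_on_def)
  show fin: "finite {t::real. rpoly f t = 0}"
    using is_minpoly_conjs(1)[OF f] unfolding c by (rule finite_imageD[OF _ inj])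
  show "card {t::real. rpoly f t = 0} = card (conjs f)" unfolding c by (rule card_image[OF inj, symmetric])
  have "map_poly complex_of_real (map_poly of_rat f) = map_poly of_rat f"
    by (intro poly_eqI) (simp add: coeff_map_poly of_real_of_rat)
  also have "\<dots> = (\<Prod>z\<in>conjs f. [:-z, 1:])" by (rule is_minpoly_conjs(3)[OF f])
  also have "\<dots> = (\<Prod>r\<in>{t::real. rpoly f t = 0}. [:-complex_of_real r, 1:])"
    unfolding c by (subst prod.reindex[OF inj]) simp
  also have "\<dots> = map_poly complex_of_real (\<Prod>r\<in>{t::real. rpoly f t = 0}. [:-r, 1:])"
  proof -
    interpret m: map_poly_comm_ring_hom complex_of_real ..
    show ?thesis by (simp add: m.hom_prod of_real_hom.map_poly_pCons_hom)
  qed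
  finally have "map_poly complex_of_real (map_poly of_rat f) =
      map_poly complex_of_real (\<Prod>r\<in>{t::real. rpoly f t = 0}. [:-r, 1:])" .
  hence "coeff (map_poly complex_of_real (map_poly of_rat f)) i =
      coeff (map_poly complex_of_real (\<Prod>r\<in>{t::real. rpoly f t = 0}. [:-r, 1:])) i" for i by simp
  thus "map_poly of_rat f = (\<Prod>r\<in>{t::real. rpoly f t = 0}. [:-r, 1:])"
    by (intro poly_eqI) (simp add: coeff_map_poly)
qed

text \<open>Every conjugate of \<open>\<alpha>\<close> is its image under a complex embedding of the
  field it generates.\<close>

lemma totally_real_conjs:
  assumes a: "algebraic_int \<alpha>" "totally_real \<alpha>" and f: "is_minpoly f \<alpha>"
  shows "conjs f \<subseteq> \<real>"
proof
  fix z assume "z \<in> conjs f"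
  hence z: "rpoly f z = 0" by (simp only: conjs_def mem_Collect_eq)
  obtain \<sigma> where \<sigma>: "\<And>h. \<sigma> (rpoly h \<alpha>) = rpoly h z" using embedding_exists[OF f z] by blast
  have "complex_emb (gen_field {\<alpha>}) \<sigma>"
    unfolding complex_emb_def gen_field_simple[OF a(1)]
  proof (intro conjI ballI)
    show "\<sigma> 1 = 1" using \<sigma>[of 1] by simp
    fix x y assume "x \<in> range (\<lambda>h. rpoly h \<alpha>)" "y \<in> range (\<lambda>h. rpoly h \<alpha>)"
    then obtain h k where hk: "x = rpoly h \<alpha>" "y = rpoly k \<alpha>" by blast
    show "\<sigma> (x + y) = \<sigma> x + \<sigma> y" unfolding hk rpoly_add[symmetric] \<sigma> by (rule refl)
    show "\<sigma> (x * y) = \<sigma> x * \<sigma> y" unfolding hk rpoly_mult[symmetric] \<sigma> by (rule refl)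
  qed
  hence "\<sigma> \<alpha> \<in> \<real>" using a(2) by (simp add: totally_real_def)
  thus "z \<in> \<real>" using \<sigma>[of "[:0, 1:]"] by (simp only: rpoly_X)
qed

lemma primitive_element:
  fixes x y :: real
  assumes x: "algebraic_int x" "is_minpoly f x" "conjs f \<subseteq> \<real>"
    and y: "algebraic_int y" "is_minpoly g y" "conjs g \<subseteq> \<real>"
  obtains l :: nat and h1 h2 where "algebraic_int (x + real l * y)"
    "x = rpoly h1 (x + real l * y)" "y = rpoly h2 (x + real l * y)"
proof -
  define A B where "A = {t::real. rpoly f t = 0}" and "B = {t::real. rpoly g t = 0}"
  note fA = real_conjs[OF x(2,3), folded A_def] and gB = real_conjs[OF y(2,3), folded B_def]
  \<comment> \<open>\<open>l\<close> is bad if \<open>x + l y = a + l b\<close> for conjugates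
    \<open>a\<close> of \<open>x\<close> and \<open>b \<noteq> y\<close> of \<open>y\<close>. For
    \<open>b = y\<close> the quotient is 0 by convention, which discards only
    \<open>l = 0\<close>.\<close>
  let ?bad = "(\<lambda>(a, b). (a - x) / (y - b)) ` (A \<times> B)"
  have "finite ?bad" by (intro finite_imageI finite_cartesian_product fA(2) gB(2))
  moreover have "infinite (range real)" by (rule range_inj_infinite) (simp add: inj_on_def)
  ultimately have "\<not> range real \<subseteq> ?bad" using finite_subset by blast
  then obtain l :: nat where l: "real l \<notin> ?bad" by blast
  define t where "t = x + real l * y"
  have t: "algebraic_int t" unfolding t_def
    by (intro algebraic_int_plus algebraic_int_times x y algebraic_int_of_nat)
  define L where "L = gen_field {t}"
  have L: "is_subfield L" unfolding L_def by (rule is_subfield_gen_field)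
  have tL: "t \<in> L" using gen_field_superset[of "{t}"] by (simp add: L_def)
  \<comment> \<open>\<open>Q(r) = f(t - l r)\<close> vanishes at \<open>y\<close>; by the choice of
    \<open>l\<close> no other conjugate of \<open>y\<close> is a root.\<close>
  define Q where "Q = pcompose (map_poly of_rat f) [:t, - real l:]"
  have Qv: "poly Q r = rpoly f (t - real l * r)" for r
    by (simp add: Q_def poly_pcompose algebra_simps)
  have yL: "y \<in> L"
  proof (rule common_root_unique[OF L gB(2), of Q])
    show "(\<Prod>r\<in>B. [:- r, 1:]) \<in> polys_over L" unfolding gB(4)[symmetric] by (rule polys_over_of_rat[OF L])
    show "Q \<in> polys_over L" unfolding Q_def
      by (intro polys_over_pcompose[OF L] polys_over_of_rat[OF L] polys_over_pCons[OF L] tL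
          polys_over_0[OF L] is_subfieldD(5)[OF L] is_subfield_of_nat[OF L])
    show "poly Q y = 0" unfolding Qv using is_minpolyD(2)[OF x(2)] by (simp add: t_def)
    show "y \<in> B" using is_minpolyD(2)[OF y(2)] by (simp only: B_def mem_Collect_eq)
    fix r assume r: "r \<in> B" "poly Q r = 0"
    define a where "a = t - real l * r"
    have "rpoly f a = 0" using r(2) by (simp only: Qv a_def)
    hence a: "a \<in> A" by (simp only: A_def mem_Collect_eq)
    show "r = y"
    proof (rule ccontr)
      assume "r \<noteq> y"
      hence "real l = (a - x) / (y - r)" by (simp add: a_def t_def field_simps)
      thus False using l a r(1) by (auto simp: image_iff)
    qed
  qed
  have "x = t - real l * y" by (simp add: t_def)
  hence xL: "x \<in> L"
    using is_subfield_diff[OF L tL is_subfieldD(4)[OF L is_subfield_of_nat[OF L] yL]] by simp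
  have "L = range (\<lambda>h. rpoly h t)" unfolding L_def by (rule gen_field_simple[OF t])
  then obtain h1 h2 where "x = rpoly h1 t" "y = rpoly h2 t" using xL yL by blast
  thus ?thesis using that[of l] t unfolding t_def by blast
qed

lemma Fd_eq: "Fd d = gen_field {4 * sin (pi / real d) ^ 2}"
proof -
  have e: "4 * sin (pi / real d) ^ 2 = 4 - 4 * cos (pi / real d) ^ 2"
    by (simp add: sin_squared_eq algebra_simps)
  have four: "4 \<in> K" if "is_subfield K" for K using is_subfield_of_nat[OF that, of 4] by simp
  have "4 * sin (pi / real d) ^ 2 \<in> Fd d"
  proof -
    have K: "is_subfield (Fd d)" unfolding Fd_def by (rule is_subfield_gen_field)
    have "cos (pi / real d) ^ 2 \<in> Fd d" using gen_field_superset by (auto simp: Fd_def)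
    thus ?thesis unfolding e by (intro is_subfield_diff[OF K] is_subfieldD(4)[OF K] four[OF K])
  qed
  moreover have "cos (pi / real d) ^ 2 \<in> gen_field {4 * sin (pi / real d) ^ 2}" (is "_ \<in> ?G")
  proof -
    have K: "is_subfield ?G" by (rule is_subfield_gen_field)
    have s: "4 * sin (pi / real d) ^ 2 \<in> ?G" using gen_field_superset by auto
    have "1 - 4 * sin (pi / real d) ^ 2 * inverse 4 \<in> ?G"
      by (intro is_subfield_diff[OF K] is_subfieldD[OF K] four[OF K] s)
    moreover have "1 - 4 * sin (pi / real d) ^ 2 * inverse 4 = cos (pi / real d) ^ 2"
      unfolding e by (simp add: field_simps)
    ultimately show ?thesis by (simp only:)
  qed
  ultimately show ?thesis unfolding Fd_def
    by (intro antisym gen_field_least is_subfield_gen_field) auto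
qed

text \<open>\<open>T\<close> is the set of real roots of the minimal polynomial of
  \<open>\<theta> = \<alpha> + l s\<close>, one for each embedding of \<open>K\<close>, with
  \<open>\<theta>\<close> itself for the identity; \<open>a t\<close> and \<open>b t\<close> are the
  images of \<open>\<alpha>\<close> and \<open>s\<close>.\<close>

lemma norm_setup:
  fixes d :: nat and \<alpha> :: real
  defines "s \<equiv> 4 * sin (pi / real d) ^ 2"
  defines "K \<equiv> gen_field (Fd d \<union> {\<alpha>})"
  assumes d: "d \<ge> 3" and \<alpha>: "algebraic_int \<alpha>" "totally_real \<alpha>" "4 < \<alpha>"
    and emb: "\<forall>\<sigma>. real_emb K \<sigma> \<and> (\<exists>x\<in>K. \<sigma> x \<noteq> x) \<longrightarrow> 0 < \<sigma> \<alpha> \<and> \<sigma> \<alpha> < \<sigma> s"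
  obtains T :: "real set" and \<theta> a b m where
    "finite T" "\<theta> \<in> T" "a \<theta> = \<alpha>" "b \<theta> = s"
    "\<And>t. t \<in> T \<Longrightarrow> t \<noteq> \<theta> \<Longrightarrow> 0 < a t \<and> a t < b t"
    "b ` T \<subseteq> sin2_conjs d" "m > 0"
    "\<And>y. y \<in> sin2_conjs d \<Longrightarrow> card {t\<in>T. b t = y} = m"
    "K = gen_field {\<alpha>}" "fdeg K (Fd d) \<le> m" "fdeg K (gen_field {}) \<le> card T"
    "\<And>q. int_poly2 q \<Longrightarrow> q \<alpha> s \<noteq> 0 \<Longrightarrow> 1 \<le> (\<Prod>t\<in>T. \<bar>q (a t) (b t)\<bar>)"
proof -
  have s: "algebraic_int s" unfolding s_def using d by (intro algebraic_int_4_sin2) auto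
  obtain f where f: "is_minpoly f \<alpha>" using is_minpoly_exists[OF \<alpha>(1)] by blast
  obtain g where g: "is_minpoly g s" using is_minpoly_exists[OF s] by blast
  have g': "is_minpoly g (complex_of_real s)" using g by (simp only: is_minpoly_of_real)
  have cg: "conjs g = complex_of_real ` sin2_conjs d"
    using conjs_sin2[OF d] g' unfolding s_def by blast
  have freal: "conjs f \<subseteq> \<real>" by (rule totally_real_conjs[OF \<alpha>(1,2) f])
  have greal: "conjs g \<subseteq> \<real>" unfolding cg by auto
  obtain l :: nat and h1 h2 where prim: "algebraic_int (\<alpha> + real l * s)"
    "\<alpha> = rpoly h1 (\<alpha> + real l * s)" "s = rpoly h2 (\<alpha> + real l * s)"
    using primitive_element[OF \<alpha>(1) f freal s g greal] by blast
  define \<theta> where "\<theta> = \<alpha> + real l * s"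
  note \<theta> = prim[folded \<theta>_def]
  obtain F where F: "is_minpoly F \<theta>" using is_minpoly_exists[OF \<theta>(1)] by blast
  have F': "is_minpoly F (complex_of_real \<theta>)" using F by (simp only: is_minpoly_of_real)
  have h1z: "rpoly h1 z \<in> conjs f" if z: "z \<in> conjs F" for z
    using rpoly_conj_root[OF F, of f h1 z] is_minpolyD(2)[OF f] z \<theta>(2)
    unfolding conjs_def by simp
  have h2z: "rpoly h2 z \<in> conjs g" if z: "z \<in> conjs F" for z
    using rpoly_conj_root[OF F, of g h2 z] is_minpolyD(2)[OF g] z \<theta>(3)
    unfolding conjs_def by simp
  \<comment> \<open>The relation \<open>\<theta> = h1(\<theta>) + l h2(\<theta>)\<close> passes to
    every conjugate, and the values of \<open>h1\<close> and \<open>h2\<close> there are conjugates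
    of \<open>\<alpha>\<close> and \<open>s\<close>, hence real.\<close>
  have Freal: "conjs F \<subseteq> \<real>"
  proof
    fix z assume z: "z \<in> conjs F"
    have "rpoly ([:0, 1:] - (h1 + [:of_nat l:] * h2)) \<theta> = 0"
      unfolding rpoly_diff rpoly_add rpoly_mult rpoly_X rpoly_const \<theta>(2,3)[symmetric]
      by (simp add: \<theta>_def)
    hence "F dvd [:0, 1:] - (h1 + [:of_nat l:] * h2)" by (rule is_minpolyD(3)[OF F])
    then obtain q where q: "[:0, 1:] - (h1 + [:of_nat l:] * h2) = F * q" unfolding dvd_def by blast
    have "rpoly ([:0, 1:] - (h1 + [:of_nat l:] * h2)) z = rpoly F z * rpoly q z"
      unfolding q by (rule rpoly_mult)
    hence "z = rpoly h1 z + of_nat l * rpoly h2 z"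
      using z unfolding conjs_def mem_Collect_eq rpoly_diff rpoly_add rpoly_mult rpoly_X rpoly_const by simp
    moreover have "rpoly h1 z \<in> \<real>" "rpoly h2 z \<in> \<real>" using h1z[OF z] h2z[OF z] freal greal by auto
    ultimately show "z \<in> \<real>" by (metis Reals_add Reals_mult Reals_of_nat)
  qed
  define T where "T = {t::real. rpoly F t = 0}"
  note T = real_conjs[OF F Freal, folded T_def]
  have \<theta>T: "\<theta> \<in> T" using is_minpolyD(2)[OF F] by (simp only: T_def mem_Collect_eq)
  define a b where "a = (\<lambda>t::real. rpoly h1 t)" and "b = (\<lambda>t::real. rpoly h2 t)"
  have a\<theta>: "a \<theta> = \<alpha>" and b\<theta>: "b \<theta> = s" using \<theta>(2,3) by (auto simp only: a_def b_def)
  have bT: "b ` T \<subseteq> sin2_conjs d"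
  proof
    fix y assume "y \<in> b ` T"
    then obtain t where t: "t \<in> T" "y = rpoly h2 t" by (auto simp only: b_def)
    have "complex_of_real t \<in> conjs F" using t(1) T(1) by blast
    hence "complex_of_real y \<in> conjs g" using h2z unfolding t(2) rpoly_of_real[symmetric] by blast
    thus "y \<in> sin2_conjs d" unfolding cg by auto
  qed
  have K\<theta>: "K = gen_field {\<theta>}"
  proof
    have G: "is_subfield (gen_field {\<theta>})" by (rule is_subfield_gen_field)
    have "\<theta> \<in> gen_field {\<theta>}" using gen_field_superset by auto
    hence "\<alpha> \<in> gen_field {\<theta>}" "s \<in> gen_field {\<theta>}"
      using rpoly_in_subfield[OF G] \<theta>(2,3) by metis+
    moreover from this have "Fd d \<subseteq> gen_field {\<theta>}"
      unfolding Fd_eq s_def[symmetric] by (intro gen_field_least G) auto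
    ultimately show "K \<subseteq> gen_field {\<theta>}" unfolding K_def by (intro gen_field_least G) auto
    have K: "is_subfield K" unfolding K_def by (rule is_subfield_gen_field)
    have "s \<in> Fd d" unfolding Fd_eq s_def[symmetric] using gen_field_superset by auto
    hence "\<alpha> \<in> K" "s \<in> K" unfolding K_def using gen_field_superset[of "Fd d \<union> {\<alpha>}"] by auto
    hence "\<theta> \<in> K" unfolding \<theta>_def by (intro is_subfieldD(3,4)[OF K] is_subfield_of_nat[OF K])
    thus "gen_field {\<theta>} \<subseteq> K" by (intro gen_field_least K) auto
  qed
  have Kr: "K = range (\<lambda>h. rpoly h \<theta>)" unfolding K\<theta> by (rule gen_field_simple[OF \<theta>(1)])
  have ab: "0 < a t \<and> a t < b t" if t: "t \<in> T" "t \<noteq> \<theta>" for t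
  proof -
    have "rpoly F t = 0" using t(1) by (simp only: T_def mem_Collect_eq)
    then obtain \<sigma> where \<sigma>: "\<And>h. \<sigma> (rpoly h \<theta>) = rpoly h t" using embedding_exists[OF F] by blast
    have "real_emb K \<sigma>"
      unfolding real_emb_def Kr
    proof (intro conjI ballI)
      show "\<sigma> 1 = 1" using \<sigma>[of 1] by simp
      fix x y assume "x \<in> range (\<lambda>h. rpoly h \<theta>)" "y \<in> range (\<lambda>h. rpoly h \<theta>)"
      then obtain h k where hk: "x = rpoly h \<theta>" "y = rpoly k \<theta>" by blast
      show "\<sigma> (x + y) = \<sigma> x + \<sigma> y" unfolding hk rpoly_add[symmetric] \<sigma> by (rule refl)
      show "\<sigma> (x * y) = \<sigma> x * \<sigma> y" unfolding hk rpoly_mult[symmetric] \<sigma> by (rule refl)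
    qed
    moreover have "\<theta> \<in> K" unfolding K\<theta> using gen_field_superset by auto
    moreover have "\<sigma> \<theta> \<noteq> \<theta>" using \<sigma>[of "[:0, 1:]"] t(2) by (simp only: rpoly_X) simp
    ultimately have "0 < \<sigma> \<alpha> \<and> \<sigma> \<alpha> < \<sigma> s" using emb by blast
    moreover have "\<sigma> \<alpha> = a t" "\<sigma> s = b t" using \<sigma> \<theta>(2,3) by (auto simp only: a_def b_def)
    ultimately show ?thesis by simp
  qed
  have le4: "y \<le> 4" if "y \<in> sin2_conjs d" for y
    using that by (auto simp: sin2_conjs_def abs_square_le_1 abs_sin_le_one)
  have a_inj: "t = \<theta>" if t: "t \<in> T" "a t = \<alpha>" for t
  proof (rule ccontr)
    assume "t \<noteq> \<theta>"
    hence "a t < b t" using ab t(1) by blast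
    moreover have "b t \<le> 4" using bT t(1) le4 by blast
    ultimately show False using t(2) \<alpha>(3) by simp
  qed
  \<comment> \<open>By \<open>a_inj\<close>, \<open>\<theta>\<close> is the only root of its minimal
    polynomial at which \<open>h1\<close> takes the value \<open>\<alpha>\<close>.\<close>
  have "\<theta> \<in> gen_field {\<alpha>}"
  proof (rule common_root_unique[OF _ T(2), of _ "map_poly of_rat h1 - [:\<alpha>:]"])
    show G: "is_subfield (gen_field {\<alpha>})" by (rule is_subfield_gen_field)
    show "(\<Prod>r\<in>T. [:- r, 1:]) \<in> polys_over (gen_field {\<alpha>})"
      unfolding T(4)[symmetric] by (rule polys_over_of_rat[OF G])
    have "\<alpha> \<in> gen_field {\<alpha>}" using gen_field_superset by auto
    thus "map_poly of_rat h1 - [:\<alpha>:] \<in> polys_over (gen_field {\<alpha>})"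
      by (intro polys_over_diff[OF G] polys_over_of_rat[OF G] polys_over_pCons[OF G] polys_over_0[OF G])
    show "poly (map_poly of_rat h1 - [:\<alpha>:]) \<theta> = 0" using \<theta>(2) by simp
    fix r assume "r \<in> T" "poly (map_poly of_rat h1 - [:\<alpha>:]) r = 0"
    thus "r = \<theta>" using a_inj[of r] by (simp add: a_def)
  qed (rule \<theta>T)
  hence "K \<subseteq> gen_field {\<alpha>}" unfolding K\<theta> by (intro gen_field_least is_subfield_gen_field) auto
  moreover have "gen_field {\<alpha>} \<subseteq> K" unfolding K_def
    using gen_field_superset[of "Fd d \<union> {\<alpha>}"] by (intro gen_field_least is_subfield_gen_field) auto
  ultimately have K\<alpha>: "K = gen_field {\<alpha>}" by blast
  have gh2: "is_minpoly g (rpoly h2 (complex_of_real \<theta>))"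
    using g' \<theta>(3) by (simp only: rpoly_of_real)
  obtain m where m: "m > 0" "\<And>y. y \<in> conjs g \<Longrightarrow> card {z\<in>conjs F. rpoly h2 z = y} = m"
    using conj_fibres[OF F' gh2] by blast
  have fib: "card {t\<in>T. b t = y} = m" if y: "y \<in> sin2_conjs d" for y
  proof -
    have "{z\<in>conjs F. rpoly h2 z = complex_of_real y} = complex_of_real ` {t\<in>T. b t = y}"
      unfolding T(1) b_def by (auto simp only: rpoly_of_real of_real_eq_iff)
    hence "card {z\<in>conjs F. rpoly h2 z = complex_of_real y} = card {t\<in>T. b t = y}"
      by (simp add: card_image inj_on_def)
    moreover have "complex_of_real y \<in> conjs g" using y unfolding cg by blast
    ultimately show ?thesis using m(2) by simp
  qed
  have \<theta>K: "\<theta> \<in> K" "is_subfield K" unfolding K\<theta> using gen_field_superset is_subfield_gen_field by auto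
  have gen: "\<exists>h\<in>polys_over L. y = poly h \<theta>" if "is_subfield L" "y \<in> K" for y L
    using that(2) polys_over_of_rat[OF that(1)] unfolding Kr by blast
  have dm: "fdeg K (Fd d) \<le> m"
  proof -
    have G: "is_subfield (Fd d)" unfolding Fd_def by (rule is_subfield_gen_field)
    have sF: "s \<in> Fd d" unfolding Fd_eq s_def[symmetric] using gen_field_superset by auto
    \<comment> \<open>The common roots of the minimal polynomial of \<open>\<theta>\<close> and
      \<open>h2 - s\<close> form the fibre of \<open>b\<close> over \<open>s\<close>, so
      \<open>\<theta>\<close> has degree at most \<open>m\<close> over \<open>Fd d\<close>.\<close>
    have "\<exists>p\<in>polys_over (Fd d). lead_coeff p = 1 \<and> poly p \<theta> = 0 \<and> degree p > 0 \<and>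
        degree p \<le> card {r\<in>T. poly (map_poly of_rat h2 - [:s:]) r = 0}"
    proof (rule common_root_degree[OF G T(2)])
      show "(\<Prod>r\<in>T. [:- r, 1:]) \<in> polys_over (Fd d)"
        unfolding T(4)[symmetric] by (rule polys_over_of_rat[OF G])
      show "map_poly of_rat h2 - [:s:] \<in> polys_over (Fd d)"
        by (intro polys_over_diff[OF G] polys_over_of_rat[OF G] polys_over_pCons[OF G] polys_over_0[OF G] sF)
      show "poly (map_poly of_rat h2 - [:s:]) \<theta> = 0" using \<theta>(3) by simp
    qed (rule \<theta>T)
    then obtain p where p: "p \<in> polys_over (Fd d)" "lead_coeff p = 1" "poly p \<theta> = 0" "degree p > 0"
      "degree p \<le> card {r\<in>T. poly (map_poly of_rat h2 - [:s:]) r = 0}" by blast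
    have "{r\<in>T. poly (map_poly of_rat h2 - [:s:]) r = 0} = {t\<in>T. b t = s}" by (auto simp: b_def)
    moreover have "s \<in> sin2_conjs d" using bT \<theta>T b\<theta> by blast
    ultimately have "degree p \<le> m" using p(5) fib by simp
    moreover have "fdeg K (Fd d) \<le> degree p"
      by (rule fdeg_le[OF G \<theta>K(2,1) gen[OF G] p(1,2,4,3)])
    ultimately show ?thesis by simp
  qed
  have dT: "fdeg K (gen_field {}) \<le> card T"
  proof -
    have G: "is_subfield (gen_field {})" by (rule is_subfield_gen_field)
    let ?p = "map_poly of_rat F :: real poly"
    have "fdeg K (gen_field {}) \<le> degree ?p"
    proof (rule fdeg_le[OF G \<theta>K(2,1) gen[OF G] polys_over_of_rat[OF G]])
      show "lead_coeff ?p = 1" using is_minpolyD(1)[OF F] by simp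
      show "degree ?p > 0" using is_minpoly_degree_pos[OF F] by simp
      show "poly ?p \<theta> = 0" by (rule is_minpolyD(2)[OF F])
    qed
    thus ?thesis using T(3) is_minpoly_conjs(2)[OF F] by simp
  qed
  have norm: "1 \<le> (\<Prod>t\<in>T. \<bar>q (a t) (b t)\<bar>)" if q: "int_poly2 q" "q \<alpha> s \<noteq> 0" for q
  proof -
    obtain h where h: "\<And>t. q (a t) (b t) = rpoly h t"
      using int_poly2_rpoly[OF q(1)] unfolding a_def b_def by blast
    have q\<theta>: "q \<alpha> s = rpoly h \<theta>" using h[of \<theta>] by (simp only: a\<theta> b\<theta>)
    have "1 \<le> (\<Prod>z\<in>conjs F. norm (rpoly h z))"
    proof (rule rat_algebraic_int_prod_ge_1[OF F'])
      show "algebraic_int (rpoly h (complex_of_real \<theta>))"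
        using int_poly2_algebraic_int[OF q(1) \<alpha>(1) s] unfolding q\<theta> rpoly_of_real algebraic_int_of_real_iff .
      show "rpoly h (complex_of_real \<theta>) \<noteq> 0"
        using q(2) unfolding q\<theta> rpoly_of_real of_real_eq_0_iff .
    qed
    also have "\<dots> = (\<Prod>t\<in>T. norm (rpoly h (complex_of_real t)))"
      unfolding T(1) by (subst prod.reindex) (auto simp: inj_on_def)
    also have "\<dots> = (\<Prod>t\<in>T. \<bar>q (a t) (b t)\<bar>)"
      by (simp only: rpoly_of_real norm_of_real h)
    finally show ?thesis .
  qed
  show ?thesis using that[OF T(2) \<theta>T a\<theta> b\<theta> ab bT m(1) fib K\<alpha> dm dT norm] by blast
qed

lemma norm_inequality:
  fixes d :: nat and \<alpha> :: real
  defines "s \<equiv> 4 * sin (pi / real d) ^ 2"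
  defines "K \<equiv> gen_field (Fd d \<union> {\<alpha>})"
  assumes d: "d \<ge> 3" and \<alpha>: "algebraic_int \<alpha>" "totally_real \<alpha>" "4 < \<alpha>"
    and emb: "\<forall>\<sigma>. real_emb K \<sigma> \<and> (\<exists>x\<in>K. \<sigma> x \<noteq> x) \<longrightarrow> 0 < \<sigma> \<alpha> \<and> \<sigma> \<alpha> < \<sigma> s"
  obtains m where "m > 0" "K = gen_field {\<alpha>}" "fdeg K (Fd d) \<le> m"
    "fdeg K (gen_field {}) \<le> m * card (half_totatives d)"
    "\<And>q k G. int_poly2 q \<Longrightarrow> q \<alpha> s \<noteq> 0 \<Longrightarrow> G > 0 \<Longrightarrow>
      (\<And>a b. b \<in> sin2_conjs d \<Longrightarrow> 0 < a \<Longrightarrow> a < b \<Longrightarrow> \<bar>q a b\<bar> \<le> b ^ k * G) \<Longrightarrow>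
      s ^ k * G \<le> \<bar>q \<alpha> s\<bar> * (exp (mangoldt d) ^ k * G ^ card (half_totatives d)) ^ m"
proof -
  obtain T :: "real set" and \<theta> a b m where T: "finite T" "\<theta> \<in> T" "a \<theta> = \<alpha>" "b \<theta> = s"
    "\<And>t. t \<in> T \<Longrightarrow> t \<noteq> \<theta> \<Longrightarrow> 0 < a t \<and> a t < b t"
    "b ` T \<subseteq> sin2_conjs d" "m > 0"
    "\<And>y. y \<in> sin2_conjs d \<Longrightarrow> card {t\<in>T. b t = y} = m"
    "K = gen_field {\<alpha>}" "fdeg K (Fd d) \<le> m" "fdeg K (gen_field {}) \<le> card T"
    "\<And>q. int_poly2 q \<Longrightarrow> q \<alpha> s \<noteq> 0 \<Longrightarrow> 1 \<le> (\<Prod>t\<in>T. \<bar>q (a t) (b t)\<bar>)"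
    using norm_setup[OF d \<alpha>] emb unfolding s_def K_def by blast
  define n where "n = card (half_totatives d)"
  have finS: "finite (sin2_conjs d)" by (simp add: sin2_conjs_def)
  have cardT: "card T = m * n"
  proof -
    have "card T = (\<Sum>y\<in>sin2_conjs d. card {t\<in>T. b t = y})"
      using T(1,6) finS by (subst card_UN_disjoint[symmetric]) (auto intro!: arg_cong[where f = card])
    also have "\<dots> = m * n" using T(8) card_sin2_conjs by (simp add: n_def)
    finally show ?thesis .
  qed
  have prodT: "(\<Prod>t\<in>T. b t) = exp (mangoldt d) ^ m"
  proof -
    have "(\<Prod>t\<in>T. b t) = (\<Prod>y\<in>sin2_conjs d. \<Prod>t | t \<in> T \<and> b t = y. b t)"
      using prod.group[OF T(1) finS T(6), of b] by simp
    also have "\<dots> = (\<Prod>y\<in>sin2_conjs d. y ^ m)"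
      using T(8) by (intro prod.cong refl) simp
    also have "\<dots> = exp (mangoldt d) ^ m"
      by (simp add: prod_sin2_conjs[OF d, symmetric] prod_power_distrib)
    finally show ?thesis .
  qed
  have bpos: "b t > 0" if "t \<in> T" for t
  proof -
    have "b t \<in> sin2_conjs d" using T(6) that by blast
    then obtain k where k: "k \<in> half_totatives d" "b t = 4 * sin (pi * real k / real d) ^ 2"
      unfolding sin2_conjs_def by blast
    have "sin (pi * real k / real d) > 0" using k(1) by (intro sin_half_totative_pos) (auto simp: half_totatives_def)
    thus ?thesis using k(2) by simp
  qed
  have main: "s ^ k * G \<le> \<bar>q \<alpha> s\<bar> * (exp (mangoldt d) ^ k * G ^ n) ^ m"
    if q: "int_poly2 q" "q \<alpha> s \<noteq> 0" and G: "G > 0"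
      and bd: "\<And>a b. b \<in> sin2_conjs d \<Longrightarrow> 0 < a \<Longrightarrow> a < b \<Longrightarrow> \<bar>q a b\<bar> \<le> b ^ k * G" for q k G
  proof -
    have "1 \<le> (\<Prod>t\<in>T. \<bar>q (a t) (b t)\<bar>)" by (rule T(12)[OF q])
    also have "\<dots> = \<bar>q \<alpha> s\<bar> * (\<Prod>t\<in>T - {\<theta>}. \<bar>q (a t) (b t)\<bar>)"
      using prod.remove[OF T(1,2), of "\<lambda>t. \<bar>q (a t) (b t)\<bar>"] T(3,4) by simp
    also have "\<dots> \<le> \<bar>q \<alpha> s\<bar> * (\<Prod>t\<in>T - {\<theta>}. b t ^ k * G)"
      using T(5,6) bd by (intro mult_left_mono prod_mono conjI) auto
    \<comment> \<open>Multiplication by \<open>s ^ k * G\<close> supplies the missing factor for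
      \<open>\<theta>\<close>, and the product over all of \<open>T\<close> can be
      evaluated.\<close>
    finally have "s ^ k * G * 1 \<le> s ^ k * G * (\<bar>q \<alpha> s\<bar> * (\<Prod>t\<in>T - {\<theta>}. b t ^ k * G))"
      using bpos[OF T(2)] T(4) G by (intro mult_left_mono) auto
    also have "\<dots> = \<bar>q \<alpha> s\<bar> * (\<Prod>t\<in>T. b t ^ k * G)"
      using prod.remove[OF T(1,2), of "\<lambda>t. b t ^ k * G"] T(4) by simp
    also have "(\<Prod>t\<in>T. b t ^ k * G) = (\<Prod>t\<in>T. b t) ^ k * G ^ card T"
      by (simp add: prod.distrib prod_power_distrib)
    also have "\<dots> = (exp (mangoldt d) ^ k * G ^ n) ^ m"
      unfolding prodT cardT by (simp add: power_mult_distrib power_mult[symmetric] mult.commute)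
    finally show ?thesis by simp
  qed
  show ?thesis
    using that[OF T(7,9,10)] T(11) main cardT unfolding n_def by simp
qed

section \<open>Rational lower bounds for the sine and the table of degrees\<close>

lemma sin_lower: "x \<ge> 0 \<Longrightarrow> x - x ^ 3 / 6 \<le> sin (x::real)"
proof -
  assume "x \<ge> 0"
  hence "\<bar>sin x - x\<bar> * 6 \<le> x * (x * x)"
    using Maclaurin_sin_bound[of x 3]
    by (simp add: sin_coeff_def numeral_eq_Suc lessThan_Suc fact_numeral)
  moreover have "(x - sin x) * 6 \<le> \<bar>sin x - x\<bar> * 6" by (intro mult_right_mono) auto
  ultimately have "(x - sin x) * 6 \<le> x ^ 3" by (simp add: power3_eq_cube)
  thus ?thesis by (simp add: field_simps)
qed

text \<open>\<open>157/50 = 3.14\<close> lies just below pi, and the sine is replaced by its cubic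
  Taylor polynomial, so the bound is rational.\<close>

lemma sin2_lower:
  assumes d: "d \<ge> 3" and x: "x = 157 / (50 * real d)"
  shows "4 * x ^ 2 * (1 - x ^ 2 / 6) ^ 2 \<le> 4 * sin (pi / real d) ^ 2"
proof -
  have d3: "real d \<ge> 3" using d by simp
  have x0: "x > 0" "x \<le> 157 / 150" unfolding x using d3 by (auto simp: field_simps)
  have xp: "x \<le> pi / real d"
  proof -
    have "157 / 50 \<le> pi" using pi_approx(1) by simp
    hence "157 / 50 / real d \<le> pi / real d" by (intro divide_right_mono) auto
    thus ?thesis by (simp add: x)
  qed
  have "pi / real d \<le> pi / 2" using d3 by (intro divide_left_mono) auto
  moreover have "- (pi / 2) \<le> x" using x0 pi_gt_zero by linarith
  ultimately have mono: "sin x \<le> sin (pi / real d)" using xp by (intro sin_monotone_2pi_le)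
  have "x ^ 2 \<le> (157 / 150) ^ 2" using x0 by (intro power_mono) auto
  hence x2: "x ^ 2 / 6 \<le> 1" by (simp add: power2_eq_square)
  have "x * (1 - x ^ 2 / 6) = x - x ^ 3 / 6" by (simp add: power2_eq_square power3_eq_cube algebra_simps)
  also have "\<dots> \<le> sin x" using x0 by (intro sin_lower) simp
  finally have "x * (1 - x ^ 2 / 6) \<le> sin (pi / real d)" using mono by simp
  hence "(x * (1 - x ^ 2 / 6)) ^ 2 \<le> sin (pi / real d) ^ 2"
    using x0 x2 by (intro power_mono) auto
  thus ?thesis by (simp add: power_mult_distrib)
qed

text \<open>The target is \<open>m < deg_limit d\<close>. The value 1 outside the list is
  incompatible with \<open>m > 0\<close> and so excludes \<open>d\<close>.\<close>

definition deg_limit :: "nat \<Rightarrow> nat" where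
  "deg_limit d = (if d \<in> admissible_d then mbound d + 1 else 1)"

text \<open>For \<open>d < 512 = 2\<^sup>9\<close> this is \<open>p\<close> if \<open>d\<close> is a power of a prime \<open>p\<close>, and \<open>1\<close> otherwise.\<close>

definition prime_power_base :: "nat \<Rightarrow> nat" where
  "prime_power_base d =
    (case List.find (\<lambda>k. k dvd d) [2..<Suc d] of None \<Rightarrow> 1 | Some q \<Rightarrow> if d dvd q ^ 9 then q else 1)"

text \<open>For \<open>d = p^k\<close> the least divisor \<open>q \<ge> 2\<close> is
  \<open>p\<close>, and \<open>k < 9\<close> because \<open>d < 2^9\<close>. Otherwise the left side
  is 1, and any value at least 1 will do.\<close>

lemma exp_mangoldt_le:
  assumes d: "2 \<le> d" "d < 512"
  shows "exp (mangoldt d) \<le> real (prime_power_base d)"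
proof -
  have "\<exists>x. x \<in> set [2..<Suc d] \<and> x dvd d" using d by (intro exI[of _ d]) auto
  then obtain q where q: "List.find (\<lambda>k. k dvd d) [2..<Suc d] = Some q"
    by (metis (no_types, lifting) find_None_iff not_Some_eq)
  then obtain i where i: "i < length [2..<Suc d]" "[2..<Suc d] ! i dvd d" "q = [2..<Suc d] ! i"
    "\<forall>j<i. \<not> [2..<Suc d] ! j dvd d" by (auto simp: find_Some_iff)
  have qi: "q = 2 + i" "q dvd d" using i by (auto simp del: upt_Suc)
  have least: "\<not> r dvd d" if "2 \<le> r" "r < q" for r
  proof -
    have "r - 2 < i" using that qi by simp
    moreover have "[2..<Suc d] ! (r - 2) = r" using that qi i(1) by (simp del: upt_Suc)
    ultimately show ?thesis using i(4) by metis
  qed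
  have b: "prime_power_base d = (if d dvd q ^ 9 then q else 1)"
    unfolding prime_power_base_def q by simp
  show ?thesis
  proof (cases "primepow d")
    case True
    then obtain p k where pk: "prime p" "k > 0" "d = p ^ k" by (auto simp: primepow_def)
    have "p dvd d" using pk by simp
    have p2: "p \<ge> 2" using pk(1) prime_ge_2_nat by blast
    have "q \<le> p" using least[of p] p2 \<open>p dvd d\<close> by (meson not_le)
    moreover have "p dvd q"
    proof -
      have "q dvd p ^ k" using qi(2) pk(3) by simp
      then obtain j where "q = p ^ j" using pk(1) divides_primepow_nat by blast
      moreover have "j \<noteq> 0" using calculation qi(1) by (intro notI) simp
      ultimately show ?thesis by simp
    qed
    hence "p \<le> q" using qi(1) by (intro dvd_imp_le) auto
    ultimately have qp: "q = p" by simp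
    have "(2::nat) ^ k \<le> d" using p2 pk(3) by (simp add: power_mono)
    hence "(2::nat) ^ k < 2 ^ 9" using d by simp
    hence "k < 9" by (simp only: power_strict_increasing_iff)
    hence "d dvd q ^ 9" using pk(3) qp by (simp add: le_imp_power_dvd)
    thus ?thesis using b qp pk p2 by simp
  next
    case False
    thus ?thesis using b qi(1) by (simp add: mangoldt_def)
  qed
qed

text \<open>Here \<open>u / v\<close> is the lower bound \<open>4 x\<^sup>2 (1 - x\<^sup>2/6)\<^sup>2\<close>, \<open>x = 157 / (50 d)\<close>, for \<open>4 sin\<^sup>2(\<pi>/d)\<close>.\<close>

definition table_check :: "nat \<Rightarrow> bool" where
  "table_check d \<longleftrightarrow>
    (let M = deg_limit d; g = prime_power_base d; e = totient d; D = d ^ 2;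
         u = 4 * 24649 * (15000 * D - 24649) ^ 2; v = 2500 * D * (15000 * D) ^ 2
     in g ^ 2 \<le> 2 ^ e \<and> 4 * 256 ^ 2 * g ^ (2 * M) * v ^ 2 \<le> u ^ 2 * 2 ^ (e * M))"

section \<open>Numerical bounds\<close>

text \<open>The \<open>d\<close> below 210 at which \<open>table_check\<close> fails. At
  \<open>d = 6\<close> it fails only because the rational lower bound for \<open>s\<close> is
  slightly below the true value 1.\<close>

definition special_d :: "nat set" where
  "special_d = {3, 4, 5, 6, 7, 9, 11, 13, 17, 37}"

lemma table_check_1: "list_all (\<lambda>d. d \<in> special_d \<or> table_check d) [3..<110]"
  by code_simp

lemma table_check_2: "list_all table_check [110..<170]"
  by code_simp

lemma table_check_3: "list_all table_check [170..<210]"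
  by code_simp

lemma table_check:
  assumes "3 \<le> d" "d < 210" "d \<notin> special_d"
  shows "table_check d"
proof -
  consider "d \<in> set [3..<110]" | "d \<in> set [110..<170]" | "d \<in> set [170..<210]"
    unfolding set_upt atLeastLessThan_iff using assms(1,2) by linarith
  thus ?thesis
    using table_check_1 table_check_2 table_check_3 assms(3) unfolding list_all_iff by cases blast+
qed

text \<open>The degree over the rationals is at most \<open>m * totient d / 2\<close>; the 2 on the
  right clears the denominator.\<close>

lemma qbound_check: "list_all (\<lambda>d. d \<in> admissible_d \<longrightarrow> totient d * mbound d \<le> 2 * qbound d) [3..<121]"
  by code_simp

lemma totient_mbound_le_qbound:
  assumes "d \<in> admissible_d"
  shows "totient d * mbound d \<le> 2 * qbound d"
proof -
  have "3 \<le> d" "d < 121" using assms by (auto simp: admissible_d_def)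
  hence "d \<in> set [3..<121]" unfolding set_upt atLeastLessThan_iff by blast
  thus ?thesis using qbound_check assms unfolding list_all_iff by blast
qed

section \<open>Lower bounds for Euler's function\<close>

lemma totient_prime_power_mult:
  assumes "prime p" "\<not> p dvd m" "k > 0"
  shows "totient (p ^ k * m) = p ^ (k - 1) * (p - 1) * totient m"
proof -
  have "coprime p m" using assms by (simp add: prime_imp_coprime)
  hence "coprime (p ^ k) m" by simp
  thus ?thesis using assms by (simp add: totient_mult_coprime totient_prime_power)
qed

lemma pow_split_nat:
  assumes "prime (p::nat)" "n > 0"
  obtains k m where "n = p ^ k * m" "\<not> p dvd m" "m > 0"
proof -
  obtain m where "n = p ^ multiplicity p n * m" "\<not> p dvd m"
    using assms by (elim multiplicity_decompose'[of n p, rotated 2]) (auto dest: not_prime_unit)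
  thus ?thesis using that[of "multiplicity p n" m] assms(2) by (cases "m = 0") auto
qed

lemma totient_prime_part_ge:
  assumes p: "prime p" "p \<ge> 5" and m: "\<not> p dvd m" and IH: "m ^ 5 \<le> totient m ^ 6"
  shows "(p ^ k * m) ^ 5 \<le> totient (p ^ k * m) ^ 6"
proof (cases "k = 0")
  case False
  define r where "r = p - 1"
  have r: "r \<ge> 4" "p = r + 1" using p(2) by (auto simp: r_def)
  \<comment> \<open>From \<open>p / r \<le> 5/4\<close> one gets
    \<open>p^5 \<le> (3125/1024) r^5\<close>, and \<open>3125/1024 < 4 \<le> r\<close>, so
    \<open>p^5 \<le> r^6\<close>. Further factors \<open>p\<close> only favour the right
    side.\<close>
  have "(4 * (r + 1)) ^ 5 \<le> (5 * r) ^ 5" using r by (intro power_mono) auto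
  hence "1024 * p ^ 5 \<le> 3125 * r ^ 5" unfolding r(2)[symmetric] power_mult_distrib by simp
  moreover have "1024 * (4 * r ^ 5) \<le> 1024 * (r * r ^ 5)" using r by (intro mult_left_mono mult_right_mono) auto
  ultimately have "p ^ 5 \<le> r * r ^ 5" by linarith
  also have "\<dots> = r ^ 6" by (simp add: power_Suc[symmetric])
  finally have pr: "p ^ 5 \<le> r ^ 6" .
  obtain j where k: "k = Suc j" using False by (cases k) auto
  have "(p ^ k * m) ^ 5 = p ^ (5 * j) * p ^ 5 * m ^ 5"
    by (simp add: k power_mult_distrib power_mult[symmetric] mult.commute power_add[symmetric])
  also have "\<dots> \<le> p ^ (6 * j) * r ^ 6 * totient m ^ 6"
    using p pr IH by (intro mult_le_mono power_increasing) auto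
  also have "\<dots> = (p ^ (k - 1) * (p - 1) * totient m) ^ 6"
    by (simp add: k r_def power_mult_distrib power_mult[symmetric] mult.commute)
  also have "\<dots> = totient (p ^ k * m) ^ 6" using totient_prime_power_mult[OF p(1) m] False by simp
  finally show ?thesis .
qed (use IH in auto)

lemma totient_coprime_6_ge:
  "n > 0 \<Longrightarrow> \<not> 2 dvd n \<Longrightarrow> \<not> 3 dvd n \<Longrightarrow> n ^ 5 \<le> totient n ^ 6"
proof (induction n rule: less_induct)
  case (less n)
  show ?case
  proof (cases "n = 1")
    case False
    then obtain p where p: "prime p" "p dvd n" using prime_factor_nat by blast
    have "p \<noteq> 2" "p \<noteq> 3" "p \<noteq> 4" "p \<ge> 2" using p less.prems prime_ge_2_nat by auto
    hence p5: "p \<ge> 5" by simp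
    obtain k m where km: "n = p ^ k * m" "\<not> p dvd m" "m > 0"
      using pow_split_nat[OF p(1) less.prems(1)] by blast
    have "k \<noteq> 0" using km p(2) by (intro notI) simp
    hence "1 < p ^ k" using one_less_power[of p k] p5 by simp
    hence "m < n" using km by simp
    hence "m ^ 5 \<le> totient m ^ 6" using less km by (auto intro!: less.IH)
    thus ?thesis unfolding km(1) by (rule totient_prime_part_ge[OF p(1) p5 km(2)])
  qed auto
qed

text \<open>The prime 2 costs a factor \<open>2^5 / 1^6\<close> and the prime 3 a factor
  \<open>3^5 / 2^6\<close>; their product is \<open>243/2\<close>. Primes from 5 on cost nothing.
  Equality holds at \<open>n = 6\<close>.\<close>

lemma totient_lower_bound:
  assumes "n > 0"
  shows "2 * n ^ 5 \<le> 243 * totient n ^ 6"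
proof -
  obtain a l where al: "n = 2 ^ a * l" "\<not> 2 dvd l" "l > 0"
    using pow_split_nat[of 2 n] assms by auto
  obtain b m where bm: "l = 3 ^ b * m" "\<not> 3 dvd m" "m > 0"
    using pow_split_nat[of 3 l] al by auto
  have m2: "\<not> 2 dvd m" using al(2) bm(1) by auto
  have m: "m ^ 5 \<le> totient m ^ 6" using totient_coprime_6_ge[OF bm(3) m2 bm(2)] .
  have l: "64 * l ^ 5 \<le> 243 * totient l ^ 6"
  proof (cases b)
    case 0
    thus ?thesis using m bm by simp
  next
    case (Suc j)
    have "totient l = 3 ^ j * 2 * totient m"
      unfolding bm(1) using totient_prime_power_mult[of 3 m b] bm(2) Suc by simp
    hence A: "243 * totient l ^ 6 = 243 * 64 * (3 ^ (6 * j) * totient m ^ 6)"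
      by (simp add: power_mult_distrib power_mult[symmetric] mult.commute)
    have B: "64 * l ^ 5 = 243 * 64 * (3 ^ (5 * j) * m ^ 5)"
      by (simp add: bm(1) Suc power_mult_distrib power_mult[symmetric] mult.commute)
    have "(3::nat) ^ (5 * j) * m ^ 5 \<le> 3 ^ (6 * j) * totient m ^ 6"
      using m by (intro mult_le_mono power_increasing) auto
    thus ?thesis unfolding A B by (rule mult_left_mono) simp
  qed
  show ?thesis
  proof (cases a)
    case 0
    have "2 * l ^ 5 \<le> 64 * l ^ 5" by simp
    thus ?thesis using l al 0 by simp
  next
    case (Suc j)
    have "totient n = 2 ^ j * totient l"
      unfolding al(1) using totient_prime_power_mult[of 2 l a] al(2) Suc by simp
    hence A: "243 * totient n ^ 6 = 2 ^ (6 * j) * (243 * totient l ^ 6)"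
      by (simp add: power_mult_distrib power_mult[symmetric] mult.commute)
    have B: "2 * n ^ 5 = 2 ^ (5 * j) * (64 * l ^ 5)"
      by (simp add: al(1) Suc power_mult_distrib power_mult[symmetric] mult.commute)
    have "(2::nat) ^ (5 * j) * (64 * l ^ 5) \<le> 2 ^ (6 * j) * (243 * totient l ^ 6)"
      by (intro mult_le_mono power_increasing l) auto
    thus ?thesis unfolding A B .
  qed
qed

text \<open>The ratio \<open>((n + 1) / n)^k\<close> decreases in \<open>n\<close>, so once it is at
  most \<open>B\<close> the exponential side keeps its lead.\<close>

lemma pow_le_exponential:
  fixes n n0 k B C :: nat
  assumes "n \<ge> n0" "n0 > 0" "C * n0 ^ k \<le> D * B ^ n0" "(n0 + 1) ^ k \<le> B * n0 ^ k"
  shows "C * n ^ k \<le> D * B ^ n"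
  using assms(1)
proof (induction n rule: dec_induct)
  case base
  show ?case using assms(3) .
next
  case (step n)
  have "n0 * (n + 1) \<le> (n0 + 1) * n" using step by (simp add: algebra_simps)
  hence "(n0 * (n + 1)) ^ k \<le> ((n0 + 1) * n) ^ k" by (rule power_mono) simp
  hence "n0 ^ k * (n + 1) ^ k \<le> (n0 + 1) ^ k * n ^ k" by (simp only: power_mult_distrib)
  also have "\<dots> \<le> B * n0 ^ k * n ^ k" using assms(4) by (rule mult_right_mono) simp
  finally have "n0 ^ k * (n + 1) ^ k \<le> n0 ^ k * (B * n ^ k)" by (simp add: algebra_simps)
  hence "(n + 1) ^ k \<le> B * n ^ k" using assms(2) by simp
  hence "C * (n + 1) ^ k \<le> B * (C * n ^ k)" by (metis mult.left_commute mult_le_mono2)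
  also have "\<dots> \<le> B * (D * B ^ n)" using step by (intro mult_left_mono) auto
  finally show ?case by (simp add: algebra_simps)
qed

text \<open>With \<open>s \<ge> 38 / d^2\<close>, the bound \<open>m < 1\<close> follows from
  \<open>4 * 256^2 * d^4 * gamma^2 \<le> 38^2 * 2^totient d\<close>, and
  \<open>4 * 256^2 / 38^2 < 182\<close>. This is the case \<open>gamma = 1\<close>.\<close>

lemma totient_exponential:
  assumes d: "d \<ge> 210"
  shows "182 * d ^ 4 \<le> 2 ^ totient d"
proof -
  define n where "n = totient d"
  have b: "2 * d ^ 5 \<le> 243 * n ^ 6" unfolding n_def using d by (intro totient_lower_bound) simp
  have "2 * 210 ^ 5 \<le> 2 * d ^ 5" using d by (intro mult_left_mono power_mono) auto
  hence nb: "2 * 210 ^ 5 \<le> 243 * n ^ 6" using b by linarith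
  \<comment> \<open>At \<open>n = 38\<close> the comparison with \<open>16 * 32 ^ n\<close> below
    still fails.\<close>
  have n: "n \<ge> 39"
  proof (rule ccontr)
    assume "\<not> n \<ge> 39"
    hence "n ^ 6 \<le> 38 ^ 6" by (intro power_mono) auto
    thus False using nb by simp
  qed
  \<comment> \<open>Raising to the fifth power turns \<open>d^4\<close> into \<open>(d^5)^4\<close>,
    to which the bound for \<open>d^5\<close> applies; \<open>d\<close> disappears and a power of
    \<open>n\<close> faces \<open>32 ^ n\<close>.\<close>
  have "16 * (182 * d ^ 4) ^ 5 = 182 ^ 5 * (2 * d ^ 5) ^ 4"
    by (simp add: power_mult_distrib power_mult[symmetric])
  also have "\<dots> \<le> 182 ^ 5 * (243 * n ^ 6) ^ 4" using b by (intro mult_left_mono power_mono) auto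
  also have "\<dots> = (182 ^ 5 * 243 ^ 4) * n ^ 24" by (simp add: power_mult_distrib power_mult[symmetric])
  also have "\<dots> \<le> 16 * 32 ^ n" by (rule pow_le_exponential[OF n]) simp_all
  also have "(32::nat) ^ n = (2 ^ 5) ^ n" by simp
  also have "\<dots> = (2 ^ n) ^ 5" by (simp only: power_mult[symmetric] mult.commute)
  finally have "(182 * d ^ 4) ^ 5 \<le> (2 ^ n) ^ 5" by simp
  thus ?thesis unfolding n_def by (simp only: power_mono_iff)
qed

text \<open>For a prime power \<open>totient d \<ge> d / 2\<close>, strong enough to absorb
  \<open>gamma^2 \<le> d^2\<close>.\<close>

lemma totient_primepow_exponential:
  assumes d: "d \<ge> 210" and p: "primepow d"
  shows "182 * d ^ 4 * aprimedivisor d ^ 2 \<le> 2 ^ totient d"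
proof -
  obtain q k where pk: "prime q" "k > 0" "d = q ^ k" using p by (auto simp: primepow_def)
  have q2: "q \<ge> 2" using pk(1) prime_ge_2_nat by blast
  have aq: "aprimedivisor d = q" using pk by (simp add: aprimedivisor_prime_power)
  have "q \<le> d" using pk(2,3) q2 by (simp add: self_le_power)
  have "totient d = q ^ (k - 1) * (q - 1)" using pk by (simp add: totient_prime_power)
  moreover have "d = q ^ (k - 1) * q" using pk by (simp add: power_eq_if mult.commute)
  moreover have "q ^ (k - 1) * q \<le> q ^ (k - 1) * (2 * (q - 1))" using q2 by (intro mult_left_mono) auto
  ultimately have dn: "d \<le> 2 * totient d" by simp
  hence n: "totient d \<ge> 105" using d by simp
  have "182 * d ^ 4 * aprimedivisor d ^ 2 \<le> 182 * d ^ 4 * d ^ 2"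
    unfolding aq using \<open>q \<le> d\<close> by (intro mult_left_mono power_mono) auto
  also have "\<dots> = 182 * d ^ 6" by (simp add: power_add[symmetric])
  also have "\<dots> \<le> 182 * (2 * totient d) ^ 6" using dn by (intro mult_left_mono power_mono) auto
  also have "\<dots> = (182 * 64) * totient d ^ 6" by (simp add: power_mult_distrib)
  also have "\<dots> \<le> 1 * 2 ^ totient d" by (rule pow_le_exponential[OF n]) simp_all
  finally show ?thesis by simp
qed

section \<open>From the norm inequality to degree bounds\<close>

definition norm_ineq :: "nat \<Rightarrow> real \<Rightarrow> nat \<Rightarrow> bool" where
  "norm_ineq d \<alpha> m \<longleftrightarrow> (\<forall>q k G. int_poly2 q \<longrightarrow> q \<alpha> (4 * sin (pi / real d) ^ 2) \<noteq> 0 \<longrightarrow> G > 0 \<longrightarrow>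
    (\<forall>a b. b \<in> sin2_conjs d \<longrightarrow> 0 < a \<longrightarrow> a < b \<longrightarrow> \<bar>q a b\<bar> \<le> b ^ k * G) \<longrightarrow>
    (4 * sin (pi / real d) ^ 2) ^ k * G \<le> \<bar>q \<alpha> (4 * sin (pi / real d) ^ 2)\<bar> *
      (exp (mangoldt d) ^ k * G ^ card (half_totatives d)) ^ m)"

text \<open>If \<open>m \<ge> M\<close>, then \<open>m\<close> may be lowered to \<open>M\<close> in
  the norm inequality, because the base is at most 1. The strict bound \<open>Q\<close> for
  \<open>|q \<alpha> s|\<close> then gives the contradiction even where the numerical comparison is
  an equality, as for \<open>d = 4\<close> and \<open>d = 6\<close>.\<close>

lemma degree_bound:
  assumes m: "norm_ineq d \<alpha> m" and s: "s = 4 * sin (pi / real d) ^ 2"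
    and q: "int_poly2 q" "q \<alpha> s \<noteq> 0" "\<bar>q \<alpha> s\<bar> < Q" and G: "G > 0"
    and bd: "\<And>a b. b \<in> sin2_conjs d \<Longrightarrow> 0 < a \<Longrightarrow> a < b \<Longrightarrow> \<bar>q a b\<bar> \<le> b ^ k * G"
    and g: "k = 0 \<or> exp (mangoldt d) \<le> g" and n: "totient d = 2 * n" "d \<ge> 3"
    and x: "g ^ k * G ^ n \<le> 1"
    and s': "0 \<le> s'" "s' \<le> s" "Q * (g ^ k * G ^ n) ^ M \<le> s' ^ k * G"
  shows "m < M"
proof (rule ccontr)
  assume "\<not> m < M"
  hence mM: "M \<le> m" by simp
  have n': "card (half_totatives d) = n" using totient_eq_half[OF n(2)] n(1) by simp
  define X where "X = exp (mangoldt d) ^ k * G ^ n"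
  have X0: "X > 0" using G by (simp add: X_def)
  have XG: "X \<le> g ^ k * G ^ n" unfolding X_def using g G
    by (intro mult_right_mono) (auto intro: power_mono)
  have "s' ^ k * G \<le> s ^ k * G" using s' G by (intro mult_right_mono power_mono) auto
  also have "\<dots> \<le> \<bar>q \<alpha> s\<bar> * X ^ m"
    using m q(1,2) G bd unfolding norm_ineq_def s X_def n' by blast
  also have "\<dots> \<le> \<bar>q \<alpha> s\<bar> * X ^ M"
    using X0 XG x mM by (intro mult_left_mono power_decreasing) auto
  also have "\<dots> < Q * X ^ M" using q(3) X0 by (intro mult_strict_right_mono) auto
  also have "\<dots> \<le> Q * (g ^ k * G ^ n) ^ M"
    using XG X0 q(3) by (intro mult_left_mono power_mono) auto
  finally show False using s'(3) by simp
qed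

lemma sin2_bounds:
  assumes "d \<ge> 3"
  shows "4 * sin (pi / real d) ^ 2 > 0" "4 * sin (pi / real d) ^ 2 \<le> 4"
  using sin_half_totative_pos[of 1 d] assms by (auto simp: abs_square_le_1 abs_sin_le_one)

lemma quadratic_le: "a * (b - a) \<le> b ^ 2 * (1 / 4 :: real)"
proof -
  have "0 \<le> (b - 2 * a) ^ 2" by simp
  thus ?thesis by (simp add: power2_eq_square algebra_simps)
qed

lemma abs_quadratic:
  assumes "4 < \<alpha>" "\<alpha> < 256" "0 < s" "s \<le> (4::real)"
  shows "\<bar>\<alpha> * (s - \<alpha>)\<bar> = \<alpha> * (\<alpha> - s)" "0 < \<alpha> * (\<alpha> - s)" "\<alpha> * (\<alpha> - s) < 256 ^ 2"
proof -
  show p: "0 < \<alpha> * (\<alpha> - s)" using assms by simp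
  have "\<alpha> * (s - \<alpha>) = - (\<alpha> * (\<alpha> - s))" by (simp add: algebra_simps)
  thus "\<bar>\<alpha> * (s - \<alpha>)\<bar> = \<alpha> * (\<alpha> - s)" using p by simp
  have "\<alpha> * (\<alpha> - s) < 256 * 256" using assms by (intro mult_strict_mono) auto
  thus "\<alpha> * (\<alpha> - s) < 256 ^ 2" by simp
qed

lemma int_poly2_quadratic: "int_poly2 (\<lambda>a b. a * (b - a))"
  by (intro int_poly2_intros)

lemma degree_bound_large:
  assumes m: "norm_ineq d \<alpha> m" and d: "d \<ge> 210" and \<alpha>: "4 < \<alpha>" "\<alpha> < 256"
  shows "m < 1"
proof -
  define s where "s = 4 * sin (pi / real d) ^ 2"
  have d3: "d \<ge> 3" using d by simp
  have s: "0 < s" "s \<le> 4" using sin2_bounds[OF d3] by (auto simp: s_def)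
  define g where "g = exp (mangoldt d :: real)"
  have g0: "g > 0" by (simp add: g_def)
  have key: "182 * real d ^ 4 * g ^ 2 \<le> 2 ^ totient d"
  proof (cases "primepow d")
    case True
    have "real (182 * d ^ 4 * aprimedivisor d ^ 2) \<le> real (2 ^ totient d)"
      using totient_primepow_exponential[OF d True] by (simp only: of_nat_le_iff)
    moreover have "aprimedivisor d > 0" using True aprimedivisor_pos_nat[of d] d by simp
    hence "g = real (aprimedivisor d)" using True by (simp add: g_def mangoldt_def)
    ultimately show ?thesis by simp
  next
    case False
    have "real (182 * d ^ 4) \<le> real (2 ^ totient d)"
      using totient_exponential[OF d] by (simp only: of_nat_le_iff)
    moreover have "g = 1" using False by (simp add: g_def mangoldt_def)
    ultimately show ?thesis by simp
  qed
  obtain n where n: "totient d = 2 * n" using totient_eq_half[OF d3] by blast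
  have p4: "(1 / 4 :: real) ^ n = 1 / 2 ^ totient d"
    by (simp add: n power_mult power_divide)
  have dpos: "real d > 0" using d by simp
  have x: "g ^ 2 * (1 / 4) ^ n \<le> 1"
  proof -
    have "1 ^ 4 \<le> real d ^ 4" using d by (intro power_mono) auto
    hence "1 * g ^ 2 \<le> (182 * real d ^ 4) * g ^ 2" by (intro mult_right_mono) auto
    hence "g ^ 2 \<le> 2 ^ totient d" using key by simp
    thus ?thesis by (simp add: p4 divide_le_eq_1)
  qed
  \<comment> \<open>\<open>4 * 3.14^2 * 0.99^2 > 38\<close>; for \<open>d \<ge> 210\<close> the
    Taylor correction is far closer to 1 than \<open>0.99\<close>.\<close>
  have s_lo: "38 / real d ^ 2 \<le> s"
  proof -
    define y where "y = 157 / (50 * real d)"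
    have y2: "y ^ 2 = (24649 / 2500) / real d ^ 2" by (simp add: y_def power_divide power_mult_distrib)
    have "(210::real) ^ 2 \<le> real d ^ 2" using d by (intro power_mono) auto
    hence "y ^ 2 \<le> (24649 / 2500) / 210 ^ 2" unfolding y2 using dpos by (intro divide_left_mono) auto
    hence y6: "99 / 100 \<le> 1 - y ^ 2 / 6" by simp
    have "38 / real d ^ 2 \<le> 4 * ((24649 / 2500) / real d ^ 2) * (99 / 100) ^ 2"
      using dpos by (simp add: field_simps)
    also have "\<dots> = 4 * y ^ 2 * (99 / 100) ^ 2" by (simp only: y2)
    also have "\<dots> \<le> 4 * y ^ 2 * (1 - y ^ 2 / 6) ^ 2"
      using y6 by (intro mult_left_mono power_mono) auto
    also have "\<dots> \<le> s" unfolding s_def by (rule sin2_lower[OF d3 y_def])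
    finally show ?thesis .
  qed
  have fin: "256 ^ 2 * (g ^ 2 * (1 / 4) ^ n) ^ 1 \<le> (38 / real d ^ 2) ^ 2 * (1 / 4)"
  proof -
    have "256 ^ 2 * 4 * real d ^ 4 * g ^ 2 \<le> 1444 * (182 * real d ^ 4 * g ^ 2)"
    proof -
      have "0 \<le> real d ^ 4 * g ^ 2" by simp
      thus ?thesis by (simp add: algebra_simps)
    qed
    also have "\<dots> \<le> 1444 * 2 ^ totient d" using key by (intro mult_left_mono) auto
    finally have *: "256 ^ 2 * 4 * real d ^ 4 * g ^ 2 \<le> 1444 * 2 ^ totient d" .
    have e: "(38 / real d ^ 2) ^ 2 = 1444 / real d ^ 4" by (simp add: power_divide power_mult[symmetric])
    show ?thesis unfolding p4 e power_one_right using * dpos by (simp add: field_simps)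
  qed
  show ?thesis
  proof (rule degree_bound[OF m s_def int_poly2_quadratic, where G = "1 / 4" and k = 2 and Q = "256 ^ 2"
        and g = g and s' = "38 / real d ^ 2" and n = n])
    show "\<alpha> * (s - \<alpha>) \<noteq> 0" "\<bar>\<alpha> * (s - \<alpha>)\<bar> < 256 ^ 2" using abs_quadratic[OF \<alpha> s] by auto
    fix a b :: real assume "0 < a" "a < b"
    thus "\<bar>a * (b - a)\<bar> \<le> b ^ 2 * (1 / 4)" using quadratic_le[of a b] by simp
  qed (use n d3 x s_lo fin in \<open>auto simp: g_def\<close>)
qed

lemma degree_bound_table:
  assumes m: "norm_ineq d \<alpha> m" and d: "3 \<le> d" "d < 210" and chk: "table_check d"
    and \<alpha>: "4 < \<alpha>" "\<alpha> < 256"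
  shows "m < deg_limit d"
proof -
  define s where "s = 4 * sin (pi / real d) ^ 2"
  have s: "0 < s" "s \<le> 4" using sin2_bounds[OF d(1)] by (auto simp: s_def)
  define g where "g = prime_power_base d"
  define M where "M = deg_limit d"
  define D where "D = d ^ 2"
  define u where "u = 4 * 24649 * (15000 * D - 24649) ^ 2"
  define v where "v = 2500 * D * (15000 * D) ^ 2"
  have c: "g ^ 2 \<le> 2 ^ totient d" "4 * 256 ^ 2 * g ^ (2 * M) * v ^ 2 \<le> u ^ 2 * 2 ^ (totient d * M)"
    using chk unfolding table_check_def Let_def g_def[symmetric] M_def[symmetric] D_def[symmetric]
      u_def[symmetric] v_def[symmetric] by blast+
  obtain n where n: "totient d = 2 * n" using totient_eq_half[OF d(1)] by blast
  have p4: "(1 / 4 :: real) ^ n = 1 / 2 ^ totient d"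
    by (simp add: n power_mult power_divide)
  have D9: "D \<ge> 9" using power_mono[OF d(1), of 2] by (simp add: D_def)
  have v0: "real v > 0" using D9 by (simp add: v_def)
  have s_lo: "real u / real v \<le> s"
  proof -
    define y where "y = 157 / (50 * real d)"
    have y2: "y ^ 2 = 24649 / (2500 * real D)" by (simp add: y_def D_def power_divide power_mult_distrib)
    have ru: "real u = 4 * 24649 * (15000 * real D - 24649) ^ 2" using D9 by (simp add: u_def of_nat_diff)
    have rv: "real v = 2500 * real D * (15000 * real D) ^ 2" by (simp add: v_def)
    have D0: "real D \<noteq> 0" using D9 by simp
    have "1 - y ^ 2 / 6 = (15000 * real D - 24649) / (15000 * real D)"
      unfolding y2 using D0 by (simp add: field_simps)
    hence "4 * y ^ 2 * (1 - y ^ 2 / 6) ^ 2 = real u / real v"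
      unfolding ru rv y2 by (simp add: power_divide)
    thus ?thesis using sin2_lower[OF d(1) y_def] by (simp add: s_def)
  qed
  have "real (g ^ 2) \<le> real (2 ^ totient d)" using c(1) by (simp only: of_nat_le_iff)
  hence x: "real g ^ 2 * (1 / 4) ^ n \<le> 1" by (simp add: p4 divide_le_eq_1)
  \<comment> \<open>This is the second inequality of \<open>table_check\<close>, divided by
    \<open>4 * v ^ 2 * 2 ^ (totient d * M)\<close>.\<close>
  have fin: "256 ^ 2 * (real g ^ 2 * (1 / 4) ^ n) ^ M \<le> (real u / real v) ^ 2 * (1 / 4)"
  proof -
    have "real (4 * 256 ^ 2 * g ^ (2 * M) * v ^ 2) \<le> real (u ^ 2 * 2 ^ (totient d * M))"
      using c(2) by (simp only: of_nat_le_iff)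
    hence *: "4 * 256 ^ 2 * real g ^ (2 * M) * real v ^ 2 \<le> real u ^ 2 * 2 ^ (totient d * M)" by simp
    have e: "(real g ^ 2 * (1 / 4) ^ n) ^ M = real g ^ (2 * M) / 2 ^ (totient d * M)"
      unfolding p4 by (simp add: power_mult_distrib power_divide power_mult[symmetric])
    show ?thesis unfolding e using * v0 by (simp add: power_divide field_simps)
  qed
  show ?thesis unfolding M_def[symmetric]
  proof (rule degree_bound[OF m s_def int_poly2_quadratic, where G = "1 / 4" and k = 2 and Q = "256 ^ 2"
        and g = "real g" and s' = "real u / real v" and n = n])
    show "\<alpha> * (s - \<alpha>) \<noteq> 0" "\<bar>\<alpha> * (s - \<alpha>)\<bar> < 256 ^ 2" using abs_quadratic[OF \<alpha> s] by auto
    show "2 = 0 \<or> exp (mangoldt d) \<le> real g" using exp_mangoldt_le[of d] d by (simp add: g_def)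
    fix a b :: real assume "0 < a" "a < b"
    thus "\<bar>a * (b - a)\<bar> \<le> b ^ 2 * (1 / 4)" using quadratic_le[of a b] by simp
  qed (use n d x s_lo fin in auto)
qed

section \<open>Maxima of the auxiliary polynomials\<close>

lemma power_le_tangent:
  assumes "0 \<le> y" "0 < (r::real)"
  shows "y ^ e \<le> r ^ e * exp (real e * (y / r - 1))"
proof -
  have "y / r \<le> exp (y / r - 1)" using exp_ge_add_one_self[of "y / r - 1"] by simp
  hence "y \<le> r * exp (y / r - 1)" using assms by (simp add: pos_divide_le_eq mult.commute)
  hence "y ^ e \<le> (r * exp (y / r - 1)) ^ e" using assms by (intro power_mono) auto
  thus ?thesis by (simp add: power_mult_distrib exp_of_nat_mult)
qed

text \<open>Applied with the values \<open>r\<^sub>i\<close> of the linear factors at a rational point close to the maximum of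
  the product, so that the sum in the last hypothesis almost vanishes.\<close>

lemma product_le_tangent:
  assumes y: "0 \<le> y1" "0 \<le> y2" "0 \<le> y3" and r: "0 < r1" "0 < r2" "0 < (r3::real)"
    and \<delta>: "0 \<le> \<delta>" "\<delta> \<le> 1"
    and le: "real e1 * (y1 / r1 - 1) + real e2 * (y2 / r2 - 1) + real e3 * (y3 / r3 - 1) \<le> \<delta>"
  shows "y1 ^ e1 * y2 ^ e2 * y3 ^ e3 \<le> r1 ^ e1 * r2 ^ e2 * r3 ^ e3 * (1 + \<delta> + \<delta> ^ 2)"
proof -
  let ?E = "\<lambda>e y r. exp (real e * (y / r - 1))"
  have "y1 ^ e1 * y2 ^ e2 * y3 ^ e3 \<le>
      (r1 ^ e1 * ?E e1 y1 r1) * (r2 ^ e2 * ?E e2 y2 r2) * (r3 ^ e3 * ?E e3 y3 r3)"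
    using y r by (intro mult_mono power_le_tangent) auto
  also have "\<dots> = r1 ^ e1 * r2 ^ e2 * r3 ^ e3 *
      exp (real e1 * (y1 / r1 - 1) + real e2 * (y2 / r2 - 1) + real e3 * (y3 / r3 - 1))"
    by (simp add: exp_add)
  also have "\<dots> \<le> r1 ^ e1 * r2 ^ e2 * r3 ^ e3 * exp \<delta>" using r le by (intro mult_left_mono) auto
  also have "\<dots> \<le> r1 ^ e1 * r2 ^ e2 * r3 ^ e3 * (1 + \<delta> + \<delta> ^ 2)"
    using r \<delta> exp_bound[of \<delta>] by (intro mult_left_mono) auto
  finally show ?thesis .
qed

lemma sup_bound_quintic:
  fixes w :: real
  assumes "0 \<le> w" "w \<le> 1 / 4"
  shows "w ^ 5 * (1 - 4 * w) * \<bar>1 - 5 * w\<bar> \<le> 1 / 100000"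
proof (cases "w \<le> 1 / 5")
  case True
  \<comment> \<open>The three bases are \<open>w\<close>, \<open>1 - 4w\<close>,
    \<open>1 - 5w\<close> at \<open>w = 31/200\<close>; the other case uses
    \<open>w = 23/100\<close>. The two local maxima are nearly equal.\<close>
  have "w ^ 5 * (1 - 4 * w) ^ 1 * (1 - 5 * w) ^ 1 \<le>
      (31 / 200) ^ 5 * (19 / 50) ^ 1 * (9 / 40) ^ 1 * (1 + 8 / 100 + (8 / 100) ^ 2)"
    using assms True by (intro product_le_tangent) (auto simp: field_simps)
  also have "\<dots> \<le> 1 / 100000" by (simp add: power_divide)
  finally show ?thesis using True by simp
next
  case False
  have "w ^ 5 * (1 - 4 * w) ^ 1 * (5 * w - 1) ^ 1 \<le>
      (23 / 100) ^ 5 * (2 / 25) ^ 1 * (3 / 20) ^ 1 * (1 + 11 / 100 + (11 / 100) ^ 2)"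
    using assms False by (intro product_le_tangent) (auto simp: field_simps)
  also have "\<dots> \<le> 1 / 100000" by (simp add: power_divide)
  finally show ?thesis using False by simp
qed

lemma sup_bound_7:
  fixes w :: real
  assumes "0 \<le> w" "w \<le> 1 / 4"
  shows "w ^ 2 * (1 - 4 * w) * (1 - 7 * w) ^ 2 \<le> 19 / 10000"
proof (cases "w \<le> 1 / 7")
  case True
  \<comment> \<open>The reference points are \<open>w = 13/200\<close> here and
    \<open>w = 11/50\<close> beyond the zero \<open>1/7\<close>.\<close>
  have "w ^ 2 * (1 - 4 * w) ^ 1 * (1 - 7 * w) ^ 2 \<le>
      (13 / 200) ^ 2 * (37 / 50) ^ 1 * (109 / 200) ^ 2 * (1 + 3 / 100 + (3 / 100) ^ 2)"
    using assms True by (intro product_le_tangent) (auto simp: field_simps)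
  also have "\<dots> \<le> 19 / 10000" by (simp add: power_divide)
  finally show ?thesis by simp
next
  case False
  have "w ^ 2 * (1 - 4 * w) ^ 1 * (7 * w - 1) ^ 2 \<le>
      (11 / 50) ^ 2 * (3 / 25) ^ 1 * (27 / 50) ^ 2 * (1 + 6 / 100 + (6 / 100) ^ 2)"
    using assms False by (intro product_le_tangent) (auto simp: field_simps)
  also have "\<dots> \<le> 19 / 10000" by (simp add: power_divide)
  finally show ?thesis by (simp add: power2_commute)
qed

lemma sup_bound_3:
  fixes u :: real
  assumes "0 \<le> u" "u \<le> 9 / 4"
  shows "u ^ 7 * (1 - u) ^ 6 * \<bar>2 - u\<bar> ^ 9 \<le> 11 / 2000"
proof -
  have "(u - 1) ^ (2 * 3) = (1 - u) ^ (2 * 3)"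
    unfolding power_mult by (simp only: power2_commute[of u 1])
  hence e: "(u - 1) ^ 6 = (1 - u) ^ 6" by simp
  consider "u \<le> 1" | "1 \<le> u" "u \<le> 2" | "2 \<le> u" by linarith
  thus ?thesis
  proof cases
    case 1
    \<comment> \<open>The reference points are \<open>u = 43/100\<close> here and
      \<open>u = 37/25\<close> between the zeros. Beyond 2 all factors increase, so the endpoint
      \<open>9/4\<close> decides.\<close>
    have "u ^ 7 * (1 - u) ^ 6 * (2 - u) ^ 9 \<le>
        (43 / 100) ^ 7 * (57 / 100) ^ 6 * (157 / 100) ^ 9 * (1 + 12 / 1000 + (12 / 1000) ^ 2)"
      using assms 1 by (intro product_le_tangent) (auto simp: field_simps)
    also have "\<dots> \<le> 11 / 2000" by (simp add: power_divide)
    finally show ?thesis using 1 by simp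
  next
    case 2
    have "u ^ 7 * (u - 1) ^ 6 * (2 - u) ^ 9 \<le>
        (37 / 25) ^ 7 * (12 / 25) ^ 6 * (13 / 25) ^ 9 * (1 + 4 / 100 + (4 / 100) ^ 2)"
      using assms 2 by (intro product_le_tangent) (auto simp: field_simps)
    also have "\<dots> \<le> 11 / 2000" by (simp add: power_divide)
    finally show ?thesis using 2 unfolding e by simp
  next
    case 3
    have "u ^ 7 * (u - 1) ^ 6 * (u - 2) ^ 9 \<le> (9 / 4) ^ 7 * (5 / 4) ^ 6 * (1 / 4) ^ 9"
      using assms 3 by (intro mult_mono power_mono) auto
    also have "\<dots> \<le> 11 / 2000" by (simp add: power_divide)
    finally show ?thesis using 3 unfolding e by simp
  qed
qed

text \<open>The maximum is at \<open>w = 1/15\<close>, a double root of the difference; its third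
  root \<open>4/15\<close> lies beyond \<open>1/4\<close>.\<close>

lemma sup_bound_5:
  fixes w :: real
  assumes "0 \<le> w" "w \<le> 1 / 4"
  shows "w * (1 - 5 * w) ^ 2 \<le> 4 / 135"
proof -
  have "0 \<le> 25 * (w - 1 / 15) ^ 2 * (4 / 15 - w)" using assms by simp
  also have "\<dots> = 4 / 135 - w * (1 - 5 * w) ^ 2"
    by (simp add: power2_eq_square field_simps)
  finally show ?thesis by simp
qed

lemma quadratic_ratio:
  fixes a b :: real
  assumes "0 < a" "a < b"
  obtains w where "0 \<le> w" "w \<le> 1 / 4" "a * (b - a) = b ^ 2 * w" "(b - 2 * a) ^ 2 = b ^ 2 * (1 - 4 * w)"
proof (rule that[of "a * (b - a) / b ^ 2"])
  show "0 \<le> a * (b - a) / b ^ 2" using assms by simp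
  show "a * (b - a) / b ^ 2 \<le> 1 / 4" using quadratic_le[of a b] assms by (simp add: field_simps)
  show "a * (b - a) = b ^ 2 * (a * (b - a) / b ^ 2)" using assms by simp
  have "c * (1 - 4 * (x / c)) = c - 4 * x" if "c \<noteq> 0" for c x :: real
    using that by (simp add: field_simps)
  hence "b ^ 2 * (1 - 4 * (a * (b - a) / b ^ 2)) = b ^ 2 - 4 * (a * (b - a))"
    using assms by simp
  moreover have "(b - 2 * a) ^ 2 = b ^ 2 - 4 * (a * (b - a))"
    by (simp add: power2_eq_square algebra_simps)
  ultimately show "(b - 2 * a) ^ 2 = b ^ 2 * (1 - 4 * (a * (b - a) / b ^ 2))" by (simp only:)
qed

section \<open>Integral equations for the conjugates when d is 5 or 7\<close>

lemma sin2_conjs_root_of_unity: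
  assumes b: "b \<in> sin2_conjs d"
  obtains z w :: complex where "complex_of_real b = 2 - (z + w)" "z * w = 1" "w = z ^ (d - 1)"
    "z ^ d = 1" "z \<noteq> 1" "b > 0"
proof -
  obtain k where k: "k \<in> half_totatives d" "b = 4 * sin (pi * real k / real d) ^ 2"
    using b unfolding sin2_conjs_def by blast
  have d: "d > 0" using k(1) by (auto simp: half_totatives_def)
  have "sin (pi * real k / real d) > 0" using k(1) by (intro sin_half_totative_pos) (auto simp: half_totatives_def)
  hence b0: "b > 0" using k(2) by simp
  define z where "z = cis (2 * pi / real d) ^ k"
  have bz: "complex_of_real b = 2 - (z + z ^ (d - 1))"
    using sin2_eq_cis[OF d, of k] unfolding k(2) z_def by simp
  have "z ^ d = (cis (2 * pi / real d) ^ d) ^ k"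
    by (simp only: z_def power_mult[symmetric] mult.commute)
  hence zd: "z ^ d = 1" by (simp add: cis_root_of_unity[OF d])
  hence zw: "z * z ^ (d - 1) = 1" using d by (simp add: power_eq_if)
  have "z \<noteq> 1"
  proof
    assume "z = 1"
    hence "complex_of_real b = 0" using bz by simp
    thus False using b0 by simp
  qed
  thus ?thesis using that[OF bz zw refl zd _ b0] by blast
qed

lemma sin2_conjs_5:
  assumes "b \<in> sin2_conjs 5"
  shows "b ^ 2 = 5 * b - 5"
proof -
  obtain z w :: complex where z: "complex_of_real b = 2 - (z + w)" "z * w = 1" "w = z ^ (5 - 1)"
    "z ^ 5 = 1" "z \<noteq> 1" by (rule sin2_conjs_root_of_unity[OF assms])
  have w: "w = z ^ 4" using z(3) by simp
  have "(z - 1) * (1 + z + z ^ 2 + z ^ 3 + z ^ 4) = z ^ 5 - 1"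
    by (simp add: power_numeral_reduce algebra_simps)
  hence g: "1 + z + z ^ 2 + z ^ 3 + z ^ 4 = 0" using z(4,5) by simp
  have "w ^ 2 = z ^ 5 * z ^ 3" unfolding w by (simp add: power_mult[symmetric] power_add[symmetric])
  hence w2: "w ^ 2 = z ^ 3" using z(4) by simp
  have "(2 - (z + w)) ^ 2 - 5 * (2 - (z + w)) + 5 = z ^ 2 + w ^ 2 + z + w + 2 * (z * w) - 1"
    by (simp add: power2_eq_square algebra_simps)
  also have "\<dots> = 1 + z + z ^ 2 + z ^ 3 + z ^ 4" using w w2 z(2) by simp
  finally have "complex_of_real b ^ 2 - 5 * complex_of_real b + 5 = 0" using g z(1) by simp
  hence "complex_of_real (b ^ 2 - 5 * b + 5) = 0" by simp
  hence "b ^ 2 - 5 * b + 5 = 0" by (simp only: of_real_eq_0_iff)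
  thus ?thesis by simp
qed

lemma sin2_conjs_7:
  assumes "b \<in> sin2_conjs 7"
  shows "b ^ 3 - 7 * b ^ 2 + 14 * b - 7 = 0"
proof -
  obtain z w :: complex where z: "complex_of_real b = 2 - (z + w)" "z * w = 1" "w = z ^ (7 - 1)"
    "z ^ 7 = 1" "z \<noteq> 1" by (rule sin2_conjs_root_of_unity[OF assms])
  have w: "w = z ^ 6" using z(3) by simp
  have "(z - 1) * (1 + z + z ^ 2 + z ^ 3 + z ^ 4 + z ^ 5 + z ^ 6) = z ^ 7 - 1"
    by (simp add: power_numeral_reduce algebra_simps)
  hence g: "1 + z + z ^ 2 + z ^ 3 + z ^ 4 + z ^ 5 + z ^ 6 = 0" using z(4,5) by simp
  have "w ^ 2 = z ^ 7 * z ^ 5" unfolding w by (simp add: power_mult[symmetric] power_add[symmetric])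
  hence w2: "w ^ 2 = z ^ 5" using z(4) by simp
  have "w ^ 3 = z ^ 7 * (z ^ 7 * z ^ 4)" unfolding w by (simp add: power_mult[symmetric] power_add[symmetric])
  hence w3: "w ^ 3 = z ^ 4" using z(4) by simp
  define c where "c = z + w"
  have c2: "c ^ 2 = z ^ 2 + w ^ 2 + 2" using z(2) by (simp add: c_def power2_eq_square algebra_simps)
  have "c ^ 3 = z ^ 3 + w ^ 3 + 3 * (z * w) * c"
    by (simp add: c_def power3_eq_cube algebra_simps)
  hence c3: "c ^ 3 = z ^ 3 + w ^ 3 + 3 * c" using z(2) by simp
  have "(2 - c) ^ 3 - 7 * (2 - c) ^ 2 + 14 * (2 - c) - 7 = - (c ^ 3 + c ^ 2 - 2 * c - 1)"
    by (simp add: power3_eq_cube power2_eq_square algebra_simps)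
  also have "c ^ 3 + c ^ 2 - 2 * c - 1 = 1 + z + z ^ 2 + z ^ 3 + z ^ 4 + z ^ 5 + z ^ 6"
    unfolding c2 c3 w2 w3 by (simp add: c_def w)
  finally have "complex_of_real b ^ 3 - 7 * complex_of_real b ^ 2 + 14 * complex_of_real b - 7 = 0"
    using g z(1) by (simp add: c_def)
  hence "complex_of_real (b ^ 3 - 7 * b ^ 2 + 14 * b - 7) = 0" by simp
  thus ?thesis by (simp only: of_real_eq_0_iff)
qed

section \<open>Degree bounds for the exceptional d\<close>

lemma degree_bound_quintic:
  assumes m: "norm_ineq d \<alpha> m" and d: "3 \<le> d" "d < 512" and \<alpha>: "4 < \<alpha>" "\<alpha> < 256"
    and n: "totient d = 2 * n" and g: "prime_power_base d = g"
    and s': "0 \<le> s'" "s' \<le> 4 * sin (pi / real d) ^ 2"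
    and x: "real g ^ 14 * (1 / 100000) ^ n \<le> 1"
    and fin: "20 * 256 ^ 14 * (real g ^ 14 * (1 / 100000) ^ n) ^ M \<le> s' ^ 14 * (1 / 100000)"
  shows "m < M"
proof -
  define s where "s = 4 * sin (pi / real d) ^ 2"
  have s: "0 < s" "s \<le> 4" using sin2_bounds[OF d(1)] by (auto simp: s_def)
  \<comment> \<open>Homogeneous of degree 14, hence \<open>k = 14\<close>: it equals
    \<open>b^14 w^5 (1 - 4w) (1 - 5w)\<close>. The same \<open>q\<close> serves
    \<open>d = 9, 11, 13, 17, 37\<close>.\<close>
  define q :: "real \<Rightarrow> real \<Rightarrow> real"
    where "q = (\<lambda>a b. (a * (b - a)) ^ 5 * (b - 2 * a) ^ 2 * (b ^ 2 - 5 * (a * (b - a))))"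
  have ip: "int_poly2 q" unfolding q_def by (intro int_poly2_intros)
  note aq = abs_quadratic[OF \<alpha> s]
  define V where "V = \<alpha> * (\<alpha> - s)"
  have V: "0 < V" "V < 256 ^ 2" using aq by (auto simp: V_def)
  have neg: "\<alpha> * (s - \<alpha>) = - V" by (simp add: V_def algebra_simps)
  have qa: "\<bar>q \<alpha> s\<bar> = V ^ 5 * (2 * \<alpha> - s) ^ 2 * (s ^ 2 + 5 * V)"
    unfolding q_def neg using V by (simp add: abs_mult power_abs power2_commute[of s])
  have "s ^ 2 + 5 * V \<le> 5 * \<alpha> ^ 2"
  proof -
    have "s * s \<le> 5 * \<alpha> * s" using \<alpha> s by (intro mult_right_mono) auto
    thus ?thesis by (simp add: V_def power2_eq_square algebra_simps)
  qed
  also have "\<dots> \<le> 5 * 256 ^ 2" using \<alpha> by (intro mult_left_mono power_mono) auto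
  finally have t3: "s ^ 2 + 5 * V \<le> 5 * 256 ^ 2" .
  have t2: "(2 * \<alpha> - s) ^ 2 \<le> 512 ^ 2" using \<alpha> s by (intro power_mono) auto
  have t1: "V ^ 5 < (256 ^ 2) ^ 5" using V by (intro power_strict_mono) auto
  have pos: "0 < (2 * \<alpha> - s) ^ 2" "0 < s ^ 2 + 5 * V" using \<alpha> s V by (auto intro: add_pos_pos)
  have q0: "q \<alpha> s \<noteq> 0"
  proof
    assume "q \<alpha> s = 0"
    hence "V ^ 5 * (2 * \<alpha> - s) ^ 2 * (s ^ 2 + 5 * V) = 0" using qa by simp
    thus False using V pos by simp
  qed
  have "\<bar>q \<alpha> s\<bar> \<le> V ^ 5 * 512 ^ 2 * (5 * 256 ^ 2)"
    unfolding qa using t2 t3 V pos by (intro mult_mono mult_left_mono) auto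
  also have "\<dots> < (256 ^ 2) ^ 5 * 512 ^ 2 * (5 * 256 ^ 2)" using t1 by (intro mult_strict_right_mono) auto
  \<comment> \<open>The 20 is 4 from \<open>(2 \<alpha> - s)^2 \<le> 512^2\<close> times 5 from
    \<open>s^2 + 5 V \<le> 5 * 256^2\<close>.\<close>
  also have "\<dots> = 20 * 256 ^ 14" by simp
  finally have qQ: "\<bar>q \<alpha> s\<bar> < 20 * 256 ^ 14" .
  show ?thesis
  proof (rule degree_bound[OF m s_def ip q0 qQ, where G = "1 / 100000" and k = 14
        and g = "real g" and s' = s' and n = n])
    show "14 = 0 \<or> exp (mangoldt d) \<le> real g" using exp_mangoldt_le[of d] d g by simp
    fix a b :: real assume ab: "0 < a" "a < b"
    obtain w where w: "0 \<le> w" "w \<le> 1 / 4" "a * (b - a) = b ^ 2 * w" "(b - 2 * a) ^ 2 = b ^ 2 * (1 - 4 * w)"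
      by (rule quadratic_ratio[OF ab])
    have "b ^ 2 - 5 * (b ^ 2 * w) = b ^ 2 * (1 - 5 * w)" by (simp add: algebra_simps)
    hence "q a b = (b ^ 2) ^ 5 * b ^ 2 * b ^ 2 * (w ^ 5 * (1 - 4 * w) * (1 - 5 * w))"
      unfolding q_def w(3,4) by (simp only: power_mult_distrib mult_ac)
    also have "(b ^ 2) ^ 5 * b ^ 2 * b ^ 2 = b ^ 14" by (simp flip: power_mult power_add)
    finally have "q a b = b ^ 14 * (w ^ 5 * (1 - 4 * w) * (1 - 5 * w))" .
    hence "\<bar>q a b\<bar> = b ^ 14 * (w ^ 5 * (1 - 4 * w) * \<bar>1 - 5 * w\<bar>)"
      using w ab by (simp add: abs_mult)
    thus "\<bar>q a b\<bar> \<le> b ^ 14 * (1 / 100000)"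
      using sup_bound_quintic[OF w(1,2)] ab by (simp only:) (intro mult_left_mono, auto)
  qed (use d n s' x fin in \<open>auto simp: s_def\<close>)
qed

lemma sin2_conjs_singleton:
  assumes "half_totatives d = {1}"
  shows "sin2_conjs d = {4 * sin (pi / real d) ^ 2}"
  by (simp add: sin2_conjs_def assms)

lemma half_totatives_346: "half_totatives 3 = {1}" "half_totatives 4 = {1}" "half_totatives 6 = {1}"
proof -
  show "half_totatives 3 = {1}" "half_totatives 4 = {1}" by (auto simp: half_totatives_def)
  have "k = 1" if "0 < k" "2 * k < 6" "coprime k 6" for k :: nat
  proof -
    have "k = 1 \<or> k = 2" using that by linarith
    moreover have "\<not> coprime (2::nat) 6" by (simp add: coprime_iff_gcd_eq_1)
    ultimately show ?thesis using that by auto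
  qed
  thus "half_totatives 6 = {1}" by (auto simp: half_totatives_def)
qed

lemma sin2_346: "4 * sin (pi / 3) ^ 2 = (3::real)" "4 * sin (pi / 4) ^ 2 = (2::real)"
  "4 * sin (pi / 6) ^ 2 = (1::real)"
  by (simp_all add: sin_60 sin_45 sin_30 power_divide)

text \<open>The only conjugate is \<open>b = 3\<close>, so \<open>u = a (3 - a) = 9w\<close> is
  itself integral and no power of \<open>b\<close> is spent. At \<open>\<alpha>\<close> each of the
  22 factors is below \<open>256^2\<close>, which gives \<open>256^44\<close>.\<close>

lemma degree_bound_3:
  assumes m: "norm_ineq 3 \<alpha> m" and \<alpha>: "4 < \<alpha>" "\<alpha> < 256"
  shows "m < 48"
proof -
  define q :: "real \<Rightarrow> real \<Rightarrow> real"
    where "q = (\<lambda>a b. (a * (b - a)) ^ 7 * (1 - a * (b - a)) ^ 6 * (2 - a * (b - a)) ^ 9)"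
  have ip: "int_poly2 q" unfolding q_def by (intro int_poly2_intros)
  define V where "V = \<alpha> * (\<alpha> - 3)"
  have neg: "\<alpha> * (3 - \<alpha>) = - V" by (simp add: V_def algebra_simps)
  have V0: "V > 0" using \<alpha> by (simp add: V_def)
  have "\<alpha> * \<alpha> < 256 * 256" using \<alpha> by (intro mult_strict_mono) auto
  hence V2: "2 + V < 256 ^ 2" using \<alpha> by (simp add: V_def algebra_simps)
  have qa: "\<bar>q \<alpha> 3\<bar> = V ^ 7 * (1 + V) ^ 6 * (2 + V) ^ 9"
    unfolding q_def neg using V0 by (simp add: abs_mult power_abs)
  have "\<bar>q \<alpha> 3\<bar> > 0" unfolding qa using V0 by simp
  hence q0: "q \<alpha> 3 \<noteq> 0" by auto
  have "\<bar>q \<alpha> 3\<bar> < (256 ^ 2) ^ 7 * (256 ^ 2) ^ 6 * (256 ^ 2) ^ 9"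
    unfolding qa using V0 V2 by (intro mult_strict_mono power_strict_mono) auto
  also have "\<dots> = 256 ^ 44" by simp
  finally have qQ: "\<bar>q \<alpha> 3\<bar> < 256 ^ 44" .
  show ?thesis
  \<comment> \<open>For \<open>k = 0\<close> neither \<open>gamma\<close> nor the size of
    \<open>s\<close> enters: \<open>s' = 0\<close> is a placeholder, with
    \<open>0 ^ 0 = 1\<close>.\<close>
  proof (rule degree_bound[where d = 3 and s = 3 and q = q and Q = "256 ^ 44" and G = "11 / 2000"
        and k = 0 and g = 1 and s' = 0 and n = 1, OF m _ ip q0 qQ])
    fix a b :: real assume "b \<in> sin2_conjs 3" and ab: "0 < a" "a < b"
    hence b: "b = 3" using sin2_conjs_singleton[OF half_totatives_346(1)] sin2_346(1) by simp
    define u where "u = a * (3 - a)"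
    have "0 \<le> u" using ab b by (simp add: u_def)
    moreover have "u \<le> 9 / 4" using quadratic_le[of a 3] by (simp add: u_def)
    ultimately have "u ^ 7 * (1 - u) ^ 6 * \<bar>2 - u\<bar> ^ 9 \<le> 11 / 2000" by (rule sup_bound_3)
    moreover have "\<bar>q a b\<bar> = u ^ 7 * (1 - u) ^ 6 * \<bar>2 - u\<bar> ^ 9"
      unfolding q_def b u_def[symmetric] using \<open>0 \<le> u\<close> by (simp add: abs_mult power_abs)
    ultimately show "\<bar>q a b\<bar> \<le> b ^ 0 * (11 / 2000)" by simp
  next
    show "3 = 4 * sin (pi / real 3) ^ 2" using sin2_346(1) by simp
    show "totient 3 = 2 * 1" by code_simp
    show "(256::real) ^ 44 * (1 ^ 0 * (11 / 2000) ^ 1) ^ 48 \<le> 0 ^ 0 * (11 / 2000)"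
      by (simp add: power_divide)
  qed auto
qed

text \<open>For \<open>b = 2\<close> one has \<open>(1 - a)^2 = 1 - u\<close> with
  \<open>u = a (2 - a) \<le> 1\<close>, and the quadratic estimate applies a second time, to
  \<open>u (1 - u)\<close>.\<close>

lemma degree_bound_4:
  assumes m: "norm_ineq 4 \<alpha> m" and \<alpha>: "4 < \<alpha>" "\<alpha> < 256"
  shows "m < 17"
proof -
  define q :: "real \<Rightarrow> real \<Rightarrow> real" where "q = (\<lambda>a b. (a * (b - a)) * (1 - a) ^ 2)"
  have ip: "int_poly2 q" unfolding q_def by (intro int_poly2_intros)
  note aq = abs_quadratic[OF \<alpha>, of 2]
  have qa: "\<bar>q \<alpha> 2\<bar> = \<alpha> * (\<alpha> - 2) * (\<alpha> - 1) ^ 2"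
    unfolding q_def using aq by (simp add: abs_mult power2_commute[of 1])
  have "\<bar>q \<alpha> 2\<bar> > 0" unfolding qa using \<alpha> by simp
  hence q0: "q \<alpha> 2 \<noteq> 0" by auto
  have "(\<alpha> - 1) ^ 2 < 256 ^ 2" using \<alpha> by (intro power_strict_mono) auto
  hence "\<bar>q \<alpha> 2\<bar> < 256 ^ 2 * 256 ^ 2"
    unfolding qa using aq \<alpha> by (intro mult_strict_mono) auto
  also have "\<dots> = 256 ^ 4" by simp
  finally have qQ: "\<bar>q \<alpha> 2\<bar> < 256 ^ 4" .
  show ?thesis
  proof (rule degree_bound[where d = 4 and s = 2 and q = q and Q = "256 ^ 4" and G = "1 / 4"
        and k = 0 and g = 1 and s' = 0 and n = 1, OF m _ ip q0 qQ])
    fix a b :: real assume "b \<in> sin2_conjs 4" and ab: "0 < a" "a < b"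
    hence b: "b = 2" using sin2_conjs_singleton[OF half_totatives_346(2)] sin2_346(2) by simp
    define u where "u = a * (2 - a)"
    have "0 \<le> u" using ab b by (simp add: u_def)
    have "(1 - a) ^ 2 = 1 - u" by (simp add: u_def power2_eq_square algebra_simps)
    hence "\<bar>q a b\<bar> = \<bar>u * (1 - u)\<bar>" unfolding q_def b u_def by simp
    moreover have "u \<le> 1" using quadratic_le[of a 2] by (simp add: u_def)
    ultimately show "\<bar>q a b\<bar> \<le> b ^ 0 * (1 / 4)" using \<open>0 \<le> u\<close> quadratic_le[of u 1] by simp
  next
    show "2 = 4 * sin (pi / real 4) ^ 2" using sin2_346(2) by simp
    show "totient 4 = 2 * 1" by code_simp
    show "(256::real) ^ 4 * (1 ^ 0 * (1 / 4) ^ 1) ^ 17 \<le> 0 ^ 0 * (1 / 4)"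
      by (simp add: power_divide)
  qed auto
qed

lemma degree_bound_6:
  assumes m: "norm_ineq 6 \<alpha> m" and \<alpha>: "4 < \<alpha>" "\<alpha> < 256"
  shows "m < 9"
proof (rule degree_bound[where d = 6 and s = 1 and Q = "256 ^ 2" and G = "1 / 4"
      and k = 0 and g = 1 and s' = 0 and n = 1, OF m _ int_poly2_quadratic])
  show "\<alpha> * (1 - \<alpha>) \<noteq> 0" "\<bar>\<alpha> * (1 - \<alpha>)\<bar> < 256 ^ 2" using abs_quadratic[OF \<alpha>, of 1] by auto
  fix a b :: real assume "b \<in> sin2_conjs 6" and ab: "0 < a" "a < b"
  hence b: "b = 1" using sin2_conjs_singleton[OF half_totatives_346(3)] sin2_346(3) by simp
  show "\<bar>a * (b - a)\<bar> \<le> b ^ 0 * (1 / 4)" using ab b quadratic_le[of a 1] by simp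
next
  show "1 = 4 * sin (pi / real 6) ^ 2" using sin2_346(3) by simp
  show "totient 6 = 2 * 1" by code_simp
  \<comment> \<open>Both sides equal \<open>1/4\<close>, so the exact value \<open>s = 1\<close>
    matters here.\<close>
  show "(256::real) ^ 2 * (1 ^ 0 * (1 / 4) ^ 1) ^ 9 \<le> 0 ^ 0 * (1 / 4)"
    by (simp add: power_divide)
qed auto

lemma le_sin2:
  assumes "d \<ge> 3" "x = 157 / (50 * real d)" "c \<le> 4 * x ^ 2 * (1 - x ^ 2 / 6) ^ 2"
  shows "c \<le> 4 * sin (pi / real d) ^ 2"
  using sin2_lower[OF assms(1,2)] assms(3) by linarith

lemma sin2_in_conjs:
  assumes "d \<ge> 3"
  shows "4 * sin (pi / real d) ^ 2 \<in> sin2_conjs d"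
proof -
  have "1 \<in> half_totatives d" using assms by (auto simp: half_totatives_def)
  thus ?thesis unfolding sin2_conjs_def by (rule rev_image_eqI) simp
qed

lemma degree_bound_5:
  assumes m: "norm_ineq 5 \<alpha> m" and \<alpha>: "4 < \<alpha>" "\<alpha> < 256"
  shows "m < 11"
proof -
  define s :: real where "s = 4 * sin (pi / real 5) ^ 2"
  have s: "0 < s" "s \<le> 4" using sin2_bounds[of 5] by (auto simp: s_def)
  have "s \<in> sin2_conjs 5" using sin2_in_conjs[of 5] by (simp add: s_def)
  hence "s ^ 2 = 5 * s - 5" by (rule sin2_conjs_5)
  moreover have "s ^ 2 > 0" using s by simp
  ultimately have s1: "s > 1" by linarith
  \<comment> \<open>Since \<open>b - 1 = b^2 / 5\<close>, the squared factor is
    \<open>-(b - 1) (1 - 5w)\<close>. It replaces \<open>b^2 (1 - 5w)\<close> and saves a factor 5,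
    hence \<open>G = (4/135) / 25\<close>.\<close>
  define q :: "real \<Rightarrow> real \<Rightarrow> real" where "q = (\<lambda>a b. (a * (b - a)) * (a * (b - a) - (b - 1)) ^ 2)"
  have ip: "int_poly2 q" unfolding q_def by (intro int_poly2_intros)
  define V where "V = \<alpha> * (\<alpha> - s)"
  have neg: "\<alpha> * (s - \<alpha>) = - V" by (simp add: V_def algebra_simps)
  have V: "0 < V" "V < 256 ^ 2" using abs_quadratic[OF \<alpha> s] by (auto simp: V_def)
  have sq: "(- V - (s - 1)) ^ 2 = (V + (s - 1)) ^ 2" by (simp add: power2_eq_square algebra_simps)
  have qa: "\<bar>q \<alpha> s\<bar> = V * (V + (s - 1)) ^ 2"
    unfolding q_def neg sq using V by (simp add: abs_mult)
  have V1: "0 < V + (s - 1)" using V s1 by simp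
  have "V + (s - 1) < 256 ^ 2"
  proof -
    have "\<alpha> * \<alpha> < 256 * 256" using \<alpha> by (intro mult_strict_mono) auto
    moreover have "1 * s \<le> \<alpha> * s" using \<alpha> s by (intro mult_right_mono) auto
    ultimately show ?thesis by (simp add: V_def right_diff_distrib)
  qed
  hence V2: "(V + (s - 1)) ^ 2 < (256 ^ 2) ^ 2" using V1 by (intro power_strict_mono) auto
  have "\<bar>q \<alpha> s\<bar> > 0" unfolding qa using V V1 by simp
  hence q0: "q \<alpha> s \<noteq> 0" by auto
  have "\<bar>q \<alpha> s\<bar> < 256 ^ 2 * (256 ^ 2) ^ 2"
    unfolding qa using V V2 by (intro mult_strict_mono) auto
  also have "\<dots> = 256 ^ 6" by simp
  finally have qQ: "\<bar>q \<alpha> s\<bar> < 256 ^ 6" .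
  show ?thesis
  proof (rule degree_bound[OF m s_def ip q0 qQ, where G = "4 / 3375" and k = 6 and g = 5
        and s' = "137 / 100" and n = 2])
    show "6 = 0 \<or> exp (mangoldt 5) \<le> (5::real)" by simp
    fix a b :: real assume b: "b \<in> sin2_conjs 5" and ab: "0 < a" "a < b"
    obtain w where w: "0 \<le> w" "w \<le> 1 / 4" "a * (b - a) = b ^ 2 * w"
      by (rule quadratic_ratio[OF ab])
    have b1: "b - 1 = b ^ 2 / 5" using sin2_conjs_5[OF b] by simp
    have "b ^ 2 * w - b ^ 2 / 5 = - (b ^ 2 / 5 * (1 - 5 * w))" by (simp add: field_simps)
    hence "q a b = b ^ 2 * w * (b ^ 2 / 5 * (1 - 5 * w)) ^ 2" unfolding q_def w(3) b1 by simp
    also have "\<dots> = b ^ 2 * (b ^ 2) ^ 2 / 25 * (w * (1 - 5 * w) ^ 2)"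
      by (simp add: power_mult_distrib power_divide)
    also have "b ^ 2 * (b ^ 2) ^ 2 = b ^ 6" by (simp flip: power_mult power_add)
    finally have "q a b = b ^ 6 / 25 * (w * (1 - 5 * w) ^ 2)" .
    moreover have "0 \<le> b ^ 6 / 25 * (w * (1 - 5 * w) ^ 2)" using w ab by simp
    ultimately have "\<bar>q a b\<bar> = b ^ 6 / 25 * (w * (1 - 5 * w) ^ 2)" by (simp only: abs_of_nonneg)
    also have "\<dots> \<le> b ^ 6 / 25 * (4 / 135)"
      using sup_bound_5[OF w(1,2)] ab by (intro mult_left_mono) auto
    finally show "\<bar>q a b\<bar> \<le> b ^ 6 * (4 / 3375)" by simp
  next
    show "totient 5 = 2 * 2" by code_simp
    show "137 / 100 \<le> s"
      unfolding s_def by (rule le_sin2[of _ "157 / 250"]) (simp_all add: power_divide)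
    show "(256::real) ^ 6 * (5 ^ 6 * (4 / 3375) ^ 2) ^ 11 \<le> (137 / 100) ^ 6 * (4 / 3375)"
      by (simp add: power_divide)
    show "5 ^ 6 * (4 / 3375 :: real) ^ 2 \<le> 1" by (simp add: power_divide)
  qed auto
qed

text \<open>Since \<open>b\<^sup>3 = 7 (1 - b)\<^sup>2\<close> and \<open>1 - b\<close> is a unit, \<open>7 / b\<^sup>2\<close> is an integral polynomial in \<open>b\<close>.\<close>

lemma degree_bound_7:
  assumes m: "norm_ineq 7 \<alpha> m" and \<alpha>: "4 < \<alpha>" "\<alpha> < 256"
  shows "m < 11"
proof -
  define s :: real where "s = 4 * sin (pi / real 7) ^ 2"
  have s: "0 < s" "s \<le> 4" using sin2_bounds[of 7] by (auto simp: s_def)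
  \<comment> \<open>The bracket is the inverse of the unit \<open>1 - b\<close>, so
    \<open>c b = b / (1 - b)^2 = 7 / b^2\<close> on the conjugates.\<close>
  define c :: "real \<Rightarrow> real" where "c b = b * (3 + 4 * (1 - b) + (1 - b) ^ 2) ^ 2" for b
  have c: "c b * b ^ 2 = 7" if "b \<in> sin2_conjs 7" for b
  proof -
    define v where "v = 1 - b"
    have r: "b ^ 3 - 7 * b ^ 2 + 14 * b - 7 = 0" by (rule sin2_conjs_7[OF that])
    have b3: "b ^ 3 = 7 * v ^ 2" using r by (simp add: v_def power2_eq_square algebra_simps)
    have "v * (3 + 4 * v + v ^ 2) - 1 = - (b ^ 3 - 7 * b ^ 2 + 14 * b - 7)"
      by (simp add: v_def power2_eq_square power3_eq_cube algebra_simps)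
    hence v1: "v * (3 + 4 * v + v ^ 2) = 1" using r by simp
    have "c b * b ^ 2 = b ^ 3 * (3 + 4 * v + v ^ 2) ^ 2"
      by (simp add: c_def v_def power2_eq_square power3_eq_cube)
    also have "\<dots> = 7 * (v * (3 + 4 * v + v ^ 2)) ^ 2" unfolding b3 by (simp add: power_mult_distrib)
    finally show ?thesis using v1 by simp
  qed
  have s7: "s \<in> sin2_conjs 7" using sin2_in_conjs[of 7] by (simp add: s_def)
  have s_lo: "3 / 4 \<le> s" unfolding s_def by (rule le_sin2[of _ "157 / 350"]) (simp_all add: power_divide)
  define q :: "real \<Rightarrow> real \<Rightarrow> real"
    where "q = (\<lambda>a b. (a * (b - a)) ^ 2 * (b - 2 * a) ^ 2 * (c b * (a * (b - a)) - 1) ^ 2)"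
  have ip: "int_poly2 q" unfolding q_def c_def by (intro int_poly2_intros)
  define V where "V = \<alpha> * (\<alpha> - s)"
  have neg: "\<alpha> * (s - \<alpha>) = - V" by (simp add: V_def algebra_simps)
  have V: "0 < V" "V < 256 ^ 2" using abs_quadratic[OF \<alpha> s] by (auto simp: V_def)
  have cs: "c s = 7 / s ^ 2" using c[OF s7] s by (simp add: field_simps)
  have c0: "c s > 0" unfolding cs using s by simp
  have sq: "(c s * - V - 1) ^ 2 = (c s * V + 1) ^ 2" by (simp add: power2_eq_square algebra_simps)
  have qa: "\<bar>q \<alpha> s\<bar> = V ^ 2 * (2 * \<alpha> - s) ^ 2 * (c s * V + 1) ^ 2"
    unfolding q_def neg sq by (simp add: abs_mult power2_commute[of s])
  have "c s * V + 1 = (7 * V + s ^ 2) / s ^ 2" using s by (simp add: cs field_simps)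
  also have "\<dots> \<le> (7 * 256 ^ 2) / s ^ 2"
  proof (intro divide_right_mono)
    have "\<alpha> * \<alpha> \<le> 256 * 256" using \<alpha> by (intro mult_mono) auto
    moreover have "s * s \<le> 7 * \<alpha> * s" using \<alpha> s by (intro mult_right_mono) auto
    ultimately show "7 * V + s ^ 2 \<le> 7 * 256 ^ 2" by (simp add: V_def power2_eq_square algebra_simps)
  qed simp
  \<comment> \<open>Dividing by \<open>s^2\<close> makes \<open>q \<alpha> s\<close> larger, so the
    lower bound \<open>3/4\<close> for \<open>s\<close> is used for \<open>Q\<close> as
    well.\<close>
  also have "\<dots> \<le> (7 * 256 ^ 2) / (3 / 4) ^ 2" using s_lo s by (intro divide_left_mono power_mono) auto
  also have "\<dots> = 7 * 256 ^ 2 * 16 / 9" by (simp add: power_divide)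
  finally have t3: "(c s * V + 1) ^ 2 \<le> (7 * 256 ^ 2 * 16 / 9) ^ 2" using c0 V by (intro power_mono) auto
  have t2: "(2 * \<alpha> - s) ^ 2 \<le> 512 ^ 2" using \<alpha> s by (intro power_mono) auto
  have t1: "V ^ 2 < (256 ^ 2) ^ 2" using V by (intro power_strict_mono) auto
  have "0 < c s * V" using c0 V by simp
  hence "\<bar>q \<alpha> s\<bar> > 0" unfolding qa using V \<alpha> s by simp
  hence q0: "q \<alpha> s \<noteq> 0" by auto
  have "\<bar>q \<alpha> s\<bar> \<le> V ^ 2 * 512 ^ 2 * (7 * 256 ^ 2 * 16 / 9) ^ 2"
    unfolding qa using t2 t3 V by (intro mult_mono mult_left_mono) auto
  also have "\<dots> < (256 ^ 2) ^ 2 * 512 ^ 2 * (7 * 256 ^ 2 * 16 / 9) ^ 2"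
    using t1 by (intro mult_strict_right_mono) auto
  finally have qQ: "\<bar>q \<alpha> s\<bar> < (256 ^ 2) ^ 2 * 512 ^ 2 * (7 * 256 ^ 2 * 16 / 9) ^ 2" .
  show ?thesis
  proof (rule degree_bound[OF m s_def ip q0 qQ, where G = "19 / 10000" and k = 6 and g = 7
        and s' = "3 / 4" and n = 3])
    show "6 = 0 \<or> exp (mangoldt 7) \<le> (7::real)" by simp
    fix a b :: real assume b: "b \<in> sin2_conjs 7" and ab: "0 < a" "a < b"
    obtain w where w: "0 \<le> w" "w \<le> 1 / 4" "a * (b - a) = b ^ 2 * w" "(b - 2 * a) ^ 2 = b ^ 2 * (1 - 4 * w)"
      by (rule quadratic_ratio[OF ab])
    have "c b * (b ^ 2 * w) - 1 = c b * b ^ 2 * w - 1" by simp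
    also have "\<dots> = - (1 - 7 * w)" unfolding c[OF b] by simp
    finally have "(c b * (b ^ 2 * w) - 1) ^ 2 = (1 - 7 * w) ^ 2" by (simp only: power2_minus)
    hence "q a b = (b ^ 2 * w) ^ 2 * (b ^ 2 * (1 - 4 * w)) * (1 - 7 * w) ^ 2"
      unfolding q_def w(3,4) by (simp only:)
    also have "\<dots> = (b ^ 2) ^ 2 * b ^ 2 * (w ^ 2 * (1 - 4 * w) * (1 - 7 * w) ^ 2)"
      by (simp only: power_mult_distrib mult_ac)
    also have "(b ^ 2) ^ 2 * b ^ 2 = b ^ 6" by (simp flip: power_mult power_add)
    finally have "q a b = b ^ 6 * (w ^ 2 * (1 - 4 * w) * (1 - 7 * w) ^ 2)" .
    moreover have "0 \<le> b ^ 6 * (w ^ 2 * (1 - 4 * w) * (1 - 7 * w) ^ 2)" using w ab by simp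
    ultimately have "\<bar>q a b\<bar> = b ^ 6 * (w ^ 2 * (1 - 4 * w) * (1 - 7 * w) ^ 2)"
      by (simp only: abs_of_nonneg)
    also have "\<dots> \<le> b ^ 6 * (19 / 10000)"
      using sup_bound_7[OF w(1,2)] ab by (intro mult_left_mono) auto
    finally show "\<bar>q a b\<bar> \<le> b ^ 6 * (19 / 10000)" .
  next
    show "totient 7 = 2 * 3" by code_simp
    show "3 / 4 \<le> s" by (rule s_lo)
    show "((256::real) ^ 2) ^ 2 * 512 ^ 2 * (7 * 256 ^ 2 * 16 / 9) ^ 2 * (7 ^ 6 * (19 / 10000) ^ 3) ^ 11
        \<le> (3 / 4) ^ 6 * (19 / 10000)"
      by (simp add: power_divide)
    show "7 ^ 6 * (19 / 10000 :: real) ^ 3 \<le> 1" by (simp add: power_divide)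
  qed auto
qed

lemma degree_bound_special:
  assumes m: "norm_ineq d \<alpha> m" and d: "d \<in> special_d" and \<alpha>: "4 < \<alpha>" "\<alpha> < 256"
  shows "m < deg_limit d"
proof -
  consider "d = 3" | "d = 4" | "d = 5" | "d = 6" | "d = 7" | "d = 9" | "d = 11" | "d = 13" | "d = 17" | "d = 37"
    using d by (auto simp: special_d_def)
  thus ?thesis
  proof cases
    case 1
    have "deg_limit 3 = 48" by code_simp
    thus ?thesis using degree_bound_3[OF _ \<alpha>] m 1 by simp
  next
    case 2
    have "deg_limit 4 = 17" by code_simp
    thus ?thesis using degree_bound_4[OF _ \<alpha>] m 2 by simp
  next
    case 3
    have "deg_limit 5 = 11" by code_simp
    thus ?thesis using degree_bound_5[OF _ \<alpha>] m 3 by simp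
  next
    case 4
    have "deg_limit 6 = 9" by code_simp
    thus ?thesis using degree_bound_6[OF _ \<alpha>] m 4 by simp
  next
    case 5
    have "deg_limit 7 = 11" by code_simp
    thus ?thesis using degree_bound_7[OF _ \<alpha>] m 5 by simp
  next
    case 6
    have v: "deg_limit 9 = 6" "totient 9 = 2 * 3" "prime_power_base 9 = 3" by code_simp+
    \<comment> \<open>Here and in the cases below the rational bound of \<open>sin2_lower\<close> is
      rounded down to two significant digits.\<close>
    have lo: "46 / 100 \<le> 4 * sin (pi / real 9) ^ 2" by (rule le_sin2[of _ "157 / 450"]) (simp_all add: power_divide)
    have mm: "norm_ineq 9 \<alpha> m" using m 6 by simp
    have "m < 6"
      by (rule degree_bound_quintic[OF mm _ _ \<alpha> v(2,3) _ lo]) (simp_all add: power_divide)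
    thus ?thesis using v 6 by simp
  next
    case 7
    have v: "deg_limit 11 = 5" "totient 11 = 2 * 5" "prime_power_base 11 = 11" by code_simp+
    have lo: "31 / 100 \<le> 4 * sin (pi / real 11) ^ 2" by (rule le_sin2[of _ "157 / 550"]) (simp_all add: power_divide)
    have mm: "norm_ineq 11 \<alpha> m" using m 7 by simp
    have "m < 5"
      by (rule degree_bound_quintic[OF mm _ _ \<alpha> v(2,3) _ lo]) (simp_all add: power_divide)
    thus ?thesis using v 7 by simp
  next
    case 8
    have v: "deg_limit 13 = 4" "totient 13 = 2 * 6" "prime_power_base 13 = 13" by code_simp+
    have lo: "22 / 100 \<le> 4 * sin (pi / real 13) ^ 2" by (rule le_sin2[of _ "157 / 650"]) (simp_all add: power_divide)
    have mm: "norm_ineq 13 \<alpha> m" using m 8 by simp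
    have "m < 4"
      by (rule degree_bound_quintic[OF mm _ _ \<alpha> v(2,3) _ lo]) (simp_all add: power_divide)
    thus ?thesis using v 8 by simp
  next
    case 9
    have v: "deg_limit 17 = 3" "totient 17 = 2 * 8" "prime_power_base 17 = 17" by code_simp+
    have lo: "13 / 100 \<le> 4 * sin (pi / real 17) ^ 2" by (rule le_sin2[of _ "157 / 850"]) (simp_all add: power_divide)
    have mm: "norm_ineq 17 \<alpha> m" using m 9 by simp
    have "m < 3"
      by (rule degree_bound_quintic[OF mm _ _ \<alpha> v(2,3) _ lo]) (simp_all add: power_divide)
    thus ?thesis using v 9 by simp
  next
    case 10
    have v: "deg_limit 37 = 1" "totient 37 = 2 * 18" "prime_power_base 37 = 37" by code_simp+
    have lo: "28 / 1000 \<le> 4 * sin (pi / real 37) ^ 2" by (rule le_sin2[of _ "157 / 1850"]) (simp_all add: power_divide)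
    have mm: "norm_ineq 37 \<alpha> m" using m 10 by simp
    have "m < 1"
      by (rule degree_bound_quintic[OF mm _ _ \<alpha> v(2,3) _ lo]) (simp_all add: power_divide)
    thus ?thesis using v 10 by simp
  qed
qed

theorem theorem4p5:
  fixes d :: nat and \<alpha> :: real
  assumes "d \<ge> 3"
    and "algebraic_int \<alpha>" and "totally_real \<alpha>"
    and "4 < \<alpha>" and "\<alpha> < 16 ^ 2"
    and "\<forall>\<sigma>. real_emb (gen_field (Fd d \<union> {\<alpha>})) \<sigma> \<and>
              (\<exists>x\<in>gen_field (Fd d \<union> {\<alpha>}). \<sigma> x \<noteq> x) \<longrightarrow>
              0 < \<sigma> \<alpha> \<and> \<sigma> \<alpha> < \<sigma> (4 * sin (pi / real d) ^ 2)"
  shows "gen_field (Fd d \<union> {\<alpha>}) = gen_field {\<alpha>} \<and>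
         d \<in> admissible_d \<and>
         fdeg (gen_field (Fd d \<union> {\<alpha>})) (Fd d) \<le> mbound d \<and>
         fdeg (gen_field (Fd d \<union> {\<alpha>})) (gen_field {}) \<le> qbound d"
proof -
  let ?K = "gen_field (Fd d \<union> {\<alpha>})"
  have \<alpha>: "4 < \<alpha>" "\<alpha> < 256" using assms by auto
  obtain m where m: "m > 0" "?K = gen_field {\<alpha>}" "fdeg ?K (Fd d) \<le> m"
    "fdeg ?K (gen_field {}) \<le> m * card (half_totatives d)" "norm_ineq d \<alpha> m"
    using norm_inequality[OF assms(1-4,6)] unfolding norm_ineq_def by metis
  have lim: "m < deg_limit d"
  proof (cases "d < 210")
    case True
    show ?thesis
    proof (cases "d \<in> special_d")
      case True
      thus ?thesis by (rule degree_bound_special[OF m(5) _ \<alpha>])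
    next
      case False
      show ?thesis
        by (rule degree_bound_table[OF m(5) assms(1) \<open>d < 210\<close> table_check[OF assms(1) \<open>d < 210\<close> False] \<alpha>])
    qed
  next
    case False
    hence "m < 1" using degree_bound_large[OF m(5) _ \<alpha>] by simp
    thus ?thesis using m(1) by simp
  qed
  \<comment> \<open>Otherwise \<open>deg_limit d\<close> is 1, contrary to
    \<open>m > 0\<close>.\<close>
  have adm: "d \<in> admissible_d"
    using lim m(1) by (cases "d \<in> admissible_d") (auto simp: deg_limit_def)
  hence mb: "m \<le> mbound d" using lim by (simp add: deg_limit_def)
  have "2 * (m * card (half_totatives d)) = totient d * m"
    using totient_eq_half[OF assms(1)] by simp
  also have "\<dots> \<le> totient d * mbound d" using mb by simp
  also have "\<dots> \<le> 2 * qbound d" by (rule totient_mbound_le_qbound[OF adm])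
  finally have "fdeg ?K (gen_field {}) \<le> qbound d" using m(4) by simp
  thus ?thesis using m(2,3) adm mb by simp
qed

end
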